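(* Let $\mathcal P$ be a nontrivial partial combinatory algebra. Up to isomorphism, the partitioned Herbrand assemblies are the projective objects in the category $\mathbf{HAsm}[\mathcal P]$ of Herbrand assemblies over $\mathcal P$. In particular, $\mathbf{HAsm}[\mathcal P]$ is equivalent to the reg/lex-completion of its full subcategory on the partitioned Herbrand assemblies.
   Context: Fix a standard coding of finite sequences of elements of $\mathcal P$ by elements of $\mathcal P$ (with length, projections, singletons, concatenation etc. represented by elements of $\mathcal P$). For a code $n$, $|n|$ is its length and $n_i$ its $i$th entry. For $A \subseteq \mathcal P$, $!A$ is the set of codes of finite sequences all of whose entries lie in $A$ (including the empty sequence), preordered by: $m \preceq n$ iff for every $i \le |m|$ there is $j \le |n|$ with $m_i = n_j$. A subset $U \subseteq {!A}$ is upwards closed in $!A$ if $m \in U$, $n \in {!A}$, $m \preceq n$ imply $n \in U$; $\uparrow_{!A} m = \{n \in {!A} : m \preceq n\}$. A Herbrand assembly over $\mathcal P$ is a triple $(A, \mathcal A, \alpha)$ with $A$ a set, $\mathcal A \subseteq \mathcal P$, and $\alpha$ assigning to each $a \in A$ an inhabited subset $\alpha(a) \subseteq {!\mathcal A}$ upwards closed in $!\mathcal A$. A morphism $f : (B,\mathcal B,\beta) \to (A,\mathcal A,\alpha)$ is a function $f : B \to A$ for which there is $n \in \mathcal P$ such that $n\cdot m$ is defined and in $!\mathcal A$ for all $m \in {!\mathcal B}$, and $n\cdot m \in \alpha(f(b))$ whenever $b \in B$, $m \in \beta(b)$. These form the category $\mathbf{HAsm}[\mathcal P]$, which is regular. $(A,\mathcal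 A,\alpha)$ is partitioned if for every $a \in A$ there is an element $g_a \in \mathcal A$ with $\alpha(a) = \uparrow_{!\mathcal A}\langle g_a\rangle$, where $\langle g_a\rangle$ is the code of the one-element sequence. Projective means projective with respect to covers (regular epimorphisms). The reg/lex-completion of a category with finite limits is the free regular category on it, in the sense of Carboni. The metatheory includes the axiom of choice. *)

theory Defs
  imports "HOL-Library.FuncSet"
begin

section \<open>Categories, functors, natural transformations\<close>

record ('o, 'm) cat =
  Obj :: "'o set"
  Arr :: "'m set"
  Dom :: "'m \<Rightarrow> 'o"
  Cod :: "'m \<Rightarrow> 'o"
  Ident :: "'o \<Rightarrow> 'm"
  Comp :: "'m \<Rightarrow> 'm \<Rightarrow> 'm"  \<comment> \<open>\<open>Comp C g f\<close> is \<open>g\<close> after \<open>f\<close>\<close>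

definition Hom :: "('o, 'm) cat \<Rightarrow> 'o \<Rightarrow> 'o \<Rightarrow> 'm set" where
  "Hom C X Y = {f \<in> Arr C. Dom C f = X \<and> Cod C f = Y}"

locale category =
  fixes C :: "('o, 'm) cat"
  assumes dom_obj: "f \<in> Arr C \<Longrightarrow> Dom C f \<in> Obj C"
    and cod_obj: "f \<in> Arr C \<Longrightarrow> Cod C f \<in> Obj C"
    and ident_hom: "X \<in> Obj C \<Longrightarrow> Ident C X \<in> Hom C X X"
    and comp_hom: "f \<in> Hom C X Y \<Longrightarrow> g \<in> Hom C Y Z \<Longrightarrow> Comp C g f \<in> Hom C X Z"
    and comp_ident_right: "f \<in> Hom C X Y \<Longrightarrow> Comp C f (Ident C X) = f"
    and comp_ident_left: "f \<in> Hom C X Y \<Longrightarrow> Comp C (Ident C Y) f = f"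
    and comp_assoc: "f \<in> Hom C W X \<Longrightarrow> g \<in> Hom C X Y \<Longrightarrow> h \<in> Hom C Y Z \<Longrightarrow>
      Comp C h (Comp C g f) = Comp C (Comp C h g) f"

definition isomorphic :: "('o, 'm) cat \<Rightarrow> 'o \<Rightarrow> 'o \<Rightarrow> bool" where
  "isomorphic C X Y \<longleftrightarrow> (\<exists>f \<in> Hom C X Y. \<exists>g \<in> Hom C Y X.
     Comp C g f = Ident C X \<and> Comp C f g = Ident C Y)"

definition full_sub :: "('o, 'm) cat \<Rightarrow> 'o set \<Rightarrow> ('o, 'm) cat" where
  "full_sub C S = C\<lparr>Obj := Obj C \<inter> S, Arr := {f \<in> Arr C. Dom C f \<in> S \<and> Cod C f \<in> S}\<rparr>"

text \<open>
  Functors and natural transformations are extensional outside their source category, so that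
  HOL equality is equality of functors and of natural transformations.
\<close>

record ('o, 'm, 'p, 'n) fctr =
  FObj :: "'o \<Rightarrow> 'p"
  FArr :: "'m \<Rightarrow> 'n"

definition is_functor :: "('o, 'm) cat \<Rightarrow> ('p, 'n) cat \<Rightarrow> ('o, 'm, 'p, 'n) fctr \<Rightarrow> bool" where
  "is_functor C D F \<longleftrightarrow> category C \<and> category D \<and>
     FObj F \<in> Obj C \<rightarrow>\<^sub>E Obj D \<and> FArr F \<in> Arr C \<rightarrow>\<^sub>E Arr D \<and>
     (\<forall>X Y. \<forall>f \<in> Hom C X Y. FArr F f \<in> Hom D (FObj F X) (FObj F Y)) \<and>
     (\<forall>X \<in> Obj C. FArr F (Ident C X) = Ident D (FObj F X)) \<and>
     (\<forall>X Y Z. \<forall>f \<in> Hom C X Y. \<forall>g \<in> Hom C Y Z.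
        FArr F (Comp C g f) = Comp D (FArr F g) (FArr F f))"

definition fid :: "('o, 'm) cat \<Rightarrow> ('o, 'm, 'o, 'm) fctr" where
  "fid C = \<lparr>FObj = (\<lambda>X \<in> Obj C. X), FArr = (\<lambda>f \<in> Arr C. f)\<rparr>"

abbreviation inclusion :: "('o, 'm) cat \<Rightarrow> 'o set \<Rightarrow> ('o, 'm, 'o, 'm) fctr" where
  "inclusion C S \<equiv> fid (full_sub C S)"

definition fcomp :: "('o, 'm) cat \<Rightarrow> ('p, 'n, 'q, 'l) fctr \<Rightarrow> ('o, 'm, 'p, 'n) fctr
    \<Rightarrow> ('o, 'm, 'q, 'l) fctr" where
  "fcomp C G F = \<lparr>FObj = compose (Obj C) (FObj G) (FObj F),
                  FArr = compose (Arr C) (FArr G) (FArr F)\<rparr>"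

record ('o, 'm, 'p, 'n) nt =
  NDom :: "('o, 'm, 'p, 'n) fctr"
  NCod :: "('o, 'm, 'p, 'n) fctr"
  NMap :: "'o \<Rightarrow> 'n"

definition nat_trans :: "('o, 'm) cat \<Rightarrow> ('p, 'n) cat \<Rightarrow> ('o, 'm, 'p, 'n) nt \<Rightarrow> bool" where
  "nat_trans C D t \<longleftrightarrow> is_functor C D (NDom t) \<and> is_functor C D (NCod t) \<and>
     NMap t \<in> extensional (Obj C) \<and>
     (\<forall>X \<in> Obj C. NMap t X \<in> Hom D (FObj (NDom t) X) (FObj (NCod t) X)) \<and>
     (\<forall>X Y. \<forall>f \<in> Hom C X Y.
        Comp D (NMap t Y) (FArr (NDom t) f) = Comp D (FArr (NCod t) f) (NMap t X))"

definition functor_cat :: "('o, 'm) cat \<Rightarrow> ('p, 'n) cat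
    \<Rightarrow> (('o, 'm, 'p, 'n) fctr, ('o, 'm, 'p, 'n) nt) cat" where
  "functor_cat C D = \<lparr>
     Obj = {F. is_functor C D F},
     Arr = {t. nat_trans C D t},
     Dom = NDom,
     Cod = NCod,
     Ident = (\<lambda>F. \<lparr>NDom = F, NCod = F, NMap = (\<lambda>X \<in> Obj C. Ident D (FObj F X))\<rparr>),
     Comp = (\<lambda>t s. \<lparr>NDom = NDom s, NCod = NCod t,
                    NMap = (\<lambda>X \<in> Obj C. Comp D (NMap t X) (NMap s X))\<rparr>)\<rparr>"

definition equivalence :: "('o, 'm) cat \<Rightarrow> ('p, 'n) cat \<Rightarrow> ('o, 'm, 'p, 'n) fctr \<Rightarrow> bool" where
  "equivalence C D F \<longleftrightarrow> is_functor C D F \<and> (\<exists>G. is_functor D C G \<and>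
     isomorphic (functor_cat C C) (fcomp C G F) (fid C) \<and>
     isomorphic (functor_cat D D) (fcomp D F G) (fid D))"

definition equivalent_cats :: "('o, 'm) cat \<Rightarrow> ('p, 'n) cat \<Rightarrow> bool" where
  "equivalent_cats C D \<longleftrightarrow> (\<exists>F. equivalence C D F)"


section \<open>Finite limits, regular categories, projective objects\<close>

text \<open>
  Finite diagrams are indexed by finite directed graphs with nodes in \<open>nat\<close>; an edge
  \<open>(i, f, j)\<close> carries the arrow \<open>f\<close> from the object at \<open>i\<close> to the object at \<open>j\<close>.
\<close>

record ('o, 'm) diagram =
  Nodes :: "nat set"
  NObj :: "nat \<Rightarrow> 'o"
  Edges :: "(nat \<times> 'm \<times> nat) set"

definition finite_diagram :: "('o, 'm) cat \<Rightarrow> ('o, 'm) diagram \<Rightarrow> bool" where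
  "finite_diagram C d \<longleftrightarrow> finite (Nodes d) \<and> finite (Edges d) \<and>
     (\<forall>i \<in> Nodes d. NObj d i \<in> Obj C) \<and>
     (\<forall>(i, f, j) \<in> Edges d. i \<in> Nodes d \<and> j \<in> Nodes d \<and> f \<in> Hom C (NObj d i) (NObj d j))"

definition cone :: "('o, 'm) cat \<Rightarrow> ('o, 'm) diagram \<Rightarrow> 'o \<Rightarrow> (nat \<Rightarrow> 'm) \<Rightarrow> bool" where
  "cone C d X p \<longleftrightarrow> X \<in> Obj C \<and> (\<forall>i \<in> Nodes d. p i \<in> Hom C X (NObj d i)) \<and>
     (\<forall>(i, f, j) \<in> Edges d. Comp C f (p i) = p j)"

definition limit_cone :: "('o, 'm) cat \<Rightarrow> ('o, 'm) diagram \<Rightarrow> 'o \<Rightarrow> (nat \<Rightarrow> 'm) \<Rightarrow> bool" where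
  "limit_cone C d X p \<longleftrightarrow> cone C d X p \<and>
     (\<forall>Y q. cone C d Y q \<longrightarrow> (\<exists>!u. u \<in> Hom C Y X \<and> (\<forall>i \<in> Nodes d. Comp C (p i) u = q i)))"

definition lex_category :: "('o, 'm) cat \<Rightarrow> bool" where
  "lex_category C \<longleftrightarrow> category C \<and> (\<forall>d. finite_diagram C d \<longrightarrow> (\<exists>X p. limit_cone C d X p))"

definition map_diagram :: "('o, 'm, 'p, 'n) fctr \<Rightarrow> ('o, 'm) diagram \<Rightarrow> ('p, 'n) diagram" where
  "map_diagram F d = \<lparr>Nodes = Nodes d, NObj = (\<lambda>i. FObj F (NObj d i)),
                      Edges = (\<lambda>(i, f, j). (i, FArr F f, j)) ` Edges d\<rparr>"

definition lex_functor :: "('o, 'm) cat \<Rightarrow> ('p, 'n) cat \<Rightarrow> ('o, 'm, 'p, 'n) fctr \<Rightarrow> bool" where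
  "lex_functor C D F \<longleftrightarrow> is_functor C D F \<and>
     (\<forall>d X p. finite_diagram C d \<and> limit_cone C d X p \<longrightarrow>
        limit_cone D (map_diagram F d) (FObj F X) (\<lambda>i. FArr F (p i)))"

definition coequalizer :: "('o, 'm) cat \<Rightarrow> 'm \<Rightarrow> 'm \<Rightarrow> 'm \<Rightarrow> bool" where
  "coequalizer C u v e \<longleftrightarrow> (\<exists>Z X Y. u \<in> Hom C Z X \<and> v \<in> Hom C Z X \<and> e \<in> Hom C X Y \<and>
     Comp C e u = Comp C e v \<and>
     (\<forall>W. \<forall>h \<in> Hom C X W. Comp C h u = Comp C h v \<longrightarrow> (\<exists>!k. k \<in> Hom C Y W \<and> Comp C k e = h)))"

definition regular_epi :: "('o, 'm) cat \<Rightarrow> 'm \<Rightarrow> bool" where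
  "regular_epi C e \<longleftrightarrow> (\<exists>u v. coequalizer C u v e)"

definition pullback :: "('o, 'm) cat \<Rightarrow> 'm \<Rightarrow> 'm \<Rightarrow> 'm \<Rightarrow> 'm \<Rightarrow> bool" where
  "pullback C f g p q \<longleftrightarrow> (\<exists>X Y Z P. f \<in> Hom C X Z \<and> g \<in> Hom C Y Z \<and>
     p \<in> Hom C P X \<and> q \<in> Hom C P Y \<and> Comp C f p = Comp C g q \<and>
     (\<forall>W. \<forall>a \<in> Hom C W X. \<forall>b \<in> Hom C W Y. Comp C f a = Comp C g b \<longrightarrow>
        (\<exists>!u. u \<in> Hom C W P \<and> Comp C p u = a \<and> Comp C q u = b)))"

definition regular_category :: "('o, 'm) cat \<Rightarrow> bool" where
  "regular_category C \<longleftrightarrow> lex_category C \<and>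
     (\<forall>f p q. pullback C f f p q \<longrightarrow> (\<exists>e. coequalizer C p q e)) \<and>
     (\<forall>f g p q. pullback C f g p q \<and> regular_epi C f \<longrightarrow> regular_epi C q)"

definition regular_functor :: "('o, 'm) cat \<Rightarrow> ('p, 'n) cat \<Rightarrow> ('o, 'm, 'p, 'n) fctr \<Rightarrow> bool" where
  "regular_functor C D F \<longleftrightarrow> lex_functor C D F \<and>
     (\<forall>e. regular_epi C e \<longrightarrow> regular_epi D (FArr F e))"

definition projective :: "('o, 'm) cat \<Rightarrow> 'o \<Rightarrow> bool" where
  "projective C X \<longleftrightarrow> X \<in> Obj C \<and>
     (\<forall>A B e f. e \<in> Hom C B A \<and> regular_epi C e \<and> f \<in> Hom C X A \<longrightarrow>
        (\<exists>h \<in> Hom C X B. Comp C e h = f))"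


section \<open>The reg/lex-completion as a free regular category\<close>

definition Lex :: "('o, 'm) cat \<Rightarrow> ('p, 'n) cat
    \<Rightarrow> (('o, 'm, 'p, 'n) fctr, ('o, 'm, 'p, 'n) nt) cat" where
  "Lex C D = full_sub (functor_cat C D) {F. lex_functor C D F}"

definition Reg :: "('o, 'm) cat \<Rightarrow> ('p, 'n) cat
    \<Rightarrow> (('o, 'm, 'p, 'n) fctr, ('o, 'm, 'p, 'n) nt) cat" where
  "Reg C D = full_sub (functor_cat C D) {F. regular_functor C D F}"

text \<open>The functor \<open>G \<mapsto> G \<circ> H\<close>, for \<open>H\<close> a functor out of \<open>C\<close>, on the functor category \<open>E\<close>.\<close>

definition precomp :: "('o, 'm) cat \<Rightarrow> ('o, 'm, 'r, 's) fctr
    \<Rightarrow> (('r, 's, 'p, 'n) fctr, ('r, 's, 'p, 'n) nt) cat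
    \<Rightarrow> (('r, 's, 'p, 'n) fctr, ('r, 's, 'p, 'n) nt,
         ('o, 'm, 'p, 'n) fctr, ('o, 'm, 'p, 'n) nt) fctr" where
  "precomp C H E = \<lparr>
     FObj = (\<lambda>G \<in> Obj E. fcomp C G H),
     FArr = (\<lambda>t \<in> Arr E. \<lparr>NDom = fcomp C (NDom t) H, NCod = fcomp C (NCod t) H,
                          NMap = compose (Obj C) (NMap t) (FObj H)\<rparr>)\<rparr>"

text \<open>
  A HOL definition cannot quantify over types, so the types of the regular categories \<open>D\<close> against
  which freeness is tested are a parameter. Statements with these types left polymorphic express
  freeness against all regular categories.
\<close>

definition reg_lex_completion :: "('d, 'e) cat itself \<Rightarrow> ('o, 'm) cat \<Rightarrow> ('r, 's) cat
    \<Rightarrow> ('o, 'm, 'r, 's) fctr \<Rightarrow> bool" where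
  "reg_lex_completion T C R H \<longleftrightarrow> lex_category C \<and> regular_category R \<and> lex_functor C R H \<and>
     (\<forall>D :: ('d, 'e) cat. regular_category D \<longrightarrow>
        equivalence (Reg R D) (Lex C D) (precomp C H (Reg R D)))"


section \<open>Partial combinatory algebras and coding of finite sequences\<close>

text \<open>
  Application is a partial binary operation. With its strict extension to \<open>option\<close>,
  HOL equality of expressions is Kleene equality.
\<close>

definition papp :: "('p \<Rightarrow> 'p \<Rightarrow> 'p option) \<Rightarrow> 'p option \<Rightarrow> 'p option \<Rightarrow> 'p option" where
  "papp ap a b = Option.bind a (\<lambda>x. Option.bind b (\<lambda>y. ap x y))"

locale pca =
  fixes ap :: "'p \<Rightarrow> 'p \<Rightarrow> 'p option" and k s :: 'p
  assumes k_app: "papp ap (papp ap (Some k) (Some x)) (Some y) = Some x"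
    and s_defined: "papp ap (papp ap (Some s) (Some x)) (Some y) \<noteq> None"
    and s_app: "papp ap (papp ap (papp ap (Some s) (Some x)) (Some y)) (Some z) =
      papp ap (papp ap (Some x) (Some z)) (papp ap (Some y) (Some z))"
begin

text \<open>Application for use where the value is known to be defined.\<close>

definition app :: "'p \<Rightarrow> 'p \<Rightarrow> 'p" where
  "app a b = the (ap a b)"

definition comb_i :: 'p where
  "comb_i = app (app s k) k"

text \<open>\<open>pair a b\<close> is \<open>\<lambda>z. z a b\<close>.\<close>

definition pair :: "'p \<Rightarrow> 'p \<Rightarrow> 'p" where
  "pair a b = app (app s (app (app s comb_i) (app k a))) (app k b)"

text \<open>Curry numerals: \<open>0\<close> is the identity and \<open>n + 1\<close> is the pair of \<open>false = k i\<close> and \<open>n\<close>.\<close>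

fun numeral_of :: "nat \<Rightarrow> 'p" where
  "numeral_of 0 = comb_i"
| "numeral_of (Suc n) = pair (app k comb_i) (numeral_of n)"

end

locale coded_pca = pca ap k s
  for ap :: "'p \<Rightarrow> 'p \<Rightarrow> 'p option" and k s :: 'p +
  fixes code :: "'p list \<Rightarrow> 'p"
  assumes nontrivial: "\<exists>x y :: 'p. x \<noteq> y"
    and inj_code: "inj code"
    and length_rep: "\<exists>l. \<forall>xs. ap l (code xs) = Some (numeral_of (length xs))"
    and proj_rep: "\<exists>p. \<forall>xs. \<forall>i < length xs.
      papp ap (ap p (code xs)) (Some (numeral_of i)) = Some (xs ! i)"
    and singleton_rep: "\<exists>g. \<forall>x. ap g x = Some (code [x])"
    and concat_rep: "\<exists>c. \<forall>xs ys. papp ap (ap c (code xs)) (Some (code ys)) = Some (code (xs @ ys))"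

definition code_len :: "('p list \<Rightarrow> 'p) \<Rightarrow> 'p \<Rightarrow> nat" where
  "code_len code n = length (inv code n)"

definition code_nth :: "('p list \<Rightarrow> 'p) \<Rightarrow> 'p \<Rightarrow> nat \<Rightarrow> 'p" where
  "code_nth code n i = inv code n ! i"

definition bang :: "('p list \<Rightarrow> 'p) \<Rightarrow> 'p set \<Rightarrow> 'p set" where
  "bang code A = code ` lists A"

definition seq_le :: "('p list \<Rightarrow> 'p) \<Rightarrow> 'p \<Rightarrow> 'p \<Rightarrow> bool" where
  "seq_le code m n \<longleftrightarrow>
     (\<forall>i < code_len code m. \<exists>j < code_len code n. code_nth code m i = code_nth code n j)"

definition upclosed :: "('p list \<Rightarrow> 'p) \<Rightarrow> 'p set \<Rightarrow> 'p set \<Rightarrow> bool" where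
  "upclosed code A U \<longleftrightarrow> U \<subseteq> bang code A \<and>
     (\<forall>m \<in> U. \<forall>n \<in> bang code A. seq_le code m n \<longrightarrow> n \<in> U)"

definition up :: "('p list \<Rightarrow> 'p) \<Rightarrow> 'p set \<Rightarrow> 'p \<Rightarrow> 'p set" where
  "up code A m = {n \<in> bang code A. seq_le code m n}"


section \<open>Herbrand assemblies\<close>

text \<open>
  The underlying sets are sets of elements of a type \<open>'u\<close>, which plays the role of the universe
  of sets.
\<close>

record ('u, 'p) hasm =
  Under :: "'u set"
  Realz :: "'p set"
  Rlz :: "'u \<Rightarrow> 'p set"

definition is_hasm :: "('p list \<Rightarrow> 'p) \<Rightarrow> ('u, 'p) hasm \<Rightarrow> bool" where
  "is_hasm code X \<longleftrightarrow> Rlz X \<in> extensional (Under X) \<and>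
     (\<forall>a \<in> Under X. Rlz X a \<noteq> {} \<and> upclosed code (Realz X) (Rlz X a))"

definition tracks :: "('p \<Rightarrow> 'p \<Rightarrow> 'p option) \<Rightarrow> ('p list \<Rightarrow> 'p) \<Rightarrow> ('u, 'p) hasm \<Rightarrow> ('u, 'p) hasm
    \<Rightarrow> 'p \<Rightarrow> ('u \<Rightarrow> 'u) \<Rightarrow> bool" where
  "tracks ap code Y X n f \<longleftrightarrow>
     (\<forall>m \<in> bang code (Realz Y). \<exists>r \<in> bang code (Realz X). ap n m = Some r) \<and>
     (\<forall>b \<in> Under Y. \<forall>m \<in> Rlz Y b. \<exists>r \<in> Rlz X (f b). ap n m = Some r)"

record ('u, 'p) hmor =
  Src :: "('u, 'p) hasm"
  Tgt :: "('u, 'p) hasm"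
  Fun :: "'u \<Rightarrow> 'u"

definition HAsm :: "('p \<Rightarrow> 'p \<Rightarrow> 'p option) \<Rightarrow> ('p list \<Rightarrow> 'p)
    \<Rightarrow> (('u, 'p) hasm, ('u, 'p) hmor) cat" where
  "HAsm ap code = \<lparr>
     Obj = {X. is_hasm code X},
     Arr = {f. is_hasm code (Src f) \<and> is_hasm code (Tgt f) \<and>
               Fun f \<in> Under (Src f) \<rightarrow>\<^sub>E Under (Tgt f) \<and>
               (\<exists>n. tracks ap code (Src f) (Tgt f) n (Fun f))},
     Dom = Src,
     Cod = Tgt,
     Ident = (\<lambda>X. \<lparr>Src = X, Tgt = X, Fun = (\<lambda>a \<in> Under X. a)\<rparr>),
     Comp = (\<lambda>g f. \<lparr>Src = Src f, Tgt = Tgt g, Fun = compose (Under (Src f)) (Fun g) (Fun f)\<rparr>)\<rparr>"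

definition partitioned :: "('p list \<Rightarrow> 'p) \<Rightarrow> ('u, 'p) hasm \<Rightarrow> bool" where
  "partitioned code X \<longleftrightarrow> is_hasm code X \<and>
     (\<forall>a \<in> Under X. \<exists>g \<in> Realz X. Rlz X a = up code (Realz X) (code [g]))"

abbreviation PHAsm :: "('p \<Rightarrow> 'p \<Rightarrow> 'p option) \<Rightarrow> ('p list \<Rightarrow> 'p)
    \<Rightarrow> (('u, 'p) hasm, ('u, 'p) hmor) cat" where
  "PHAsm ap code \<equiv> full_sub (HAsm ap code) {X. partitioned code X}"

end

theory Submission
  imports Defs
begin

text \<open>
  For the general part, let \<open>R\<close> be a regular category with a full subcategory \<open>S\<close> of projectives that
  is closed under finite limits, such that every object is covered by an object of \<open>S\<close> and embeds
  into one. Then every object \<open>X\<close> is the image of an arrow \<open>P \<rightarrow> X \<rightarrow> Q\<close> of \<open>S\<close>, and a finite limit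
  preserving functor \<open>F\<close> from \<open>S\<close> to a regular category extends to \<open>R\<close> by sending \<open>X\<close> to the image of
  the value of \<open>F\<close> at this arrow. Finite limits and regular epimorphisms are preserved because the kernel
  pair of \<open>P \<rightarrow> Q\<close> lies in \<open>S\<close>.

  A partitioned Herbrand assembly is projective because a realizer for the lift may be applied to each
  entry of a sequence separately and the results concatenated: upward closure makes one
  correct entry suffice. An assembly \<open>(A, \<A>, \<alpha>)\<close> is covered by the pairs \<open>(a, m)\<close> with \<open>m \<in> \<alpha>(a)\<close>,
  realized by \<open>\<langle>m\<rangle>\<close>, and it embeds into the assembly on \<open>A\<close> in which all elements have the same
  realizers. A projective assembly is a retract of its cover, and a retract of a partitioned
  assembly is a subassembly with the inherited realizers.
\<close>

section \<open>Categories\<close>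

text \<open>The embedding of \<open>X\<close> is what makes the extension computable from
  \<open>F\<close>. The kernel pair of a cover \<open>P -> X\<close> need not lie in
  \<open>S\<close>, but a mono \<open>X -> Q\<close> leaves it unchanged and exhibits it as the
  kernel pair of \<open>P -> Q\<close>, a finite limit of a diagram in \<open>S\<close>. So
  \<open>F\<close> carries inclusions between such kernel pairs to inclusions, and an image in a
  regular category is the quotient by a kernel pair. Every arrow out of an image is obtained from
  such an inclusion, and arguments by elements are carried out after passing to a cover, with a
  descent at the end. For assemblies the ingredient that is not formal is a realizer that maps over
  the entries of a sequence and concatenates the results. Inside the algebra this is a recursion on
  the length, whence the fixed point operator and the numerals. Test categories for freeness range
  over one type at a time, so comparing two completions takes freeness of each at both
  types.\<close>

lemma homD:
  assumes "f \<in> Hom C X Y"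
  shows "f \<in> Arr C" "Dom C f = X" "Cod C f = Y"
  using assms by (auto simp: Hom_def)

context category
begin

lemma hom_obj: "f \<in> Hom C X Y \<Longrightarrow> X \<in> Obj C \<and> Y \<in> Obj C"
  using dom_obj cod_obj by (auto simp: Hom_def)

lemma hom_obj1: "f \<in> Hom C X Y \<Longrightarrow> X \<in> Obj C"
  using hom_obj by blast

lemma arr_hom: "f \<in> Arr C \<Longrightarrow> f \<in> Hom C (Dom C f) (Cod C f)"
  by (simp add: Hom_def)

lemma comp_arr [simp]:
  assumes "f \<in> Arr C" "g \<in> Arr C" "Cod C f = Dom C g"
  shows "Comp C g f \<in> Arr C" "Dom C (Comp C g f) = Dom C f" "Cod C (Comp C g f) = Cod C g"
  using comp_hom[of f "Dom C f" "Cod C f" g "Cod C g"] assms by (auto simp: Hom_def)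

lemma comp_assoc_right [simp]:
  assumes "f \<in> Arr C" "g \<in> Arr C" "h \<in> Arr C" "Cod C f = Dom C g" "Cod C g = Dom C h"
  shows "Comp C (Comp C h g) f = Comp C h (Comp C g f)"
  using comp_assoc[of f "Dom C f" "Cod C f" g "Cod C g" h "Cod C h"] assms by (auto simp: Hom_def)

lemma ident_arr [simp]:
  assumes "X \<in> Obj C"
  shows "Ident C X \<in> Arr C" "Dom C (Ident C X) = X" "Cod C (Ident C X) = X"
  using ident_hom[OF assms] by (auto simp: Hom_def)

lemma comp_id [simp]:
  assumes "f \<in> Arr C"
  shows "Dom C f = X \<Longrightarrow> Comp C f (Ident C X) = f" "Cod C f = X \<Longrightarrow> Comp C (Ident C X) f = f"
  using comp_ident_right[of f X] comp_ident_left[of f _ X] assms by (auto simp: Hom_def)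

text \<open>Precomposition keeps a square commutative. This replaces rewriting modulo associativity:
  the hom-set premises supply the intermediate objects that a rewrite rule would have to
  guess.\<close>

lemma comp_eq_ext:
  assumes "Comp C g f = Comp C g' f'" "x \<in> Hom C W X" "f \<in> Hom C X Y" "g \<in> Hom C Y Z"
    "f' \<in> Hom C X Y'" "g' \<in> Hom C Y' Z"
  shows "Comp C g (Comp C f x) = Comp C g' (Comp C f' x)"
  using comp_assoc[OF assms(2,3,4)] comp_assoc[OF assms(2,5,6)] assms(1) by simp

lemma comp_eq_ext1:
  assumes "Comp C g f = h" "x \<in> Hom C W X" "f \<in> Hom C X Y" "g \<in> Hom C Y Z"
  shows "Comp C g (Comp C f x) = Comp C h x"
  using comp_assoc[OF assms(2,3,4)] assms(1) by simp

end

lemma category_full_sub: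
  assumes "category C"
  shows "category (full_sub C S)"
proof -
  interpret category C by fact
  show ?thesis
    by unfold_locales (auto simp: full_sub_def Hom_def dom_obj cod_obj)
qed

lemma hom_full_sub:
  "Hom (full_sub C S) X Y = (if X \<in> S \<and> Y \<in> S then Hom C X Y else {})"
  by (auto simp: full_sub_def Hom_def)

lemma full_sub_simps [simp]:
  "Obj (full_sub C S) = Obj C \<inter> S" "Comp (full_sub C S) = Comp C"
  "Ident (full_sub C S) = Ident C" "Dom (full_sub C S) = Dom C" "Cod (full_sub C S) = Cod C"
  by (auto simp: full_sub_def)

section \<open>Monomorphisms and isomorphic objects\<close>

definition monic :: "('o, 'm) cat \<Rightarrow> 'm \<Rightarrow> bool" where
  "monic C m \<longleftrightarrow> (\<forall>W. \<forall>a \<in> Hom C W (Dom C m). \<forall>b \<in> Hom C W (Dom C m).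
     Comp C m a = Comp C m b \<longrightarrow> a = b)"

lemma monicD:
  "monic C m \<Longrightarrow> m \<in> Hom C X Y \<Longrightarrow> a \<in> Hom C W X \<Longrightarrow> b \<in> Hom C W X \<Longrightarrow>
     Comp C m a = Comp C m b \<Longrightarrow> a = b"
  by (auto simp: monic_def Hom_def)

lemma monicI:
  "m \<in> Hom C X Y \<Longrightarrow> (\<And>W a b. a \<in> Hom C W X \<Longrightarrow> b \<in> Hom C W X \<Longrightarrow>
     Comp C m a = Comp C m b \<Longrightarrow> a = b) \<Longrightarrow> monic C m"
  by (auto simp: monic_def Hom_def)

lemma isomorphic_sym: "isomorphic C X Y \<Longrightarrow> isomorphic C Y X"
  by (auto simp: isomorphic_def)

lemma (in category) isomorphic_refl: "X \<in> Obj C \<Longrightarrow> isomorphic C X X"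
  unfolding isomorphic_def using ident_hom[of X] comp_ident_left by fastforce

lemma (in category) isomorphic_trans:
  assumes "isomorphic C X Y" "isomorphic C Y Z"
  shows "isomorphic C X Z"
proof -
  obtain f g where 1: "f \<in> Hom C X Y" "g \<in> Hom C Y X" "Comp C g f = Ident C X" "Comp C f g = Ident C Y"
    using assms(1) by (auto simp: isomorphic_def)
  obtain h l where 2: "h \<in> Hom C Y Z" "l \<in> Hom C Z Y" "Comp C l h = Ident C Y" "Comp C h l = Ident C Z"
    using assms(2) by (auto simp: isomorphic_def)
  have a: "Comp C l (Comp C h f) = f"
    using comp_eq_ext1[OF 2(3) 1(1) 2(1,2)] comp_ident_left[OF 1(1)] by simp
  have b: "Comp C f (Comp C g l) = l"
    using comp_eq_ext1[OF 1(4) 2(2) 1(2,1)] comp_ident_left[OF 2(2)] by simp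
  have "Comp C (Comp C g l) (Comp C h f) = Ident C X" "Comp C (Comp C h f) (Comp C g l) = Ident C Z"
    using a b 1 2 homD[OF 1(1)] homD[OF 1(2)] homD[OF 2(1)] homD[OF 2(2)] by simp_all
  moreover have "Comp C h f \<in> Hom C X Z" "Comp C g l \<in> Hom C Z X"
    using comp_hom 1 2 by blast+
  ultimately show ?thesis unfolding isomorphic_def by blast
qed

section \<open>Finite limits\<close>

text \<open>Finite completeness is defined by arbitrary finite diagrams. This shape and the two that
  follow generate all of them and are what is checked in concrete categories.\<close>

definition terminal :: "('o, 'm) cat \<Rightarrow> 'o \<Rightarrow> bool" where
  "terminal C T \<longleftrightarrow> T \<in> Obj C \<and> (\<forall>X \<in> Obj C. \<exists>!u. u \<in> Hom C X T)"

definition product :: "('o, 'm) cat \<Rightarrow> 'o \<Rightarrow> 'o \<Rightarrow> 'o \<Rightarrow> 'm \<Rightarrow> 'm \<Rightarrow> bool" where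
  "product C X Y Z p q \<longleftrightarrow> p \<in> Hom C Z X \<and> q \<in> Hom C Z Y \<and>
     (\<forall>W. \<forall>a \<in> Hom C W X. \<forall>b \<in> Hom C W Y.
        \<exists>!u. u \<in> Hom C W Z \<and> Comp C p u = a \<and> Comp C q u = b)"

definition equalizer :: "('o, 'm) cat \<Rightarrow> 'o \<Rightarrow> 'o \<Rightarrow> 'm \<Rightarrow> 'm \<Rightarrow> 'o \<Rightarrow> 'm \<Rightarrow> bool" where
  "equalizer C X Y f g E e \<longleftrightarrow> f \<in> Hom C X Y \<and> g \<in> Hom C X Y \<and> e \<in> Hom C E X \<and>
     Comp C f e = Comp C g e \<and>
     (\<forall>W. \<forall>a \<in> Hom C W X. Comp C f a = Comp C g a \<longrightarrow> (\<exists>!u. u \<in> Hom C W E \<and> Comp C e u = a))"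

definition prod_diag :: "'o \<Rightarrow> 'o \<Rightarrow> ('o, 'm) diagram" where
  "prod_diag X Y = \<lparr>Nodes = {0, 1}, NObj = (\<lambda>i. if i = 0 then X else Y), Edges = {}\<rparr>"

definition eq_diag :: "'o \<Rightarrow> 'o \<Rightarrow> 'm \<Rightarrow> 'm \<Rightarrow> ('o, 'm) diagram" where
  "eq_diag X Y f g = \<lparr>Nodes = {0, 1}, NObj = (\<lambda>i. if i = 0 then X else Y),
     Edges = {(0, f, 1), (0, g, 1)}\<rparr>"

lemma limit_coneD:
  "limit_cone C d X p \<Longrightarrow> cone C d Y q \<Longrightarrow> \<exists>!u. u \<in> Hom C Y X \<and> (\<forall>i \<in> Nodes d. Comp C (p i) u = q i)"
  by (simp add: limit_cone_def)

lemma map_diagram_simps [simp]: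
  "map_diagram F (prod_diag X Y) = prod_diag (FObj F X) (FObj F Y)"
  "map_diagram F (eq_diag X Y f g) = eq_diag (FObj F X) (FObj F Y) (FArr F f) (FArr F g)"
  by (auto simp: map_diagram_def prod_diag_def eq_diag_def)

lemma finite_prod_diag: "X \<in> Obj C \<Longrightarrow> Y \<in> Obj C \<Longrightarrow> finite_diagram C (prod_diag X Y)"
  by (auto simp: finite_diagram_def prod_diag_def)

lemma (in category) finite_eq_diag:
  "f \<in> Hom C X Y \<Longrightarrow> g \<in> Hom C X Y \<Longrightarrow> finite_diagram C (eq_diag X Y f g)"
  using hom_obj by (fastforce simp: finite_diagram_def eq_diag_def)

lemma limit_cone_empty:
  assumes "Nodes d = {}" "Edges d = {}"
  shows "limit_cone C d X p \<longleftrightarrow> terminal C X"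
  using assms by (auto simp: limit_cone_def cone_def terminal_def)

lemma (in category) limit_cone_prod:
  "limit_cone C (prod_diag X Y) Z p \<longleftrightarrow> product C X Y Z (p 0) (p 1)" (is "?L \<longleftrightarrow> ?R")
proof
  assume L: ?L
  have "\<exists>!u. u \<in> Hom C W Z \<and> Comp C (p 0) u = a \<and> Comp C (p 1) u = b"
    if "a \<in> Hom C W X" "b \<in> Hom C W Y" for W a b
  proof -
    have "cone C (prod_diag X Y) W (\<lambda>i. if i = 0 then a else b)"
      using that hom_obj1[OF that(1)] by (auto simp: cone_def prod_diag_def)
    note limit_coneD[OF L this]
    then show ?thesis by (simp add: prod_diag_def)
  qed
  with L show ?R
    by (auto simp: product_def limit_cone_def cone_def prod_diag_def)
next
  assume R: ?R
  then have "Z \<in> Obj C" using hom_obj1 unfolding product_def by blast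
  with R show ?L
    by (auto simp: product_def limit_cone_def cone_def prod_diag_def)
qed

text \<open>A cone is determined by its leg at node 0, because either edge forces the leg at node 1.
  The second conjunct records this forced value.\<close>

lemma (in category) limit_cone_eq:
  assumes "f \<in> Hom C X Y" "g \<in> Hom C X Y"
  shows "limit_cone C (eq_diag X Y f g) E p \<longleftrightarrow>
    equalizer C X Y f g E (p 0) \<and> p 1 = Comp C f (p 0)" (is "?L \<longleftrightarrow> ?R")
proof
  assume L: ?L
  then have c: "p 0 \<in> Hom C E X" "p 1 = Comp C f (p 0)" "Comp C f (p 0) = Comp C g (p 0)"
    by (auto simp: limit_cone_def cone_def eq_diag_def)
  have "\<exists>!u. u \<in> Hom C W E \<and> Comp C (p 0) u = a"
    if a: "a \<in> Hom C W X" and eq: "Comp C f a = Comp C g a" for W a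
  proof -
    have "cone C (eq_diag X Y f g) W (\<lambda>i. if i = 0 then a else Comp C f a)"
      using a eq comp_hom[OF a assms(1)] hom_obj1[OF a] by (auto simp: cone_def eq_diag_def)
    note ex = limit_coneD[OF L this]
    have "Comp C (p 1) u = Comp C f a" if "u \<in> Hom C W E" "Comp C (p 0) u = a" for u
      using comp_assoc[OF that(1) c(1) assms(1)] c(2) that(2) by simp
    with ex show ?thesis by (auto simp: eq_diag_def)
  qed
  with c assms show ?R by (auto simp: equalizer_def)
next
  assume R: ?R
  then have c: "p 0 \<in> Hom C E X" "p 1 = Comp C f (p 0)" "Comp C f (p 0) = Comp C g (p 0)"
    by (auto simp: equalizer_def)
  have "cone C (eq_diag X Y f g) E p"
    using c comp_hom[OF c(1) assms(1)] hom_obj1[OF c(1)] by (auto simp: cone_def eq_diag_def)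
  moreover have "\<exists>!u. u \<in> Hom C W E \<and> (\<forall>i \<in> Nodes (eq_diag X Y f g). Comp C (p i) u = q i)"
    if q: "cone C (eq_diag X Y f g) W q" for W q
  proof -
    have q': "q 0 \<in> Hom C W X" "Comp C f (q 0) = Comp C g (q 0)" "q 1 = Comp C f (q 0)"
      using q by (auto simp: cone_def eq_diag_def)
    then have "\<exists>!u. u \<in> Hom C W E \<and> Comp C (p 0) u = q 0"
      using R by (auto simp: equalizer_def)
    moreover have "Comp C (p 1) u = q 1" if "u \<in> Hom C W E" "Comp C (p 0) u = q 0" for u
      using comp_assoc[OF that(1) c(1) assms(1)] c(2) that(2) q' by simp
    ultimately show ?thesis by (auto simp: eq_diag_def)
  qed
  ultimately show ?L by (auto simp: limit_cone_def)
qed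

text \<open>The last fact is joint monicity of the projections. Its premise
  \<open>category C\<close> places the composites in hom-sets, so that the universal property can be
  applied to them.\<close>

lemma productD:
  assumes "product C X Y Z p q"
  shows "p \<in> Hom C Z X" "q \<in> Hom C Z Y"
    "a \<in> Hom C W X \<Longrightarrow> b \<in> Hom C W Y \<Longrightarrow> \<exists>u \<in> Hom C W Z. Comp C p u = a \<and> Comp C q u = b"
    "a \<in> Hom C W Z \<Longrightarrow> b \<in> Hom C W Z \<Longrightarrow> Comp C p a = Comp C p b \<Longrightarrow> Comp C q a = Comp C q b \<Longrightarrow>
      category C \<Longrightarrow> a = b"
proof -
  show p: "p \<in> Hom C Z X" and q: "q \<in> Hom C Z Y"
    using assms by (auto simp: product_def)
  show "a \<in> Hom C W X \<Longrightarrow> b \<in> Hom C W Y \<Longrightarrow> \<exists>u \<in> Hom C W Z. Comp C p u = a \<and> Comp C q u = b"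
    using assms unfolding product_def by blast
  assume *: "a \<in> Hom C W Z" "b \<in> Hom C W Z" "Comp C p a = Comp C p b" "Comp C q a = Comp C q b" "category C"
  then have "Comp C p a \<in> Hom C W X" "Comp C q a \<in> Hom C W Y"
    using category.comp_hom[OF *(5)] p q by blast+
  then have "\<exists>!u. u \<in> Hom C W Z \<and> Comp C p u = Comp C p a \<and> Comp C q u = Comp C q a"
    using assms unfolding product_def by blast
  then show "a = b" using * by auto
qed

lemma equalizerD:
  assumes "equalizer C X Y f g E e"
  shows "f \<in> Hom C X Y" "g \<in> Hom C X Y" "e \<in> Hom C E X" "Comp C f e = Comp C g e"
    "a \<in> Hom C W X \<Longrightarrow> Comp C f a = Comp C g a \<Longrightarrow> \<exists>u \<in> Hom C W E. Comp C e u = a"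
    "category C \<Longrightarrow> monic C e"
proof -
  show *: "f \<in> Hom C X Y" "g \<in> Hom C X Y" "e \<in> Hom C E X" "Comp C f e = Comp C g e"
    using assms by (auto simp: equalizer_def)
  show "a \<in> Hom C W X \<Longrightarrow> Comp C f a = Comp C g a \<Longrightarrow> \<exists>u \<in> Hom C W E. Comp C e u = a"
    using assms unfolding equalizer_def by blast
  assume C: "category C"
  show "monic C e"
  proof (rule monicI[OF *(3)])
    fix W a b assume ab: "a \<in> Hom C W E" "b \<in> Hom C W E" "Comp C e a = Comp C e b"
    have "Comp C e a \<in> Hom C W X" "Comp C f (Comp C e a) = Comp C g (Comp C e a)"
      using category.comp_hom[OF C ab(1) *(3)]
        category.comp_eq_ext[OF C *(4) ab(1) *(3,1,3,2)] by auto
    then have "\<exists>!u. u \<in> Hom C W E \<and> Comp C e u = Comp C e a"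
      using assms unfolding equalizer_def by blast
    then show "a = b" using ab by auto
  qed
qed

text \<open>The definition hides the apex behind an existential quantifier. Recovering it as
  \<open>Dom C p\<close> lets all facts about one pullback speak of the same object.\<close>

lemma pullbackD:
  assumes "pullback C f g p q" "f \<in> Hom C X Z" "g \<in> Hom C Y Z"
  shows "p \<in> Hom C (Dom C p) X" "q \<in> Hom C (Dom C p) Y" "Comp C f p = Comp C g q"
    "a \<in> Hom C W X \<Longrightarrow> b \<in> Hom C W Y \<Longrightarrow> Comp C f a = Comp C g b \<Longrightarrow>
      \<exists>u \<in> Hom C W (Dom C p). Comp C p u = a \<and> Comp C q u = b"
proof -
  obtain P where P: "p \<in> Hom C P X" "q \<in> Hom C P Y" "Comp C f p = Comp C g q"
    "\<forall>W. \<forall>a \<in> Hom C W X. \<forall>b \<in> Hom C W Y. Comp C f a = Comp C g b \<longrightarrow>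
        (\<exists>!u. u \<in> Hom C W P \<and> Comp C p u = a \<and> Comp C q u = b)"
  proof -
    obtain X' Y' Z' P where *: "f \<in> Hom C X' Z'" "g \<in> Hom C Y' Z'"
      "p \<in> Hom C P X'" "q \<in> Hom C P Y'" "Comp C f p = Comp C g q"
      "\<forall>W. \<forall>a \<in> Hom C W X'. \<forall>b \<in> Hom C W Y'. Comp C f a = Comp C g b \<longrightarrow>
          (\<exists>!u. u \<in> Hom C W P \<and> Comp C p u = a \<and> Comp C q u = b)"
      using assms(1) unfolding pullback_def by blast
    have "X' = X" "Y' = Y" using *(1,2) assms(2,3) by (auto simp: Hom_def)
    then show thesis using that[of P] *(3-6) by simp
  qed
  then show "p \<in> Hom C (Dom C p) X" "q \<in> Hom C (Dom C p) Y" "Comp C f p = Comp C g q"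
    using homD[OF P(1)] by simp_all
  show "a \<in> Hom C W X \<Longrightarrow> b \<in> Hom C W Y \<Longrightarrow> Comp C f a = Comp C g b \<Longrightarrow>
      \<exists>u \<in> Hom C W (Dom C p). Comp C p u = a \<and> Comp C q u = b"
    using P(4) unfolding homD(2)[OF P(1)] by blast
qed

text \<open>A pair of arrows factors through the product, and it equalizes the two composites
  exactly when the outer square commutes. The product and the equalizer are given data, so the
  construction also applies to their images under a functor.\<close>

lemma (in category) pullback_of_product_equalizer:
  assumes P: "product C X Y Z p q" and f: "f \<in> Hom C X V" and g: "g \<in> Hom C Y V"
    and E: "equalizer C Z V (Comp C f p) (Comp C g q) E e"
  shows "pullback C f g (Comp C p e) (Comp C q e)"
proof -
  note p = productD[OF P] note e = equalizerD[OF E]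
  have c: "category C" by unfold_locales
  have pe: "Comp C p e \<in> Hom C E X" "Comp C q e \<in> Hom C E Y"
    using p(1,2) e(3) comp_hom by blast+
  have eq: "Comp C f (Comp C p e) = Comp C g (Comp C q e)"
    using comp_assoc[OF e(3) p(1) f] comp_assoc[OF e(3) p(2) g] e(4) by simp
  have "\<exists>!u. u \<in> Hom C W E \<and> Comp C (Comp C p e) u = a \<and> Comp C (Comp C q e) u = b"
    if a: "a \<in> Hom C W X" and b: "b \<in> Hom C W Y" and ab: "Comp C f a = Comp C g b" for W a b
  proof -
    obtain t where t: "t \<in> Hom C W Z" "Comp C p t = a" "Comp C q t = b"
      using p(3)[OF a b] by blast
    have "Comp C (Comp C f p) t = Comp C (Comp C g q) t"
      using comp_assoc[OF t(1) p(1) f] comp_assoc[OF t(1) p(2) g] t ab by simp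
    then obtain u where u: "u \<in> Hom C W E" "Comp C e u = t"
      using e(5)[OF t(1)] by blast
    show ?thesis
    proof (rule ex1I[of _ u])
      show "u \<in> Hom C W E \<and> Comp C (Comp C p e) u = a \<and> Comp C (Comp C q e) u = b"
        using u t comp_assoc[OF u(1) e(3) p(1)] comp_assoc[OF u(1) e(3) p(2)] by simp
      fix v assume v: "v \<in> Hom C W E \<and> Comp C (Comp C p e) v = a \<and> Comp C (Comp C q e) v = b"
      then have v1: "v \<in> Hom C W E" by blast
      have "Comp C p (Comp C e v) = a" "Comp C q (Comp C e v) = b"
        using v comp_assoc[OF v1 e(3) p(1)] comp_assoc[OF v1 e(3) p(2)] by simp_all
      then have "Comp C e v = t"
        using p(4)[OF comp_hom[OF v1 e(3)] t(1)] t c by simp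
      then show "v = u" using monicD[OF e(6)[OF c] e(3) v1 u(1)] u by simp
    qed
  qed
  with pe eq f g show ?thesis
    unfolding pullback_def by (intro exI[of _ X] exI[of _ Y] exI[of _ V] exI[of _ E]) simp
qed

section \<open>Construction and transport of limit cones\<close>

lemma limit_cone_cong:
  assumes "limit_cone C d X p" "\<forall>i \<in> Nodes d. p i = p' i"
    "\<forall>(i, f, j) \<in> Edges d. i \<in> Nodes d \<and> j \<in> Nodes d"
  shows "limit_cone C d X p'"
proof -
  have "cone C d X p'"
    using assms unfolding limit_cone_def cone_def by (simp add: case_prod_beta)
  moreover have "(\<forall>i\<in>Nodes d. Comp C (p i) u = q i) = (\<forall>i\<in>Nodes d. Comp C (p' i) u = q i)" for u q
    using assms(2) by auto
  ultimately show ?thesis using assms(1) unfolding limit_cone_def by simp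
qed

text \<open>Together with uniqueness of limits, this lets preservation by a functor be checked on
  one chosen limit cone per diagram.\<close>

lemma (in category) limit_cone_iso:
  assumes L: "limit_cone C d X p" and d: "finite_diagram C d"
    and u: "u \<in> Hom C Y X" and v: "v \<in> Hom C X Y"
    and uv: "Comp C u v = Ident C X" and vu: "Comp C v u = Ident C Y"
    and p': "\<forall>i \<in> Nodes d. p' i = Comp C (p i) u"
  shows "limit_cone C d Y p'"
proof -
  have c: "cone C d X p" using L by (simp add: limit_cone_def)
  have pi: "i \<in> Nodes d \<Longrightarrow> p i \<in> Hom C X (NObj d i)" for i
    using c by (simp add: cone_def)
  have p'i: "i \<in> Nodes d \<Longrightarrow> p' i \<in> Hom C Y (NObj d i)" for i
    using pi p' comp_hom[OF u] by simp
  have edge: "Comp C f (p' i) = p' j" if "(i, f, j) \<in> Edges d" for i f j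
  proof -
    have ij: "i \<in> Nodes d" "j \<in> Nodes d" "f \<in> Hom C (NObj d i) (NObj d j)" "Comp C f (p i) = p j"
      using that d c by (auto simp: finite_diagram_def cone_def)
    then show ?thesis
      using comp_assoc[OF u pi[OF ij(1)] ij(3)] p' by simp
  qed
  have c': "cone C d Y p'"
    using p'i edge hom_obj[OF u] by (auto simp: cone_def)
  have "\<exists>!w. w \<in> Hom C W Y \<and> (\<forall>i\<in>Nodes d. Comp C (p' i) w = q i)" if q: "cone C d W q" for W q
  proof -
    have ex1: "\<exists>!w. w \<in> Hom C W X \<and> (\<forall>i\<in>Nodes d. Comp C (p i) w = q i)"
      using L q by (simp add: limit_cone_def)
    then obtain w where w: "w \<in> Hom C W X" "\<forall>i\<in>Nodes d. Comp C (p i) w = q i" by blast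
    have key: "Comp C (p' i) z = Comp C (p i) (Comp C u z)" if "z \<in> Hom C W Y" "i \<in> Nodes d" for z i
      using comp_assoc[OF that(1) u pi[OF that(2)]] p' that by simp
    have uvw: "Comp C u (Comp C v w) = w"
      using comp_eq_ext1[OF uv w(1) v u] comp_ident_left[OF w(1)] by simp
    show ?thesis
    proof (rule ex1I[of _ "Comp C v w"])
      show "Comp C v w \<in> Hom C W Y \<and> (\<forall>i\<in>Nodes d. Comp C (p' i) (Comp C v w) = q i)"
        using key comp_hom[OF w(1) v] uvw w by simp
      fix z assume z: "z \<in> Hom C W Y \<and> (\<forall>i\<in>Nodes d. Comp C (p' i) z = q i)"
      then have "Comp C u z \<in> Hom C W X \<and> (\<forall>i\<in>Nodes d. Comp C (p i) (Comp C u z) = q i)"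
        using key comp_hom[OF _ u] by auto
      then have "Comp C u z = w" using ex1 w by blast
      then show "z = Comp C v w"
        using z comp_eq_ext1[OF vu _ u v] comp_ident_left[of z W Y] by auto
    qed
  qed
  with c' show ?thesis by (simp add: limit_cone_def)
qed

lemma (in category) limit_cone_unique:
  assumes X: "limit_cone C d X p" and Y: "limit_cone C d Y q"
  obtains u v where "u \<in> Hom C Y X" "v \<in> Hom C X Y" "Comp C u v = Ident C X" "Comp C v u = Ident C Y"
    "\<forall>i \<in> Nodes d. q i = Comp C (p i) u"
proof -
  have cX: "cone C d X p" and cY: "cone C d Y q" using X Y by (auto simp: limit_cone_def)
  have pi: "i \<in> Nodes d \<Longrightarrow> p i \<in> Hom C X (NObj d i)" and qi: "i \<in> Nodes d \<Longrightarrow> q i \<in> Hom C Y (NObj d i)" for i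
    using cX cY by (simp_all add: cone_def)
  obtain u where u: "u \<in> Hom C Y X" "\<forall>i \<in> Nodes d. Comp C (p i) u = q i"
    using limit_coneD[OF X cY] by blast
  obtain v where v: "v \<in> Hom C X Y" "\<forall>i \<in> Nodes d. Comp C (q i) v = p i"
    using limit_coneD[OF Y cX] by blast
  have o: "X \<in> Obj C" "Y \<in> Obj C" using hom_obj[OF u(1)] by auto
  have "\<forall>i \<in> Nodes d. Comp C (p i) (Comp C u v) = p i"
    using comp_assoc[OF v(1) u(1) pi] u v by simp
  moreover have "\<forall>i \<in> Nodes d. Comp C (p i) (Ident C X) = p i"
    using comp_ident_right[OF pi] by blast
  ultimately have 1: "Comp C u v = Ident C X"
    using limit_coneD[OF X cX] comp_hom[OF v(1) u(1)] ident_hom[OF o(1)] by blast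
  have "\<forall>i \<in> Nodes d. Comp C (q i) (Comp C v u) = q i"
    using comp_assoc[OF u(1) v(1) qi] u v by simp
  moreover have "\<forall>i \<in> Nodes d. Comp C (q i) (Ident C Y) = q i"
    using comp_ident_right[OF qi] by blast
  ultimately have 2: "Comp C v u = Ident C Y"
    using limit_coneD[OF Y cY] comp_hom[OF u(1) v(1)] ident_hom[OF o(2)] by blast
  show thesis using that[OF u(1) v(1) 1 2] u by simp
qed

text \<open>An isolated node multiplies the limit by its object. It is the induction step for
  discrete diagrams.\<close>

lemma (in category) limit_cone_insert_node:
  assumes L: "limit_cone C \<lparr>Nodes = N, NObj = O', Edges = {}\<rparr> X p" and i: "i \<notin> N"
    and P: "product C X (O' i) Z u v"
  shows "limit_cone C \<lparr>Nodes = insert i N, NObj = O', Edges = {}\<rparr> Z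
    (\<lambda>j. if j = i then v else Comp C (p j) u)" (is "limit_cone C ?d Z ?p")
proof -
  note P' = productD[OF P]
  have c: "category C" by unfold_locales
  have pj: "j \<in> N \<Longrightarrow> p j \<in> Hom C X (O' j)" for j
    using L by (auto simp: limit_cone_def cone_def)
  have "cone C ?d Z ?p"
    using P'(1,2) comp_hom[OF P'(1) pj] hom_obj1[OF P'(1)] i by (auto simp: cone_def)
  moreover have "\<exists>!w. w \<in> Hom C W Z \<and> (\<forall>j\<in>Nodes ?d. Comp C (?p j) w = q j)" if q: "cone C ?d W q" for W q
  proof -
    have "cone C \<lparr>Nodes = N, NObj = O', Edges = {}\<rparr> W q" using q by (auto simp: cone_def)
    then have ex1: "\<exists>!w. w \<in> Hom C W X \<and> (\<forall>j\<in>N. Comp C (p j) w = q j)"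
      using L by (simp add: limit_cone_def)
    then obtain a where a: "a \<in> Hom C W X" "\<forall>j\<in>N. Comp C (p j) a = q j" by blast
    have qi: "q i \<in> Hom C W (O' i)" using q by (auto simp: cone_def)
    obtain w where w: "w \<in> Hom C W Z" "Comp C u w = a" "Comp C v w = q i"
      using P'(3)[OF a(1) qi] by blast
    have as: "Comp C (Comp C (p j) u) z = Comp C (p j) (Comp C u z)" if "z \<in> Hom C W Z" "j \<in> N" for z j
      using comp_assoc[OF that(1) P'(1) pj[OF that(2)]] by simp
    show ?thesis
    proof (rule ex1I[of _ w])
      show "w \<in> Hom C W Z \<and> (\<forall>j\<in>Nodes ?d. Comp C (?p j) w = q j)"
        using w a as by auto
      fix z assume z: "z \<in> Hom C W Z \<and> (\<forall>j\<in>Nodes ?d. Comp C (?p j) z = q j)"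
      then have z1: "z \<in> Hom C W Z" "Comp C v z = q i" by auto
      have "\<forall>j\<in>N. Comp C (p j) (Comp C u z) = q j" 
      proof
        fix j assume j: "j \<in> N"
        with i have "j \<noteq> i" by blast
        with z j have "Comp C (Comp C (p j) u) z = q j" by fastforce
        then show "Comp C (p j) (Comp C u z) = q j" using as[OF z1(1) j] by simp
      qed
      then have "Comp C u z = a" using ex1 a comp_hom[OF z1(1) P'(1)] by blast
      then show "z = w" using P'(4)[OF z1(1) w(1)] z1 w c by simp
    qed
  qed
  ultimately show ?thesis by (simp add: limit_cone_def)
qed

text \<open>A new edge imposes one more equation between legs, so the limit shrinks to the equalizer
  of the leg at the target and the leg at the source followed by the edge.\<close>

lemma (in category) limit_cone_insert_edge:
  assumes L: "limit_cone C \<lparr>Nodes = N, NObj = O', Edges = E\<rparr> X p"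
    and fin: "finite_diagram C \<lparr>Nodes = N, NObj = O', Edges = insert (i, f, j) E\<rparr>"
    and Q: "equalizer C X (O' j) (Comp C f (p i)) (p j) Z e"
  shows "limit_cone C \<lparr>Nodes = N, NObj = O', Edges = insert (i, f, j) E\<rparr> Z (\<lambda>l. Comp C (p l) e)"
    (is "limit_cone C ?d Z ?p")
proof -
  note e = equalizerD[OF Q]
  have c: "category C" by unfold_locales
  have pj: "l \<in> N \<Longrightarrow> p l \<in> Hom C X (O' l)" for l
    using L by (auto simp: limit_cone_def cone_def)
  have ed: "g \<in> Hom C (O' l) (O' l') \<and> l \<in> N \<and> l' \<in> N" if "(l, g, l') \<in> insert (i,f,j) E" for l g l'
    using fin that by (fastforce simp: finite_diagram_def)
  have pe: "\<forall>(l, g, l') \<in> E. Comp C g (p l) = p l'"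
    using L by (auto simp: limit_cone_def cone_def)
  have edge: "Comp C g (Comp C (p l) e) = Comp C (p l') e" if "(l, g, l') \<in> insert (i,f,j) E" for l g l'
  proof -
    have "Comp C g (Comp C (p l) e) = Comp C (Comp C g (p l)) e"
      using comp_assoc[OF e(3) pj] ed[OF that] by blast
    also have "\<dots> = Comp C (p l') e" using that pe e(4) by auto
    finally show ?thesis .
  qed
  have c1: "cone C ?d Z ?p"
    using pj comp_hom[OF e(3)] hom_obj[OF e(3)] edge unfolding cone_def by auto
  moreover have "\<exists>!w. w \<in> Hom C W Z \<and> (\<forall>l\<in>Nodes ?d. Comp C (?p l) w = q l)" if q: "cone C ?d W q" for W q
  proof -
    have "cone C \<lparr>Nodes = N, NObj = O', Edges = E\<rparr> W q" using q by (auto simp: cone_def)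
    then have ex1: "\<exists>!w. w \<in> Hom C W X \<and> (\<forall>l\<in>N. Comp C (p l) w = q l)"
      using L by (simp add: limit_cone_def)
    then obtain a where a: "a \<in> Hom C W X" "\<forall>l\<in>N. Comp C (p l) a = q l" by blast
    have ij: "i \<in> N" "j \<in> N" "f \<in> Hom C (O' i) (O' j)" using ed by auto
    have "Comp C (Comp C f (p i)) a = Comp C f (q i)"
      using comp_assoc[OF a(1) pj[OF ij(1)] ij(3)] a ij by simp
    also have "\<dots> = Comp C (p j) a" using q a ij by (auto simp: cone_def)
    finally obtain w where w: "w \<in> Hom C W Z" "Comp C e w = a"
      using e(5)[OF a(1)] by blast
    have as: "Comp C (Comp C (p l) e) z = Comp C (p l) (Comp C e z)" if "z \<in> Hom C W Z" "l \<in> N" for z l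
      using comp_assoc[OF that(1) e(3) pj[OF that(2)]] by simp
    show ?thesis
    proof (rule ex1I[of _ w])
      show "w \<in> Hom C W Z \<and> (\<forall>l\<in>Nodes ?d. Comp C (?p l) w = q l)"
        using w a as by auto
      fix z assume z: "z \<in> Hom C W Z \<and> (\<forall>l\<in>Nodes ?d. Comp C (?p l) z = q l)"
      then have z1: "z \<in> Hom C W Z" by blast
      have "\<forall>l\<in>N. Comp C (p l) (Comp C e z) = q l" using as[OF z1] z by simp
      then have "Comp C e z = a" using ex1 a comp_hom[OF z1 e(3)] by blast
      then show "z = w" using monicD[OF e(6)[OF c] e(3) z1 w(1)] w(2) by simp
    qed
  qed
  ultimately show ?thesis by (simp add: limit_cone_def)
qed

section \<open>Functors and preservation of finite limits\<close>

lemma functorD: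
  assumes "is_functor C D F"
  shows "category C" "category D"
    "X \<in> Obj C \<Longrightarrow> FObj F X \<in> Obj D" "f \<in> Arr C \<Longrightarrow> FArr F f \<in> Arr D"
    "f \<in> Hom C X Y \<Longrightarrow> FArr F f \<in> Hom D (FObj F X) (FObj F Y)"
    "X \<in> Obj C \<Longrightarrow> FArr F (Ident C X) = Ident D (FObj F X)"
    "f \<in> Hom C X Y \<Longrightarrow> g \<in> Hom C Y Z \<Longrightarrow> FArr F (Comp C g f) = Comp D (FArr F g) (FArr F f)"
  using assms unfolding is_functor_def by (blast dest: PiE_mem)+

lemma functor_isomorphic:
  assumes F: "is_functor C D F" and "isomorphic C X Y"
  shows "isomorphic D (FObj F X) (FObj F Y)"
proof -
  obtain f g where *: "f \<in> Hom C X Y" "g \<in> Hom C Y X" "Comp C g f = Ident C X" "Comp C f g = Ident C Y"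
    using assms by (auto simp: isomorphic_def)
  have "X \<in> Obj C" "Y \<in> Obj C" using category.hom_obj[OF functorD(1)[OF F] *(1)] by auto
  then have "Comp D (FArr F g) (FArr F f) = Ident D (FObj F X)" "Comp D (FArr F f) (FArr F g) = Ident D (FObj F Y)"
    using functorD(6,7)[OF F] * by metis+
  then show ?thesis using functorD(5)[OF F] * unfolding isomorphic_def by blast
qed

lemma finite_map_diagram:
  assumes F: "is_functor C D F" and d: "finite_diagram C d"
  shows "finite_diagram D (map_diagram F d)"
  using functorD(3,5)[OF F] d by (fastforce simp: finite_diagram_def map_diagram_def)

text \<open>Each premise provides a limit in \<open>C\<close> together with the fact that its image
  is a limit in \<open>D\<close>, so both categories run through the same induction. For an identity
  functor the first conclusion is the usual construction of finite limits from products and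
  equalizers.\<close>

lemma lex_of_products_equalizers:
  assumes F: "is_functor C D F"
    and T: "\<exists>T. terminal C T \<and> terminal D (FObj F T)"
    and P: "\<And>X Y. X \<in> Obj C \<Longrightarrow> Y \<in> Obj C \<Longrightarrow> \<exists>Z p q. product C X Y Z p q \<and>
      product D (FObj F X) (FObj F Y) (FObj F Z) (FArr F p) (FArr F q)"
    and E: "\<And>X Y f g. f \<in> Hom C X Y \<Longrightarrow> g \<in> Hom C X Y \<Longrightarrow> \<exists>Z e. equalizer C X Y f g Z e \<and>
      equalizer D (FObj F X) (FObj F Y) (FArr F f) (FArr F g) (FObj F Z) (FArr F e)"
  shows "lex_category C" "lex_functor C D F"
proof -
  interpret C: category C using functorD(1)[OF F] .
  interpret D: category D using functorD(2)[OF F] .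
  have nodes: "\<exists>X p. limit_cone C \<lparr>Nodes = N, NObj = O', Edges = {}\<rparr> X p \<and>
      limit_cone D (map_diagram F \<lparr>Nodes = N, NObj = O', Edges = {}\<rparr>) (FObj F X) (\<lambda>i. FArr F (p i))"
    if "finite N" "\<forall>i \<in> N. O' i \<in> Obj C" for N and O' :: "nat \<Rightarrow> 'a"
    using that
  proof (induction N)
    case empty
    then show ?case using T by (simp add: limit_cone_empty map_diagram_def)
  next
    case (insert i N)
    then obtain X p where L: "limit_cone C \<lparr>Nodes = N, NObj = O', Edges = {}\<rparr> X p"
      and L': "limit_cone D (map_diagram F \<lparr>Nodes = N, NObj = O', Edges = {}\<rparr>) (FObj F X) (\<lambda>i. FArr F (p i))"
      by auto
    have X: "X \<in> Obj C" using L by (auto simp: limit_cone_def cone_def)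
    obtain Z u v where Z: "product C X (O' i) Z u v"
      "product D (FObj F X) (FObj F (O' i)) (FObj F Z) (FArr F u) (FArr F v)"
      using P[OF X, of "O' i"] insert by auto
    have 1: "limit_cone C \<lparr>Nodes = insert i N, NObj = O', Edges = {}\<rparr> Z
        (\<lambda>j. if j = i then v else Comp C (p j) u)" (is "limit_cone C ?d Z ?p")
      by (rule C.limit_cone_insert_node[OF L insert(2) Z(1)])
    have "limit_cone D \<lparr>Nodes = insert i N, NObj = \<lambda>i. FObj F (O' i), Edges = {}\<rparr> (FObj F Z)
        (\<lambda>j. if j = i then FArr F v else Comp D (FArr F (p j)) (FArr F u))"
      by (rule D.limit_cone_insert_node[where O' = "\<lambda>i. FObj F (O' i)", OF _ insert(2) Z(2)]) (use L' in \<open>simp add: map_diagram_def\<close>)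
    then have "limit_cone D (map_diagram F ?d) (FObj F Z) (\<lambda>j. FArr F (?p j))"
    \<comment> \<open>\<open>back_subst\<close> splits off the identification of the explicit record
      with the image diagram as a separate goal.\<close>
    proof (rule limit_cone_cong[where p = "\<lambda>j. if j = i then FArr F v else Comp D (FArr F (p j)) (FArr F u)",
          OF back_subst[where P = "\<lambda>d. limit_cone D d _ _"]])
      have "p j \<in> Hom C X (O' j)" if "j \<in> N" for j
        using L that by (auto simp: limit_cone_def cone_def)
      then show "\<forall>j\<in>Nodes (map_diagram F ?d). (if j = i then FArr F v else Comp D (FArr F (p j)) (FArr F u))
          = FArr F (?p j)"
        using functorD(7)[OF F productD(1)[OF Z(1)], symmetric] insert.hyps by (auto simp: map_diagram_def)
    qed (auto simp: map_diagram_def)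
    with 1 show ?case by blast
  qed
  \<comment> \<open>All nodes are present before the first edge is added, so the induction is over
    the edge set with the nodes fixed.\<close>
  have edges: "\<exists>X p. limit_cone C \<lparr>Nodes = N, NObj = O', Edges = E'\<rparr> X p \<and>
      limit_cone D (map_diagram F \<lparr>Nodes = N, NObj = O', Edges = E'\<rparr>) (FObj F X) (\<lambda>i. FArr F (p i))"
    if "finite E'" "finite_diagram C \<lparr>Nodes = N, NObj = O', Edges = E'\<rparr>" for N and O' :: "nat \<Rightarrow> 'a" and E'
    using that
  proof (induction E')
    case empty
    then show ?case using nodes[of N O'] by (auto simp: finite_diagram_def)
  next
    case (insert x E')
    obtain i f j where x: "x = (i, f, j)" by (cases x)
    have fin: "finite_diagram C \<lparr>Nodes = N, NObj = O', Edges = E'\<rparr>"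
      using insert.prems by (auto simp: finite_diagram_def)
    obtain X p where L: "limit_cone C \<lparr>Nodes = N, NObj = O', Edges = E'\<rparr> X p"
      and L': "limit_cone D (map_diagram F \<lparr>Nodes = N, NObj = O', Edges = E'\<rparr>) (FObj F X) (\<lambda>i. FArr F (p i))"
      using insert.IH[OF fin] by auto
    have pj: "l \<in> N \<Longrightarrow> p l \<in> Hom C X (O' l)" for l
      using L by (auto simp: limit_cone_def cone_def)
    have f: "i \<in> N" "j \<in> N" "f \<in> Hom C (O' i) (O' j)"
      using insert.prems by (auto simp: finite_diagram_def x)
    obtain Z e where Z: "equalizer C X (O' j) (Comp C f (p i)) (p j) Z e"
      "equalizer D (FObj F X) (FObj F (O' j)) (FArr F (Comp C f (p i))) (FArr F (p j)) (FObj F Z) (FArr F e)"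
      using E[OF C.comp_hom[OF pj[OF f(1)] f(3)] pj[OF f(2)]] by auto
    have 1: "limit_cone C \<lparr>Nodes = N, NObj = O', Edges = insert (i, f, j) E'\<rparr> Z (\<lambda>l. Comp C (p l) e)"
      (is "limit_cone C ?d Z ?p")
      by (rule C.limit_cone_insert_edge[OF L _ Z(1)]) (use insert.prems x in simp)
    have md: "map_diagram F ?d = \<lparr>Nodes = N, NObj = \<lambda>i. FObj F (O' i),
        Edges = insert (i, FArr F f, j) ((\<lambda>(i, f, j). (i, FArr F f, j)) ` E')\<rparr>"
      by (simp add: map_diagram_def)
    have "limit_cone D (map_diagram F ?d) (FObj F Z) (\<lambda>l. Comp D (FArr F (p l)) (FArr F e))"
      unfolding md
    proof (rule D.limit_cone_insert_edge)
      show "limit_cone D \<lparr>Nodes = N, NObj = \<lambda>i. FObj F (O' i),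
          Edges = (\<lambda>(i, f, j). (i, FArr F f, j)) ` E'\<rparr> (FObj F X) (\<lambda>i. FArr F (p i))"
        using L' by (simp add: map_diagram_def)
      show "finite_diagram D \<lparr>Nodes = N, NObj = \<lambda>i. FObj F (O' i),
          Edges = insert (i, FArr F f, j) ((\<lambda>(i, f, j). (i, FArr F f, j)) ` E')\<rparr>"
        using finite_map_diagram[OF F, of ?d] insert.prems x md by simp
      show "equalizer D (FObj F X) (FObj F (O' j)) (Comp D (FArr F f) (FArr F (p i))) (FArr F (p j))
          (FObj F Z) (FArr F e)"
        using Z(2) functorD(7)[OF F pj[OF f(1)] f(3)] by simp
    qed
    then have "limit_cone D (map_diagram F ?d) (FObj F Z) (\<lambda>l. FArr F (?p l))"
    proof (rule limit_cone_cong)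
      show "\<forall>l\<in>Nodes (map_diagram F ?d). Comp D (FArr F (p l)) (FArr F e) = FArr F (?p l)"
        using functorD(7)[OF F equalizerD(3)[OF Z(1)] pj] by (simp add: map_diagram_def)
      show "\<forall>(i, f, j)\<in>Edges (map_diagram F ?d). i \<in> Nodes (map_diagram F ?d) \<and> j \<in> Nodes (map_diagram F ?d)"
        using insert.prems x by (auto simp: finite_diagram_def map_diagram_def)
    qed
    with 1 x show ?case by blast
  qed
  have ex: "\<exists>X p. limit_cone C d X p \<and> limit_cone D (map_diagram F d) (FObj F X) (\<lambda>i. FArr F (p i))"
    if "finite_diagram C d" for d
    by (cases d) (use edges that in \<open>auto simp: finite_diagram_def\<close>)
  then show "lex_category C" using C.category_axioms unfolding lex_category_def by blast
  show "lex_functor C D F"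
    unfolding lex_functor_def
  proof (intro conjI allI impI F)
    \<comment> \<open>An arbitrary limit cone is isomorphic to the one constructed, and
      \<open>F\<close> carries the isomorphism and the legs along.\<close>
    fix d Y q assume d: "finite_diagram C d \<and> limit_cone C d Y q"
    then obtain X p where L: "limit_cone C d X p"
      "limit_cone D (map_diagram F d) (FObj F X) (\<lambda>i. FArr F (p i))" using ex by blast
    obtain u v where uv: "u \<in> Hom C Y X" "v \<in> Hom C X Y" "Comp C u v = Ident C X" "Comp C v u = Ident C Y"
      "\<forall>i \<in> Nodes d. q i = Comp C (p i) u"
      using C.limit_cone_unique[OF L(1)] d by blast
    have o: "X \<in> Obj C" "Y \<in> Obj C" using C.hom_obj[OF uv(1)] by auto
    have pi: "i \<in> Nodes d \<Longrightarrow> p i \<in> Hom C X (NObj d i)" for i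
      using L by (simp add: limit_cone_def cone_def)
    show "limit_cone D (map_diagram F d) (FObj F Y) (\<lambda>i. FArr F (q i))"
    proof (rule D.limit_cone_iso[OF L(2), where u = "FArr F u" and v = "FArr F v"])
      show "finite_diagram D (map_diagram F d)" using finite_map_diagram[OF F] d by blast
      show "FArr F u \<in> Hom D (FObj F Y) (FObj F X)" "FArr F v \<in> Hom D (FObj F X) (FObj F Y)"
        using functorD(5)[OF F] uv by auto
      show "Comp D (FArr F u) (FArr F v) = Ident D (FObj F X)"
        using functorD(7)[OF F uv(2,1)] functorD(6)[OF F o(1)] uv by simp
      show "Comp D (FArr F v) (FArr F u) = Ident D (FObj F Y)"
        using functorD(7)[OF F uv(1,2)] functorD(6)[OF F o(2)] uv by simp
      show "\<forall>i\<in>Nodes (map_diagram F d). FArr F (q i) = Comp D (FArr F (p i)) (FArr F u)"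
        using functorD(7)[OF F uv(1) pi] uv by (simp add: map_diagram_def)
    qed
  qed
qed

lemma lex_categoryD:
  assumes "lex_category C"
  shows "category C" "\<exists>T. terminal C T"
    "X \<in> Obj C \<Longrightarrow> Y \<in> Obj C \<Longrightarrow> \<exists>Z p q. product C X Y Z p q"
    "f \<in> Hom C X Y \<Longrightarrow> g \<in> Hom C X Y \<Longrightarrow> \<exists>E e. equalizer C X Y f g E e"
    "f \<in> Hom C X Z \<Longrightarrow> g \<in> Hom C Y Z \<Longrightarrow> \<exists>p q. pullback C f g p q"
proof -
  show cat: "category C" using assms by (simp add: lex_category_def)
  interpret category C by (rule cat)
  have ex: "\<And>d. finite_diagram C d \<Longrightarrow> \<exists>X p. limit_cone C d X p"
    using assms by (simp add: lex_category_def)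
  show "\<exists>T. terminal C T"
    using ex[of "\<lparr>Nodes = {}, NObj = \<lambda>_. undefined, Edges = {}\<rparr>"]
    by (simp add: limit_cone_empty finite_diagram_def)
  show prod: "X \<in> Obj C \<Longrightarrow> Y \<in> Obj C \<Longrightarrow> \<exists>Z p q. product C X Y Z p q" for X Y
    using ex[OF finite_prod_diag[of X C Y]] unfolding limit_cone_prod by blast
  show eq: "f \<in> Hom C X Y \<Longrightarrow> g \<in> Hom C X Y \<Longrightarrow> \<exists>E e. equalizer C X Y f g E e" for f g X Y
    using ex[OF finite_eq_diag[of f X Y g]] limit_cone_eq[of f X Y g] by blast
  show "\<exists>p q. pullback C f g p q" if f: "f \<in> Hom C X Z" and g: "g \<in> Hom C Y Z"
  proof -
    obtain P p q where P: "product C X Y P p q" using prod[of X Y] hom_obj[OF f] hom_obj[OF g] by blast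
    obtain E e where "equalizer C P Z (Comp C f p) (Comp C g q) E e"
      using eq[OF comp_hom[OF productD(1)[OF P] f] comp_hom[OF productD(2)[OF P] g]] by blast
    then show ?thesis using pullback_of_product_equalizer[OF P f g] by blast
  qed
qed

lemma lex_functorD:
  assumes "lex_functor C D F"
  shows "is_functor C D F" "terminal C T \<Longrightarrow> terminal D (FObj F T)"
    "product C X Y Z p q \<Longrightarrow> product D (FObj F X) (FObj F Y) (FObj F Z) (FArr F p) (FArr F q)"
    "equalizer C X Y f g E e \<Longrightarrow>
      equalizer D (FObj F X) (FObj F Y) (FArr F f) (FArr F g) (FObj F E) (FArr F e)"
proof -
  show F: "is_functor C D F" using assms by (simp add: lex_functor_def)
  interpret C: category C using functorD(1)[OF F] .
  interpret D: category D using functorD(2)[OF F] .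
  have pres: "\<And>d X p. finite_diagram C d \<Longrightarrow> limit_cone C d X p \<Longrightarrow>
        limit_cone D (map_diagram F d) (FObj F X) (\<lambda>i. FArr F (p i))"
    using assms by (simp add: lex_functor_def)
  show "terminal D (FObj F T)" if T: "terminal C T"
    using pres[of "\<lparr>Nodes = {}, NObj = \<lambda>_. undefined, Edges = {}\<rparr>" T] that
    by (simp add: limit_cone_empty finite_diagram_def map_diagram_def)
  show "product D (FObj F X) (FObj F Y) (FObj F Z) (FArr F p) (FArr F q)" if P: "product C X Y Z p q"
  proof -
    have "limit_cone C (prod_diag X Y) Z (\<lambda>i. if i = 0 then p else q)"
      using P by (simp add: C.limit_cone_prod)
    then have "limit_cone D (prod_diag (FObj F X) (FObj F Y)) (FObj F Z) (\<lambda>i. FArr F (if i = 0 then p else q))"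
      using pres[of "prod_diag X Y"] finite_prod_diag[of X C Y] C.hom_obj[OF productD(1)[OF P]]
        C.hom_obj[OF productD(2)[OF P]] by simp
    then show ?thesis by (simp add: D.limit_cone_prod)
  qed
  show "equalizer D (FObj F X) (FObj F Y) (FArr F f) (FArr F g) (FObj F E) (FArr F e)"
    if E: "equalizer C X Y f g E e"
  proof -
    note fg = equalizerD(1,2)[OF E]
    have "limit_cone C (eq_diag X Y f g) E (\<lambda>i. if i = 0 then e else Comp C f e)"
      using E unfolding C.limit_cone_eq[OF fg] by simp
    then have "limit_cone D (eq_diag (FObj F X) (FObj F Y) (FArr F f) (FArr F g)) (FObj F E)
        (\<lambda>i. FArr F (if i = 0 then e else Comp C f e))"
      using pres[OF C.finite_eq_diag[OF fg]] by simp
    then show ?thesis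
      unfolding D.limit_cone_eq[OF functorD(5)[OF F fg(1)] functorD(5)[OF F fg(2)]] by simp
  qed
qed

section \<open>Regular categories\<close>

text \<open>\<open>kle C m n\<close> says that the kernel pair of \<open>m\<close> is contained in that of \<open>n\<close>.\<close>

definition kle :: "('o, 'm) cat \<Rightarrow> 'm \<Rightarrow> 'm \<Rightarrow> bool" where
  "kle C m n \<longleftrightarrow> (\<forall>W. \<forall>a \<in> Hom C W (Dom C m). \<forall>b \<in> Hom C W (Dom C m).
     Comp C m a = Comp C m b \<longrightarrow> Comp C n a = Comp C n b)"

lemma kleI:
  assumes "m \<in> Hom C X Y"
    "\<And>W a b. a \<in> Hom C W X \<Longrightarrow> b \<in> Hom C W X \<Longrightarrow> Comp C m a = Comp C m b \<Longrightarrow> Comp C n a = Comp C n b"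
  shows "kle C m n"
  unfolding kle_def homD(2)[OF assms(1)] using assms(2) by blast

lemma kleD:
  assumes "kle C m n" "m \<in> Hom C X Y" "a \<in> Hom C W X" "b \<in> Hom C W X" "Comp C m a = Comp C m b"
  shows "Comp C n a = Comp C n b"
  using assms(1) unfolding kle_def homD(2)[OF assms(2)] using assms(3-) by blast

lemma coequalizerI:
  assumes "u \<in> Hom C Z X" "v \<in> Hom C Z X" "e \<in> Hom C X Y" "Comp C e u = Comp C e v"
    "\<And>W h. h \<in> Hom C X W \<Longrightarrow> Comp C h u = Comp C h v \<Longrightarrow> \<exists>!k. k \<in> Hom C Y W \<and> Comp C k e = h"
  shows "coequalizer C u v e"
  unfolding coequalizer_def
  by (intro exI[of _ Z] exI[of _ X] exI[of _ Y] conjI allI ballI impI assms)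

lemma coequalizerD:
  assumes "coequalizer C u v e" "e \<in> Hom C X Y"
  shows "u \<in> Hom C (Dom C u) X" "v \<in> Hom C (Dom C u) X" "Comp C e u = Comp C e v"
    "h \<in> Hom C X W \<Longrightarrow> Comp C h u = Comp C h v \<Longrightarrow> \<exists>!k. k \<in> Hom C Y W \<and> Comp C k e = h"
proof -
  obtain Z X' Y' where *: "u \<in> Hom C Z X'" "v \<in> Hom C Z X'" "e \<in> Hom C X' Y'" "Comp C e u = Comp C e v"
    "\<forall>W. \<forall>h \<in> Hom C X' W. Comp C h u = Comp C h v \<longrightarrow> (\<exists>!k. k \<in> Hom C Y' W \<and> Comp C k e = h)"
    using assms(1) unfolding coequalizer_def by blast
  have [simp]: "X' = X" "Y' = Y" "Z = Dom C u" using *(1,3) assms(2) by (auto simp: Hom_def)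
  show "u \<in> Hom C (Dom C u) X" "v \<in> Hom C (Dom C u) X" "Comp C e u = Comp C e v"
    using * by simp_all
  show "h \<in> Hom C X W \<Longrightarrow> Comp C h u = Comp C h v \<Longrightarrow> \<exists>!k. k \<in> Hom C Y W \<and> Comp C k e = h"
    using *(5) by simp
qed

lemma regular_epi_arr: "regular_epi C e \<Longrightarrow> e \<in> Arr C"
  by (auto simp: regular_epi_def coequalizer_def Hom_def)

context category
begin

text \<open>What \<open>f\<close> identifies is also identified by every composite
  \<open>Comp C h f\<close>.\<close>

lemma kle_comp_monic:
  assumes "kle C (Comp C h f) n" "f \<in> Hom C X Y" "h \<in> Hom C Y Z"
  shows "kle C f n"
proof (rule kleI[OF assms(2)])
  fix W a b assume ab: "a \<in> Hom C W X" "b \<in> Hom C W X" "Comp C f a = Comp C f b"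
  have "Comp C (Comp C h f) a = Comp C (Comp C h f) b"
    using comp_assoc[OF ab(1) assms(2,3)] comp_assoc[OF ab(2) assms(2,3)] ab(3) by simp
  then show "Comp C n a = Comp C n b"
    using kleD[OF assms(1) comp_hom[OF assms(2,3)] ab(1,2)] by blast
qed

text \<open>Composing with a mono afterwards does not enlarge the kernel pair, so the inclusion may
  be tested behind \<open>m\<close>.\<close>

lemma kle_monic_cancel:
  assumes "kle C f (Comp C m n)" "f \<in> Hom C X Y" "n \<in> Hom C X U" "m \<in> Hom C U V" "monic C m"
  shows "kle C f n"
proof (rule kleI[OF assms(2)])
  fix W a b assume ab: "a \<in> Hom C W X" "b \<in> Hom C W X" "Comp C f a = Comp C f b"
  have "Comp C (Comp C m n) a = Comp C (Comp C m n) b"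
    using kleD[OF assms(1,2) ab] .
  then have "Comp C m (Comp C n a) = Comp C m (Comp C n b)"
    using comp_assoc[OF ab(1) assms(3,4)] comp_assoc[OF ab(2) assms(3,4)] by simp
  then show "Comp C n a = Comp C n b"
    using monicD[OF assms(5,4)] comp_hom[OF ab(1) assms(3)] comp_hom[OF ab(2) assms(3)] by blast
qed

lemma monic_cancel:
  assumes "monic C (Comp C h f)" "f \<in> Hom C X Y" "h \<in> Hom C Y Z"
  shows "monic C f"
proof (rule monicI[OF assms(2)])
  fix W a b assume ab: "a \<in> Hom C W X" "b \<in> Hom C W X" "Comp C f a = Comp C f b"
  have "Comp C (Comp C h f) a = Comp C (Comp C h f) b"
    using comp_assoc[OF ab(1) assms(2,3)] comp_assoc[OF ab(2) assms(2,3)] ab(3) by simp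
  then show "a = b" using monicD[OF assms(1) comp_hom[OF assms(2,3)] ab(1,2)] by blast
qed

lemma monic_comp:
  assumes "monic C f" "monic C h" "f \<in> Hom C X Y" "h \<in> Hom C Y Z"
  shows "monic C (Comp C h f)"
proof (rule monicI[OF comp_hom[OF assms(3,4)]])
  fix W a b assume ab: "a \<in> Hom C W X" "b \<in> Hom C W X" "Comp C (Comp C h f) a = Comp C (Comp C h f) b"
  then have "Comp C h (Comp C f a) = Comp C h (Comp C f b)"
    using comp_assoc[OF ab(1) assms(3,4)] comp_assoc[OF ab(2) assms(3,4)] by simp
  then have "Comp C f a = Comp C f b"
    using monicD[OF assms(2,4)] comp_hom[OF ab(1) assms(3)] comp_hom[OF ab(2) assms(3)] by blast
  then show "a = b" using monicD[OF assms(1,3) ab(1,2)] by blast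
qed

lemma monic_ident: "X \<in> Obj C \<Longrightarrow> monic C (Ident C X)"
  by (rule monicI[OF ident_hom]) (auto simp: comp_ident_left)

text \<open>A regular epi coequalizes some pair, and that pair belongs to its kernel pair. This is
  how arrows out of quotients and images are constructed throughout.\<close>

lemma regular_epi_factor:
  assumes "regular_epi C w" "w \<in> Hom C A B" "t \<in> Hom C A Z" "kle C w t"
  obtains d where "d \<in> Hom C B Z" "Comp C d w = t"
proof -
  obtain u v where uv: "coequalizer C u v w" using assms(1) by (auto simp: regular_epi_def)
  note * = coequalizerD[OF uv assms(2)]
  have "Comp C t u = Comp C t v" using kleD[OF assms(4,2) *(1,2,3)] .
  then show thesis using that *(4)[OF assms(3)] by blast
qed

lemma regular_epi_cancel:
  assumes "regular_epi C e" "e \<in> Hom C X Y" "a \<in> Hom C Y W" "b \<in> Hom C Y W" "Comp C a e = Comp C b e"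
  shows "a = b"
proof -
  obtain u v where uv: "coequalizer C u v e" using assms(1) by (auto simp: regular_epi_def)
  note * = coequalizerD[OF uv assms(2)]
  have "Comp C (Comp C a e) u = Comp C (Comp C a e) v"
    using comp_assoc[OF *(1) assms(2,3)] comp_assoc[OF *(2) assms(2,3)] *(3) by simp
  then show ?thesis
    using *(4)[OF comp_hom[OF assms(2,3)]] assms(3-5) by auto
qed

lemma regular_epi_ident:
  assumes "X \<in> Obj C"
  shows "regular_epi C (Ident C X)"
proof -
  have "\<exists>!k. k \<in> Hom C X W \<and> Comp C k (Ident C X) = h" if "h \<in> Hom C X W" for W h
    using that by (intro ex1I[of _ h]) (auto simp: comp_ident_right)
  then have "coequalizer C (Ident C X) (Ident C X) (Ident C X)"
    using ident_hom[OF assms] by (intro coequalizerI[where Z = X and X = X and Y = X]) simp_all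
  then show ?thesis by (auto simp: regular_epi_def)
qed

lemma regular_epi_comp_iso:
  assumes e: "regular_epi C e" "e \<in> Hom C X Y" and m: "m \<in> Hom C Y Z" and d: "d \<in> Hom C Z Y"
    and md: "Comp C m d = Ident C Z" and dm: "Comp C d m = Ident C Y"
  shows "regular_epi C (Comp C m e)"
proof -
  obtain u v where uv: "coequalizer C u v e" using e(1) by (auto simp: regular_epi_def)
  note * = coequalizerD[OF uv e(2)]
  have "Comp C (Comp C m e) u = Comp C (Comp C m e) v"
    using comp_assoc[OF *(1) e(2) m] comp_assoc[OF *(2) e(2) m] *(3) by simp
  moreover have "\<exists>!k. k \<in> Hom C Z W \<and> Comp C k (Comp C m e) = h"
    if h: "h \<in> Hom C X W" and eq: "Comp C h u = Comp C h v" for W h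
  proof -
    obtain l where l: "l \<in> Hom C Y W" "Comp C l e = h" using *(4)[OF h eq] by blast
    have dme: "Comp C d (Comp C m e) = e"
      using comp_eq_ext1[OF dm e(2) m d] comp_ident_left[OF e(2)] by simp
    show ?thesis
    proof (rule ex1I[of _ "Comp C l d"])
      show "Comp C l d \<in> Hom C Z W \<and> Comp C (Comp C l d) (Comp C m e) = h"
        using comp_hom[OF d l(1)] comp_assoc[OF comp_hom[OF e(2) m] d l(1)] dme l(2) by simp
      fix k assume k: "k \<in> Hom C Z W \<and> Comp C k (Comp C m e) = h"
      then have k1: "k \<in> Hom C Z W" by blast
      have "Comp C (Comp C k m) e = Comp C l e"
        using k comp_assoc[OF e(2) m k1] l by simp
      then have "Comp C k m = l"
        using regular_epi_cancel[OF e comp_hom[OF m k1] l(1)] by blast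
      then have "Comp C l d = Comp C k (Comp C m d)"
        using comp_assoc[OF d m k1] by simp
      then show "k = Comp C l d" using md comp_ident_right[OF k1] by simp
    qed
  qed
  ultimately have "coequalizer C u v (Comp C m e)"
    by (intro coequalizerI[OF *(1,2) comp_hom[OF e(2) m]])
  then show ?thesis by (auto simp: regular_epi_def)
qed

text \<open>Since \<open>m\<close> is monic, \<open>g\<close> has the same kernel pair as
  \<open>f\<close> and factors through it. Cancelling the regular epi gives one of the two inverse
  laws, cancelling the mono the other.\<close>

lemma regular_epi_extremal:
  assumes f: "regular_epi C f" and g: "g \<in> Hom C X Y" and m: "m \<in> Hom C Y Z" "monic C m"
    and eq: "Comp C m g = f"
  obtains d where "d \<in> Hom C Z Y" "Comp C m d = Ident C Z" "Comp C d m = Ident C Y"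
proof -
  have fh: "f \<in> Hom C X Z" using comp_hom[OF g m(1)] eq by simp
  have "kle C f g"
  proof (rule kle_monic_cancel[OF _ fh g m])
    show "kle C f (Comp C m g)" using eq by (auto simp: kle_def)
  qed
  then obtain d where d: "d \<in> Hom C Z Y" "Comp C d f = g"
    using regular_epi_factor[OF f fh g] by blast
  have o: "Y \<in> Obj C" "Z \<in> Obj C" using hom_obj[OF m(1)] by auto
  have "Comp C (Comp C m d) f = Comp C (Ident C Z) f"
    using comp_assoc[OF fh d(1) m(1)] d eq comp_ident_left[OF fh] by simp
  then have 1: "Comp C m d = Ident C Z"
    using regular_epi_cancel[OF f fh comp_hom[OF d(1) m(1)] ident_hom[OF o(2)]] by blast
  have "Comp C m (Comp C d m) = Comp C m (Ident C Y)"
    using comp_eq_ext1[OF 1 m(1) d(1) m(1)] comp_ident_left[OF m(1)] comp_ident_right[OF m(1)] by simp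
  then have "Comp C d m = Ident C Y"
    using monicD[OF m(2,1) comp_hom[OF m(1) d(1)] ident_hom[OF o(1)]] by blast
  with 1 d(1) that show thesis by blast
qed

end

lemma kernel_pair:
  assumes "lex_category C" "f \<in> Hom C X Y"
  obtains K p q where "pullback C f f p q" "p \<in> Hom C K X" "q \<in> Hom C K X" "Comp C f p = Comp C f q"
    "\<And>W a b. a \<in> Hom C W X \<Longrightarrow> b \<in> Hom C W X \<Longrightarrow> Comp C f a = Comp C f b \<Longrightarrow>
      \<exists>z \<in> Hom C W K. Comp C p z = a \<and> Comp C q z = b"
proof -
  obtain p q where "pullback C f f p q" using lex_categoryD(5)[OF assms(1,2,2)] by blast
  note * = pullbackD[OF this assms(2,2)]
  show thesis
    by (rule that[OF \<open>pullback C f f p q\<close> *(1,2,3)]) (rule *(4))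
qed

section \<open>Covers and images in regular categories\<close>

locale regular_cat =
  fixes C :: "('o, 'm) cat"
  assumes reg: "regular_category C"
begin

lemma lex: "lex_category C"
  using reg by (simp add: regular_category_def)

sublocale category C
  using lex by (simp add: lex_category_def)

lemma pullback_regular_epi: "pullback C f g p q \<Longrightarrow> regular_epi C f \<Longrightarrow> regular_epi C q"
  using reg unfolding regular_category_def by blast

text \<open>Read \<open>u\<close> as an element of \<open>B\<close> at stage \<open>W\<close>: it
  has a preimage under \<open>e\<close> after passing to a cover of the stage. This is the internal
  substitute for choosing preimages.\<close>

lemma cover_lift:
  assumes "regular_epi C e" "e \<in> Hom C A B" "u \<in> Hom C W B"
  obtains W' w u' where "w \<in> Hom C W' W" "regular_epi C w" "u' \<in> Hom C W' A" "Comp C e u' = Comp C u w"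
proof -
  obtain p q where pq: "pullback C e u p q" using lex_categoryD(5)[OF lex assms(2,3)] by blast
  show thesis
    using that[OF pullbackD(2)[OF pq assms(2,3)] pullback_regular_epi[OF pq assms(1)]
        pullbackD(1,3)[OF pq assms(2,3)]] .
qed

text \<open>Two elements of \<open>I\<close> that \<open>h\<close> identifies lift to
  \<open>A\<close> at a common cover of their stage. There the hypothesis identifies their images
  under \<open>e\<close>, and the covers are cancelled.\<close>

lemma monic_of_kle:
  assumes e: "regular_epi C e" "e \<in> Hom C A I" and h: "h \<in> Hom C I Q" and k: "kle C (Comp C h e) e"
  shows "monic C h"
proof (rule monicI[OF h])
  fix W a b assume ab: "a \<in> Hom C W I" "b \<in> Hom C W I" "Comp C h a = Comp C h b"
  obtain V v a' where v: "v \<in> Hom C V W" "regular_epi C v" "a' \<in> Hom C V A" "Comp C e a' = Comp C a v"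
    using cover_lift[OF e ab(1)] .
  have bv: "Comp C b v \<in> Hom C V I" using comp_hom[OF v(1) ab(2)] .
  \<comment> \<open>The second lift is taken over the cover produced by the first, so that both
    lifts live at stage \<open>U\<close>.\<close>
  obtain U u b' where u: "u \<in> Hom C U V" "regular_epi C u" "b' \<in> Hom C U A"
      "Comp C e b' = Comp C (Comp C b v) u"
    using cover_lift[OF e bv] .
  have a'u: "Comp C a' u \<in> Hom C U A" using comp_hom[OF u(1) v(3)] .
  have *: "Comp C e (Comp C a' u) = Comp C (Comp C a v) u"
    using comp_eq_ext[OF v(4) u(1) v(3) e(2) v(1) ab(1)] comp_assoc[OF u(1) v(1) ab(1)] by simp
  have "Comp C h (Comp C (Comp C a v) u) = Comp C h (Comp C (Comp C b v) u)"
    using ab(3) comp_eq_ext[OF ab(3) comp_hom[OF u(1) v(1)] ab(1) h ab(2) h]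
      comp_assoc[OF u(1) v(1) ab(1)] comp_assoc[OF u(1) v(1) ab(2)] by simp
  then have "Comp C (Comp C h e) (Comp C a' u) = Comp C (Comp C h e) b'"
    using comp_assoc[OF a'u e(2) h] comp_assoc[OF u(3) e(2) h] * u(4) by simp
  then have "Comp C (Comp C a v) u = Comp C (Comp C b v) u"
    using kleD[OF k comp_hom[OF e(2) h] a'u u(3)] * u(4) by simp
  then have "Comp C a v = Comp C b v"
    using regular_epi_cancel[OF u(2,1) comp_hom[OF v(1) ab(1)] bv] by blast
  then show "a = b" using regular_epi_cancel[OF v(2,1) ab(1,2)] by blast
qed

text \<open>The quotient by the kernel pair identifies everything that \<open>f\<close> identifies,
  which is the hypothesis of \<open>monic_of_kle\<close> for the comparison arrow.\<close>

lemma image_factorization: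
  assumes f: "f \<in> Hom C X Y"
  obtains I e m where "e \<in> Hom C X I" "regular_epi C e" "m \<in> Hom C I Y" "monic C m" "Comp C m e = f"
proof -
  obtain K p q where K: "pullback C f f p q" "p \<in> Hom C K X" "q \<in> Hom C K X" "Comp C f p = Comp C f q"
    "\<And>W a b. a \<in> Hom C W X \<Longrightarrow> b \<in> Hom C W X \<Longrightarrow> Comp C f a = Comp C f b \<Longrightarrow>
      \<exists>z \<in> Hom C W K. Comp C p z = a \<and> Comp C q z = b"
    by (rule kernel_pair[OF lex f]) blast
  obtain e where e: "coequalizer C p q e"
    using reg K(1) unfolding regular_category_def by blast
  then have re: "regular_epi C e" by (auto simp: regular_epi_def)
  obtain I where eI: "e \<in> Hom C X I"
    using e homD(3)[OF K(2)] unfolding coequalizer_def Hom_def by auto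
  obtain m where m: "m \<in> Hom C I Y" "Comp C m e = f"
    using coequalizerD(4)[OF e eI f K(4)] by blast
  have "kle C f e"
  proof (rule kleI[OF f])
    fix W a b assume "a \<in> Hom C W X" "b \<in> Hom C W X" "Comp C f a = Comp C f b"
    then obtain z where z: "z \<in> Hom C W K" "Comp C p z = a" "Comp C q z = b" using K(5) by blast
    then show "Comp C e a = Comp C e b"
      using comp_eq_ext[OF coequalizerD(3)[OF e eI] z(1) K(2) eI K(3) eI] by simp
  qed
  then have "monic C m" using monic_of_kle[OF re eI m(1)] m(2) by simp
  with that eI re m show thesis by blast
qed

text \<open>The mono part of the image of \<open>h\<close> receives a regular epi through
  \<open>a\<close>, so it is invertible and \<open>h\<close> agrees with its regular epi part up to
  isomorphism.\<close>

lemma regular_epi_right_cancel: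
  assumes "regular_epi C (Comp C h a)" "a \<in> Hom C X Y" "h \<in> Hom C Y Z"
  shows "regular_epi C h"
proof -
  obtain I e m where m: "e \<in> Hom C Y I" "regular_epi C e" "m \<in> Hom C I Z" "monic C m" "Comp C m e = h"
    using image_factorization[OF assms(3)] .
  have "Comp C m (Comp C e a) = Comp C h a" using comp_assoc[OF assms(2) m(1,3)] m(5) by simp
  then obtain d where "d \<in> Hom C Z I" "Comp C m d = Ident C Z" "Comp C d m = Ident C I"
    using regular_epi_extremal[OF assms(1) comp_hom[OF assms(2) m(1)] m(3,4)] by blast
  then show ?thesis using regular_epi_comp_iso[OF m(2,1,3)] m(5) by blast
qed

text \<open>The epi part of the image of the composite descends along \<open>f\<close>, so
  \<open>g\<close> factors through the mono part. A mono through which a regular epi factors is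
  invertible.\<close>

lemma regular_epi_comp:
  assumes f: "regular_epi C f" "f \<in> Hom C X Y" and g: "regular_epi C g" "g \<in> Hom C Y Z"
  shows "regular_epi C (Comp C g f)"
proof -
  obtain I e m where m: "e \<in> Hom C X I" "regular_epi C e" "m \<in> Hom C I Z" "monic C m" "Comp C m e = Comp C g f"
    using image_factorization[OF comp_hom[OF f(2) g(2)]] .
  have "kle C f (Comp C g f)"
  proof (rule kleI[OF f(2)])
    fix W a b assume ab: "a \<in> Hom C W X" "b \<in> Hom C W X" "Comp C f a = Comp C f b"
    then show "Comp C (Comp C g f) a = Comp C (Comp C g f) b"
      using comp_assoc[OF ab(1) f(2) g(2)] comp_assoc[OF ab(2) f(2) g(2)] by simp
  qed
  then have "kle C f e" using kle_monic_cancel[OF _ f(2) m(1,3,4)] m(5) by simp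
  then obtain d where d: "d \<in> Hom C Y I" "Comp C d f = e"
    using regular_epi_factor[OF f m(1)] by blast
  have "Comp C (Comp C m d) f = Comp C g f"
    using comp_assoc[OF f(2) d(1) m(3)] d(2) m(5) by simp
  then have "Comp C m d = g"
    using regular_epi_cancel[OF f comp_hom[OF d(1) m(3)] g(2)] by blast
  then obtain d' where "d' \<in> Hom C Z I" "Comp C m d' = Ident C Z" "Comp C d' m = Ident C I"
    using regular_epi_extremal[OF g(1) d(1) m(3,4)] by blast
  then show ?thesis using regular_epi_comp_iso[OF m(2,1,3)] m(5) by simp
qed

text \<open>Two elements are lifted at a common cover of their stage; this serves existence of
  pairings into a product.\<close>

lemma cover_lift2:
  assumes e: "regular_epi C e" "e \<in> Hom C A B" "u \<in> Hom C W B"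
    and e': "regular_epi C e'" "e' \<in> Hom C A' B'" "v \<in> Hom C W B'"
  obtains W' w u' v' where "w \<in> Hom C W' W" "regular_epi C w" "u' \<in> Hom C W' A" "Comp C e u' = Comp C u w"
    "v' \<in> Hom C W' A'" "Comp C e' v' = Comp C v w"
proof -
  obtain W1 w1 u1 where 1: "w1 \<in> Hom C W1 W" "regular_epi C w1" "u1 \<in> Hom C W1 A" "Comp C e u1 = Comp C u w1"
    using cover_lift[OF e] .
  obtain W2 w2 v2 where 2: "w2 \<in> Hom C W2 W1" "regular_epi C w2" "v2 \<in> Hom C W2 A'"
      "Comp C e' v2 = Comp C (Comp C v w1) w2"
    using cover_lift[OF e'(1,2) comp_hom[OF 1(1) e'(3)]] .
  show thesis
  proof (rule that)
    show "Comp C w1 w2 \<in> Hom C W2 W" using comp_hom[OF 2(1) 1(1)] .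
    show "regular_epi C (Comp C w1 w2)" using regular_epi_comp[OF 2(2,1) 1(2,1)] .
    show "Comp C u1 w2 \<in> Hom C W2 A" using comp_hom[OF 2(1) 1(3)] .
    show "Comp C e (Comp C u1 w2) = Comp C u (Comp C w1 w2)"
      using comp_eq_ext[OF 1(4) 2(1) 1(3) e(2) 1(1) e(3)] .
    show "v2 \<in> Hom C W2 A'" by fact
    show "Comp C e' v2 = Comp C v (Comp C w1 w2)"
      using 2(4) comp_assoc[OF 2(1) 1(1) e'(3)] by simp
  qed
qed

end

text \<open>The kernel pair is built from a product and an equalizer in \<open>P\<close>, both of
  which \<open>F\<close> preserves. What is exported is the pair in \<open>P\<close> and the
  existence half of the universal property of its image.\<close>

lemma lex_functor_kernel_pair:
  assumes P: "lex_category P" and F: "lex_functor P D F" and m: "m \<in> Hom P X Q"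
  obtains K p q where "p \<in> Hom P K X" "q \<in> Hom P K X" "Comp P m p = Comp P m q"
    "\<And>W a b. a \<in> Hom D W (FObj F X) \<Longrightarrow> b \<in> Hom D W (FObj F X) \<Longrightarrow>
      Comp D (FArr F m) a = Comp D (FArr F m) b \<Longrightarrow>
      \<exists>z \<in> Hom D W (FObj F K). Comp D (FArr F p) z = a \<and> Comp D (FArr F q) z = b"
proof -
  note F' = lex_functorD(1)[OF F]
  interpret P: category P using functorD(1)[OF F'] .
  interpret D: category D using functorD(2)[OF F'] .
  have X: "X \<in> Obj P" using P.hom_obj1[OF m] .
  obtain Z p q where Z: "product P X X Z p q" using lex_categoryD(3)[OF P X X] by blast
  note pq = productD(1,2)[OF Z]
  obtain K e where K: "equalizer P Z Q (Comp P m p) (Comp P m q) K e"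
    using lex_categoryD(4)[OF P P.comp_hom[OF pq(1) m] P.comp_hom[OF pq(2) m]] by blast
  note e = equalizerD(3)[OF K]
  note pe = P.comp_hom[OF e pq(1)] P.comp_hom[OF e pq(2)]
  have eq: "Comp P m (Comp P p e) = Comp P m (Comp P q e)"
    using P.comp_assoc[OF e pq(1) m] P.comp_assoc[OF e pq(2) m] equalizerD(4)[OF K] by simp
  note Fh = functorD(5)[OF F']
  have pb: "pullback D (FArr F m) (FArr F m) (FArr F (Comp P p e)) (FArr F (Comp P q e))"
    using D.pullback_of_product_equalizer[OF lex_functorD(3)[OF F Z] Fh[OF m] Fh[OF m]]
      lex_functorD(4)[OF F K] functorD(7)[OF F' e pq(1)] functorD(7)[OF F' e pq(2)]
      functorD(7)[OF F' pq(1) m] functorD(7)[OF F' pq(2) m] by simp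
  show thesis
    by (rule that[OF pe eq]) (rule pullbackD(4)[OF pb Fh[OF m] Fh[OF m], unfolded homD(2)[OF Fh[OF pe(1)]]])
qed

text \<open>An inclusion of kernel pairs amounts to one equation on the generic pair
  \<open>p\<close>, \<open>q\<close>. A functor preserves equations, and the image of the generic
  pair is generic again.\<close>

lemma lex_functor_kle:
  assumes P: "lex_category P" and F: "lex_functor P D F"
    and k: "kle P m n" and m: "m \<in> Hom P X Q" and n: "n \<in> Hom P X Q'"
  shows "kle D (FArr F m) (FArr F n)"
proof -
  note F' = lex_functorD(1)[OF F] and Fh = functorD(5)[OF lex_functorD(1)[OF F]]
  interpret D: category D using functorD(2)[OF F'] .
  obtain K p q where pq: "p \<in> Hom P K X" "q \<in> Hom P K X" "Comp P m p = Comp P m q"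
    and K: "\<And>W a b. a \<in> Hom D W (FObj F X) \<Longrightarrow> b \<in> Hom D W (FObj F X) \<Longrightarrow>
      Comp D (FArr F m) a = Comp D (FArr F m) b \<Longrightarrow>
      \<exists>z \<in> Hom D W (FObj F K). Comp D (FArr F p) z = a \<and> Comp D (FArr F q) z = b"
    by (rule lex_functor_kernel_pair[OF P F m]) blast
  have eq: "Comp D (FArr F n) (FArr F p) = Comp D (FArr F n) (FArr F q)"
    using kleD[OF k m pq] functorD(7)[OF F' pq(1) n] functorD(7)[OF F' pq(2) n] by simp
  show ?thesis
  proof (rule kleI[OF Fh[OF m]])
    fix W a b assume "a \<in> Hom D W (FObj F X)" "b \<in> Hom D W (FObj F X)"
      "Comp D (FArr F m) a = Comp D (FArr F m) b"
    then obtain z where z: "z \<in> Hom D W (FObj F K)" "Comp D (FArr F p) z = a" "Comp D (FArr F q) z = b"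
      using K by blast
    then show "Comp D (FArr F n) a = Comp D (FArr F n) b"
      using D.comp_eq_ext[OF eq z(1) Fh[OF pq(1)] Fh[OF n] Fh[OF pq(2)] Fh[OF n]] by simp
  qed
qed

lemma terminal_full_sub: "terminal C T \<Longrightarrow> T \<in> S \<Longrightarrow> terminal (full_sub C S) T"
  by (auto simp: terminal_def hom_full_sub)

lemma product_full_sub:
  "product C X Y Z p q \<Longrightarrow> X \<in> S \<Longrightarrow> Y \<in> S \<Longrightarrow> Z \<in> S \<Longrightarrow> product (full_sub C S) X Y Z p q"
  by (simp add: product_def hom_full_sub)

lemma equalizer_full_sub:
  "equalizer C X Y f g E e \<Longrightarrow> X \<in> S \<Longrightarrow> Y \<in> S \<Longrightarrow> E \<in> S \<Longrightarrow> equalizer (full_sub C S) X Y f g E e"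
  by (simp add: equalizer_def hom_full_sub)

text \<open>This is the retract argument: lift the composite of \<open>t\<close> with
  \<open>g\<close> along \<open>e\<close>, then precompose the lift with \<open>f\<close>.\<close>

lemma (in category) projective_isomorphic:
  assumes P: "projective C P" and i: "isomorphic C X P"
  shows "projective C X"
proof -
  obtain f g where f: "f \<in> Hom C X P" and g: "g \<in> Hom C P X" and gf: "Comp C g f = Ident C X"
    using i by (auto simp: isomorphic_def)
  have "\<exists>h \<in> Hom C X B. Comp C e h = t"
    if e: "e \<in> Hom C B A" "regular_epi C e" and t: "t \<in> Hom C X A" for A B e t
  proof -
    obtain h where h: "h \<in> Hom C P B" "Comp C e h = Comp C t g"
      using P e comp_hom[OF g t] unfolding projective_def by blast
    have "Comp C e (Comp C h f) = Comp C t (Comp C g f)"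
      using comp_eq_ext[OF h(2) f h(1) e(1) g t] .
    then show ?thesis using gf comp_ident_right[OF t] comp_hom[OF f h(1)] by auto
  qed
  then show ?thesis using hom_obj1[OF f] unfolding projective_def by blast
qed

section \<open>Functor categories\<close>

lemma is_functorI:
  assumes "category C" "category D" "FObj F \<in> extensional (Obj C)" "FArr F \<in> extensional (Arr C)"
    and ob: "\<And>X. X \<in> Obj C \<Longrightarrow> FObj F X \<in> Obj D"
    and ar: "\<And>X Y f. f \<in> Hom C X Y \<Longrightarrow> FArr F f \<in> Hom D (FObj F X) (FObj F Y)"
    and "\<And>X. X \<in> Obj C \<Longrightarrow> FArr F (Ident C X) = Ident D (FObj F X)"
    and "\<And>X Y Z f g. f \<in> Hom C X Y \<Longrightarrow> g \<in> Hom C Y Z \<Longrightarrow>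
        FArr F (Comp C g f) = Comp D (FArr F g) (FArr F f)"
  shows "is_functor C D F"
proof -
  have "FArr F f \<in> Arr D" if "f \<in> Arr C" for f
    using ar[OF category.arr_hom[OF assms(1) that]] by (rule homD)
  then show ?thesis
    unfolding is_functor_def PiE_def Pi_def using assms by simp
qed

lemma is_functor_extensional:
  assumes "is_functor C D F"
  shows "FObj F \<in> extensional (Obj C)" "FArr F \<in> extensional (Arr C)"
  using assms by (simp_all add: is_functor_def PiE_def)

lemma functor_eqI:
  assumes "is_functor C D F" "is_functor C D G"
    "\<And>X. X \<in> Obj C \<Longrightarrow> FObj F X = FObj G X" "\<And>f. f \<in> Arr C \<Longrightarrow> FArr F f = FArr G f"
  shows "F = G"
proof -
  have "FObj F = FObj G" "FArr F = FArr G"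
    using is_functor_extensional[OF assms(1)] is_functor_extensional[OF assms(2)] assms(3,4)
    by (auto intro: extensionalityI)
  then show ?thesis by simp
qed

lemma fid_simps [simp]:
  "X \<in> Obj C \<Longrightarrow> FObj (fid C) X = X" "f \<in> Arr C \<Longrightarrow> FArr (fid C) f = f"
  by (simp_all add: fid_def)

lemma fcomp_simps [simp]:
  "X \<in> Obj C \<Longrightarrow> FObj (fcomp C G F) X = FObj G (FObj F X)"
  "f \<in> Arr C \<Longrightarrow> FArr (fcomp C G F) f = FArr G (FArr F f)"
  by (simp_all add: fcomp_def compose_def)

lemma inclusion_functor:
  assumes "category C"
  shows "is_functor (full_sub C S) C (inclusion C S)"
proof -
  interpret category C by fact
  interpret S: category "full_sub C S" by (rule category_full_sub) fact
  show ?thesis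
  proof (rule is_functorI)
    show "FObj (inclusion C S) \<in> extensional (Obj (full_sub C S))" by (simp add: fid_def)
    show "FArr (inclusion C S) \<in> extensional (Arr (full_sub C S))" by (simp add: fid_def)
    show "FArr (inclusion C S) f \<in> Hom C (FObj (inclusion C S) X) (FObj (inclusion C S) Y)"
      if "f \<in> Hom (full_sub C S) X Y" for X Y f
      using that S.hom_obj[OF that] homD(1)[OF that] by (simp add: hom_full_sub split: if_splits)
    show "FArr (inclusion C S) (Comp (full_sub C S) g f) =
        Comp C (FArr (inclusion C S) g) (FArr (inclusion C S) f)"
      if "f \<in> Hom (full_sub C S) X Y" "g \<in> Hom (full_sub C S) Y Z" for X Y Z f g
      using homD(1)[OF that(1)] homD(1)[OF that(2)] homD(1)[OF S.comp_hom[OF that]] by simp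
    show "FArr (inclusion C S) (Ident (full_sub C S) X) = Ident C (FObj (inclusion C S) X)"
      if "X \<in> Obj (full_sub C S)" for X
      using that S.ident_arr(1)[OF that] by simp
  qed (simp_all add: category_axioms S.category_axioms)
qed

text \<open>It makes the identity functor an instance of the inclusion of a full
  subcategory.\<close>

lemma full_sub_UNIV: "full_sub C UNIV = C"
  by (simp add: full_sub_def)

lemma fid_functor: "category C \<Longrightarrow> is_functor C C (fid C)"
  using inclusion_functor[of C UNIV] by (simp add: full_sub_UNIV)

lemma fcomp_functor:
  assumes F: "is_functor C D F" and G: "is_functor D E G"
  shows "is_functor C E (fcomp C G F)"
proof -
  interpret C: category C using functorD(1)[OF F] .
  show ?thesis
  proof (rule is_functorI)
    show "FArr (fcomp C G F) f \<in> Hom E (FObj (fcomp C G F) X) (FObj (fcomp C G F) Y)"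
      if f: "f \<in> Hom C X Y" for X Y f
      using functorD(5)[OF G functorD(5)[OF F f]] homD(1)[OF f] C.hom_obj[OF f] by simp
    show "FArr (fcomp C G F) (Comp C g f) = Comp E (FArr (fcomp C G F) g) (FArr (fcomp C G F) f)"
      if "f \<in> Hom C X Y" "g \<in> Hom C Y Z" for X Y Z f g
      using functorD(7)[OF F that] functorD(7)[OF G functorD(5)[OF F that(1)] functorD(5)[OF F that(2)]]
        homD(1)[OF that(1)] homD(1)[OF that(2)] homD(1)[OF C.comp_hom[OF that]] by simp
  qed (use functorD[OF F] functorD[OF G] in \<open>simp_all add: fcomp_def compose_def\<close>)
qed

lemma fcomp_assoc:
  assumes F: "is_functor C D F"
  shows "fcomp C H (fcomp C G F) = fcomp C (fcomp D H G) F"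
  unfolding fcomp_def using functorD(3,4)[OF F] by (auto simp: compose_def restrict_def fun_eq_iff)

lemma fcomp_fid:
  assumes F: "is_functor C D F"
  shows "fcomp C F (fid C) = F" "fcomp C (fid D) F = F"
proof -
  show "fcomp C F (fid C) = F"
    using fcomp_functor[OF fid_functor F] F functorD(1)[OF F]
    by (intro functor_eqI[where C = C and D = D]) simp_all
  show "fcomp C (fid D) F = F"
    using fcomp_functor[OF F fid_functor] F functorD(2-4)[OF F]
    by (intro functor_eqI[where C = C and D = D]) simp_all
qed

section \<open>Natural transformations and functor categories\<close>

lemma nat_transD:
  assumes "nat_trans C D t"
  shows "is_functor C D (NDom t)" "is_functor C D (NCod t)" "NMap t \<in> extensional (Obj C)"
    "X \<in> Obj C \<Longrightarrow> NMap t X \<in> Hom D (FObj (NDom t) X) (FObj (NCod t) X)"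
    "f \<in> Hom C X Y \<Longrightarrow> Comp D (NMap t Y) (FArr (NDom t) f) = Comp D (FArr (NCod t) f) (NMap t X)"
  using assms unfolding nat_trans_def by blast+

lemma hom_functor_cat:
  "t \<in> Hom (functor_cat C D) F G \<longleftrightarrow> nat_trans C D t \<and> NDom t = F \<and> NCod t = G"
  by (simp add: functor_cat_def Hom_def)

lemma nat_trans_eqI:
  assumes "t \<in> Hom (functor_cat C D) F G" "s \<in> Hom (functor_cat C D) F G"
    "\<And>X. X \<in> Obj C \<Longrightarrow> NMap t X = NMap s X"
  shows "t = s"
proof -
  have "NMap t = NMap s"
    using assms nat_transD(3) unfolding hom_functor_cat by (auto intro!: extensionalityI)
  then show ?thesis using assms(1,2) unfolding hom_functor_cat by simp
qed

lemma functor_cat_simps [simp]: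
  "Obj (functor_cat C D) = {F. is_functor C D F}"
  "X \<in> Obj C \<Longrightarrow> NMap (Comp (functor_cat C D) t s) X = Comp D (NMap t X) (NMap s X)"
  "X \<in> Obj C \<Longrightarrow> NMap (Ident (functor_cat C D) F) X = Ident D (FObj F X)"
  by (simp_all add: functor_cat_def)

lemma category_functor_cat:
  assumes C: "category C" and D: "category D"
  shows "category (functor_cat C D)"
proof -
  interpret C: category C by fact
  interpret D: category D by fact
  let ?E = "functor_cat C D"
  have id: "Ident ?E F \<in> Hom ?E F F" if F: "F \<in> Obj ?E" for F
  proof -
    have F: "is_functor C D F" using F by simp
    have "Comp D (Ident D (FObj F Y)) (FArr F f) = Comp D (FArr F f) (Ident D (FObj F X))"
      if "f \<in> Hom C X Y" for X Y f
      using D.comp_ident_left[OF functorD(5)[OF F that]] D.comp_ident_right[OF functorD(5)[OF F that]] by simp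
    then show ?thesis
      using F functorD(3)[OF F] D.ident_hom C.hom_obj unfolding hom_functor_cat nat_trans_def
      by (simp add: functor_cat_def)
  qed
  have comp: "Comp ?E t s \<in> Hom ?E F H" if s: "s \<in> Hom ?E F G" and t: "t \<in> Hom ?E G H" for F G H s t
  proof -
    have s': "nat_trans C D s" "NDom s = F" "NCod s = G" and t': "nat_trans C D t" "NDom t = G" "NCod t = H"
      using s t by (simp_all add: hom_functor_cat)
    note S = nat_transD[OF s'(1), unfolded s'(2,3)] and T = nat_transD[OF t'(1), unfolded t'(2,3)]
    have "Comp D (NMap (Comp ?E t s) Y) (FArr F f) = Comp D (FArr H f) (NMap (Comp ?E t s) X)"
      if f: "f \<in> Hom C X Y" for X Y f
    proof -
      have o: "X \<in> Obj C" "Y \<in> Obj C" using C.hom_obj[OF f] by auto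
      note sX = S(4)[OF o(1)] and sY = S(4)[OF o(2)] and tX = T(4)[OF o(1)] and tY = T(4)[OF o(2)]
      note Ff = functorD(5)[OF S(1) f] and Gf = functorD(5)[OF S(2) f] and Hf = functorD(5)[OF T(2) f]
      have "Comp D (Comp D (NMap t Y) (NMap s Y)) (FArr F f) = Comp D (NMap t Y) (Comp D (FArr G f) (NMap s X))"
        using D.comp_assoc[OF Ff sY tY] S(5)[OF f] by simp
      also have "\<dots> = Comp D (FArr H f) (Comp D (NMap t X) (NMap s X))"
        using D.comp_eq_ext[OF T(5)[OF f] sX Gf tY tX Hf] .
      finally show ?thesis using o by simp
    qed
    moreover have "NMap (Comp ?E t s) X \<in> Hom D (FObj F X) (FObj H X)" if "X \<in> Obj C" for X
      using D.comp_hom[OF S(4) T(4)] that by simp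
    moreover have "NMap (Comp ?E t s) \<in> extensional (Obj C)" "NDom (Comp ?E t s) = F" "NCod (Comp ?E t s) = H"
      using s' t' by (simp_all add: functor_cat_def)
    ultimately show ?thesis
      using S(1) T(2) by (simp add: hom_functor_cat nat_trans_def)
  qed
  have cp: "NMap t X \<in> Hom D (FObj F X) (FObj G X)" if "t \<in> Hom ?E F G" "X \<in> Obj C" for F G t X
    using that nat_transD(4)[of C D t X] unfolding hom_functor_cat by simp
  have fo: "F \<in> Obj ?E" "G \<in> Obj ?E" if "t \<in> Hom ?E F G" for F G t
    using that nat_transD(1,2)[of C D t] unfolding hom_functor_cat by simp_all
  show ?thesis
  proof
    fix f assume "f \<in> Arr ?E"
    then have "f \<in> Hom ?E (Dom ?E f) (Cod ?E f)" by (simp add: Hom_def)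
    then show "Dom ?E f \<in> Obj ?E" "Cod ?E f \<in> Obj ?E" using fo by blast+
  next
    fix f X Y assume f: "f \<in> Hom ?E X Y"
    show "Comp ?E f (Ident ?E X) = f"
      by (rule nat_trans_eqI[OF comp[OF id[OF fo(1)[OF f]] f] f]) (simp add: D.comp_ident_right[OF cp[OF f]])
    show "Comp ?E (Ident ?E Y) f = f"
      by (rule nat_trans_eqI[OF comp[OF f id[OF fo(2)[OF f]]] f]) (simp add: D.comp_ident_left[OF cp[OF f]])
  next
    fix f g h W X Y Z assume f: "f \<in> Hom ?E W X" and g: "g \<in> Hom ?E X Y" and h: "h \<in> Hom ?E Y Z"
    show "Comp ?E h (Comp ?E g f) = Comp ?E (Comp ?E h g) f"
      by (rule nat_trans_eqI[OF comp[OF comp[OF f g] h] comp[OF f comp[OF g h]]])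
        (simp add: D.comp_assoc[OF cp[OF f] cp[OF g] cp[OF h]])
  qed (use id comp in blast)+
qed

lemma natural_isoI:
  assumes F: "is_functor C D F" and G: "is_functor C D G"
    and a: "\<And>X. X \<in> Obj C \<Longrightarrow> a X \<in> Hom D (FObj F X) (FObj G X)"
    and b: "\<And>X. X \<in> Obj C \<Longrightarrow> b X \<in> Hom D (FObj G X) (FObj F X)"
    and ba: "\<And>X. X \<in> Obj C \<Longrightarrow> Comp D (b X) (a X) = Ident D (FObj F X)"
    and ab: "\<And>X. X \<in> Obj C \<Longrightarrow> Comp D (a X) (b X) = Ident D (FObj G X)"
    and nat: "\<And>X Y f. f \<in> Hom C X Y \<Longrightarrow> Comp D (a Y) (FArr F f) = Comp D (FArr G f) (a X)"
  shows "isomorphic (functor_cat C D) F G"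
proof -
  interpret C: category C using functorD(1)[OF F] .
  interpret D: category D using functorD(2)[OF F] .
  interpret E: category "functor_cat C D" by (intro category_functor_cat C.category_axioms D.category_axioms)
  define t where "t = \<lparr>NDom = F, NCod = G, NMap = restrict a (Obj C)\<rparr>"
  define s where "s = \<lparr>NDom = G, NCod = F, NMap = restrict b (Obj C)\<rparr>"
  \<comment> \<open>Naturality of the inverse components: insert \<open>ab\<close>, move
    \<open>f\<close> across \<open>a\<close> and cancel with \<open>ba\<close>.\<close>
  have "Comp D (b Y) (FArr G f) = Comp D (FArr F f) (b X)" if f: "f \<in> Hom C X Y" for X Y f
  proof -
    have o: "X \<in> Obj C" "Y \<in> Obj C" using C.hom_obj[OF f] by auto
    note Ff = functorD(5)[OF F f] and Gf = functorD(5)[OF G f]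
    have "Comp D (b Y) (FArr G f) = Comp D (b Y) (Comp D (FArr G f) (Comp D (a X) (b X)))"
      using ab[OF o(1)] D.comp_ident_right[OF Gf] by simp
    also have "\<dots> = Comp D (b Y) (Comp D (a Y) (Comp D (FArr F f) (b X)))"
      using D.comp_eq_ext[OF nat[OF f] b[OF o(1)] Ff a[OF o(2)] a[OF o(1)] Gf] by simp
    also have "\<dots> = Comp D (FArr F f) (b X)"
      using D.comp_eq_ext1[OF ba[OF o(2)] D.comp_hom[OF b[OF o(1)] Ff] a[OF o(2)] b[OF o(2)]]
        D.comp_ident_left[OF D.comp_hom[OF b[OF o(1)] Ff]] by simp
    finally show ?thesis .
  qed
  then have s: "s \<in> Hom (functor_cat C D) G F"
    using F G b C.hom_obj unfolding hom_functor_cat nat_trans_def s_def by auto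
  have t: "t \<in> Hom (functor_cat C D) F G"
    using F G a nat C.hom_obj unfolding hom_functor_cat nat_trans_def t_def by auto
  have "Comp (functor_cat C D) s t = Ident (functor_cat C D) F"
    by (rule nat_trans_eqI[OF E.comp_hom[OF t s] E.ident_hom]) (use F ba in \<open>auto simp: t_def s_def\<close>)
  moreover have "Comp (functor_cat C D) t s = Ident (functor_cat C D) G"
    by (rule nat_trans_eqI[OF E.comp_hom[OF s t] E.ident_hom]) (use G ab in \<open>auto simp: t_def s_def\<close>)
  ultimately show ?thesis using s t unfolding isomorphic_def by blast
qed

lemma natural_isoE:
  assumes "isomorphic (functor_cat C D) F G"
  obtains a b where "is_functor C D F" "is_functor C D G"
    "\<And>X. X \<in> Obj C \<Longrightarrow> a X \<in> Hom D (FObj F X) (FObj G X)"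
    "\<And>X. X \<in> Obj C \<Longrightarrow> b X \<in> Hom D (FObj G X) (FObj F X)"
    "\<And>X. X \<in> Obj C \<Longrightarrow> Comp D (b X) (a X) = Ident D (FObj F X)"
    "\<And>X. X \<in> Obj C \<Longrightarrow> Comp D (a X) (b X) = Ident D (FObj G X)"
    "\<And>X Y f. f \<in> Hom C X Y \<Longrightarrow> Comp D (a Y) (FArr F f) = Comp D (FArr G f) (a X)"
proof -
  obtain t s where t: "t \<in> Hom (functor_cat C D) F G" and s: "s \<in> Hom (functor_cat C D) G F"
    and st: "Comp (functor_cat C D) s t = Ident (functor_cat C D) F"
      "Comp (functor_cat C D) t s = Ident (functor_cat C D) G"
    using assms by (auto simp: isomorphic_def)
  have t': "nat_trans C D t" "NDom t = F" "NCod t = G" and s': "nat_trans C D s" "NDom s = G" "NCod s = F"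
    using s t by (simp_all add: hom_functor_cat)
  note S = nat_transD[OF s'(1), unfolded s'(2,3)] and T = nat_transD[OF t'(1), unfolded t'(2,3)]
  show thesis
  proof (rule that[of "NMap t" "NMap s"])
    show "Comp D (NMap s X) (NMap t X) = Ident D (FObj F X)" if "X \<in> Obj C" for X
      using arg_cong[OF st(1), of "\<lambda>t. NMap t X"] that by simp
    show "Comp D (NMap t X) (NMap s X) = Ident D (FObj G X)" if "X \<in> Obj C" for X
      using arg_cong[OF st(2), of "\<lambda>t. NMap t X"] that by simp
  qed (fact S T)+
qed

lemma isomorphic_fcomp_right:
  assumes "isomorphic (functor_cat C D) F G" and L: "is_functor D E L"
  shows "isomorphic (functor_cat C E) (fcomp C L F) (fcomp C L G)"
proof -
  obtain a b where F: "is_functor C D F" and G: "is_functor C D G"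
    and a: "\<And>X. X \<in> Obj C \<Longrightarrow> a X \<in> Hom D (FObj F X) (FObj G X)"
    and b: "\<And>X. X \<in> Obj C \<Longrightarrow> b X \<in> Hom D (FObj G X) (FObj F X)"
    and ba: "\<And>X. X \<in> Obj C \<Longrightarrow> Comp D (b X) (a X) = Ident D (FObj F X)"
    and ab: "\<And>X. X \<in> Obj C \<Longrightarrow> Comp D (a X) (b X) = Ident D (FObj G X)"
    and nat: "\<And>X Y f. f \<in> Hom C X Y \<Longrightarrow> Comp D (a Y) (FArr F f) = Comp D (FArr G f) (a X)"
    using natural_isoE[OF assms(1)] by blast
  interpret C: category C using functorD(1)[OF F] .
  show ?thesis
  proof (rule natural_isoI[where a = "\<lambda>X. FArr L (a X)" and b = "\<lambda>X. FArr L (b X)"])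
    fix X assume X: "X \<in> Obj C"
    show "Comp E (FArr L (b X)) (FArr L (a X)) = Ident E (FObj (fcomp C L F) X)"
      using functorD(7)[OF L a[OF X] b[OF X]] ba[OF X] functorD(6)[OF L functorD(3)[OF F X]] X by simp
    show "Comp E (FArr L (a X)) (FArr L (b X)) = Ident E (FObj (fcomp C L G) X)"
      using functorD(7)[OF L b[OF X] a[OF X]] ab[OF X] functorD(6)[OF L functorD(3)[OF G X]] X by simp
  next
    fix X Y f assume f: "f \<in> Hom C X Y"
    have o: "X \<in> Obj C" "Y \<in> Obj C" using C.hom_obj[OF f] by auto
    show "Comp E (FArr L (a Y)) (FArr (fcomp C L F) f) = Comp E (FArr (fcomp C L G) f) (FArr L (a X))"
      using functorD(7)[OF L functorD(5)[OF F f] a[OF o(2)]]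
        functorD(7)[OF L a[OF o(1)] functorD(5)[OF G f]] nat[OF f] homD(1)[OF f] by simp
  qed (use fcomp_functor[OF F L] fcomp_functor[OF G L] functorD(5)[OF L a] functorD(5)[OF L b] in simp_all)
qed

lemma natural_iso_component:
  assumes "isomorphic (functor_cat C D) F G" "X \<in> Obj C"
  shows "isomorphic D (FObj F X) (FObj G X)"
  using natural_isoE[OF assms(1)] assms(2) unfolding isomorphic_def by metis

section \<open>Equivalences of categories\<close>

lemma isomorphic_full_sub:
  "isomorphic (full_sub C S) X Y \<longleftrightarrow> X \<in> S \<and> Y \<in> S \<and> isomorphic C X Y"
  by (auto simp: isomorphic_def hom_full_sub)

text \<open>With a quasi-inverse \<open>G\<close>, both \<open>X\<close> and \<open>Y\<close> are
  isomorphic to their images under \<open>G\<close> after \<open>F\<close>, and \<open>G\<close>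
  preserves the isomorphism between \<open>FObj F X\<close> and \<open>FObj F Y\<close>.\<close>

lemma equivalence_reflects_isomorphic:
  assumes "equivalence C D F" "X \<in> Obj C" "Y \<in> Obj C" "isomorphic D (FObj F X) (FObj F Y)"
  shows "isomorphic C X Y"
proof -
  obtain G where F: "is_functor C D F" and G: "is_functor D C G"
    and i: "isomorphic (functor_cat C C) (fcomp C G F) (fid C)"
    using assms(1) by (auto simp: equivalence_def)
  interpret C: category C using functorD(1)[OF F] .
  have "isomorphic C (FObj G (FObj F Z)) Z" if "Z \<in> Obj C" for Z
    using natural_iso_component[OF i that] that by simp
  then show ?thesis
    using functor_isomorphic[OF G assms(4)] assms(2,3) C.isomorphic_trans isomorphic_sym by metis
qed

lemma equivalence_essentially_surjective:
  assumes "equivalence C D F" "Y \<in> Obj D"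
  obtains X where "X \<in> Obj C" "isomorphic D (FObj F X) Y"
proof -
  obtain G where F: "is_functor C D F" and G: "is_functor D C G"
    and i: "isomorphic (functor_cat D D) (fcomp D F G) (fid D)"
    using assms(1) by (auto simp: equivalence_def)
  show thesis
    using that[OF functorD(3)[OF G assms(2)]] natural_iso_component[OF i assms(2)] assms(2) by simp
qed

text \<open>Objects are hit up to equality, which fits restriction along an inclusion because the
  extension built below restricts strictly. A quasi-inverse is then found by choosing preimages of
  objects and lifting arrows between them.\<close>

lemma equivalenceI:
  assumes F: "is_functor A B F"
    and surj: "\<And>Y. Y \<in> Obj B \<Longrightarrow> \<exists>X \<in> Obj A. FObj F X = Y"
    and full: "\<And>X Y g. X \<in> Obj A \<Longrightarrow> Y \<in> Obj A \<Longrightarrow> g \<in> Hom B (FObj F X) (FObj F Y) \<Longrightarrow>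
      \<exists>f \<in> Hom A X Y. FArr F f = g"
    and faithful: "\<And>X Y f f'. f \<in> Hom A X Y \<Longrightarrow> f' \<in> Hom A X Y \<Longrightarrow> FArr F f = FArr F f' \<Longrightarrow> f = f'"
  shows "equivalence A B F"
proof -
  interpret A: category A using functorD(1)[OF F] .
  interpret B: category B using functorD(2)[OF F] .
  obtain p where p: "\<And>Y. Y \<in> Obj B \<Longrightarrow> p Y \<in> Obj A" "\<And>Y. Y \<in> Obj B \<Longrightarrow> FObj F (p Y) = Y"
    using surj by metis
  \<comment> \<open>The choice is forced when a lift exists: fullness gives a preimage of
    \<open>g\<close> and faithfulness makes it unique, which yields functoriality.\<close>
  define l where "l X Y g = (SOME f. f \<in> Hom A X Y \<and> FArr F f = g)" for X Y g
  have l: "l X Y g \<in> Hom A X Y" "FArr F (l X Y g) = g"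
    if "X \<in> Obj A" "Y \<in> Obj A" "g \<in> Hom B (FObj F X) (FObj F Y)" for X Y g
  proof -
    have "\<exists>f. f \<in> Hom A X Y \<and> FArr F f = g" using full[OF that] by blast
    from someI_ex[OF this] show "l X Y g \<in> Hom A X Y" "FArr F (l X Y g) = g" by (simp_all add: l_def)
  qed
  define G where "G = \<lparr>FObj = restrict p (Obj B), FArr = \<lambda>g \<in> Arr B. l (p (Dom B g)) (p (Cod B g)) g\<rparr>"
  have Go: "FObj G Y = p Y" if "Y \<in> Obj B" for Y using that by (simp add: G_def)
  have Ga: "FArr G g \<in> Hom A (p X) (p Y)" "FArr F (FArr G g) = g" if g: "g \<in> Hom B X Y" for X Y g
  proof -
    have o: "X \<in> Obj B" "Y \<in> Obj B" using B.hom_obj[OF g] by auto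
    have "FArr G g = l (p X) (p Y) g" using homD[OF g] by (simp add: G_def)
    then show "FArr G g \<in> Hom A (p X) (p Y)" "FArr F (FArr G g) = g"
      using l[OF p(1)[OF o(1)] p(1)[OF o(2)]] g p(2) o by simp_all
  qed
  have G: "is_functor B A G"
  proof (rule is_functorI)
    show "FArr G g \<in> Hom A (FObj G X) (FObj G Y)" if "g \<in> Hom B X Y" for X Y g
      using Ga(1)[OF that] B.hom_obj[OF that] Go by simp
    show "FArr G (Ident B X) = Ident A (FObj G X)" if X: "X \<in> Obj B" for X
    proof (rule faithful)
      show "FArr G (Ident B X) \<in> Hom A (p X) (p X)" using Ga(1)[OF B.ident_hom[OF X]] .
      show "Ident A (FObj G X) \<in> Hom A (p X) (p X)" using A.ident_hom[OF p(1)[OF X]] Go[OF X] by simp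
      show "FArr F (FArr G (Ident B X)) = FArr F (Ident A (FObj G X))"
        using Ga(2)[OF B.ident_hom[OF X]] functorD(6)[OF F p(1)[OF X]] p(2)[OF X] Go[OF X] by simp
    qed
    show "FArr G (Comp B g f) = Comp A (FArr G g) (FArr G f)"
      if f: "f \<in> Hom B X Y" and g: "g \<in> Hom B Y Z" for X Y Z f g
    proof (rule faithful)
      show "FArr G (Comp B g f) \<in> Hom A (p X) (p Z)" using Ga(1)[OF B.comp_hom[OF f g]] .
      show "Comp A (FArr G g) (FArr G f) \<in> Hom A (p X) (p Z)" using A.comp_hom[OF Ga(1)[OF f] Ga(1)[OF g]] .
      show "FArr F (FArr G (Comp B g f)) = FArr F (Comp A (FArr G g) (FArr G f))"
        using Ga(2)[OF B.comp_hom[OF f g]] functorD(7)[OF F Ga(1)[OF f] Ga(1)[OF g]] Ga(2)[OF f] Ga(2)[OF g] by simp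
    qed
  qed (use A.category_axioms B.category_axioms Go p in \<open>simp_all add: G_def\<close>)
  \<comment> \<open>One composite is the identity on the nose; the other is compared with the
    identity by lifting identities of \<open>B\<close>.\<close>
  have "fcomp B F G = fid B"
    using fcomp_functor[OF G F] fid_functor[OF B.category_axioms] Go p Ga(2)[OF B.arr_hom]
    by (intro functor_eqI[where C = B and D = B]) simp_all
  then have 1: "isomorphic (functor_cat B B) (fcomp B F G) (fid B)"
    using category.isomorphic_refl[OF category_functor_cat[OF B.category_axioms B.category_axioms]]
      fid_functor[OF B.category_axioms] by simp
  have GF: "FObj (fcomp A G F) X = p (FObj F X)" "p (FObj F X) \<in> Obj A" "FObj F (p (FObj F X)) = FObj F X"
    "Ident B (FObj F X) \<in> Hom B (FObj F X) (FObj F X)"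
    if "X \<in> Obj A" for X
    using that Go p functorD(3)[OF F that] B.ident_hom by simp_all
  have lX: "l (p (FObj F X)) X (Ident B (FObj F X)) \<in> Hom A (p (FObj F X)) X"
    "FArr F (l (p (FObj F X)) X (Ident B (FObj F X))) = Ident B (FObj F X)"
    "l X (p (FObj F X)) (Ident B (FObj F X)) \<in> Hom A X (p (FObj F X))"
    "FArr F (l X (p (FObj F X)) (Ident B (FObj F X))) = Ident B (FObj F X)"
    if "X \<in> Obj A" for X
    using l[OF GF(2) _, OF that that] l[OF _ GF(2), OF that that] GF(3,4)[OF that] by simp_all
  have 2: "isomorphic (functor_cat A A) (fcomp A G F) (fid A)"
  proof (rule natural_isoI[where a = "\<lambda>X. l (p (FObj F X)) X (Ident B (FObj F X))"
        and b = "\<lambda>X. l X (p (FObj F X)) (Ident B (FObj F X))"])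
    fix X assume X: "X \<in> Obj A"
    let ?a = "l (p (FObj F X)) X (Ident B (FObj F X))" and ?b = "l X (p (FObj F X)) (Ident B (FObj F X))"
    show "?a \<in> Hom A (FObj (fcomp A G F) X) (FObj (fid A) X)" "?b \<in> Hom A (FObj (fid A) X) (FObj (fcomp A G F) X)"
      using lX(1,3)[OF X] GF(1)[OF X] X by simp_all
    note idid = B.comp_ident_left[OF GF(4)[OF X]]
    have "Comp A ?b ?a = Ident A (p (FObj F X))"
      using functorD(7)[OF F lX(1)[OF X] lX(3)[OF X]] lX(2,4)[OF X] idid functorD(6)[OF F GF(2)[OF X]] GF(3)[OF X]
      by (intro faithful[OF A.comp_hom[OF lX(1)[OF X] lX(3)[OF X]] A.ident_hom[OF GF(2)[OF X]]]) simp
    then show "Comp A ?b ?a = Ident A (FObj (fcomp A G F) X)" using GF(1)[OF X] by simp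
    have "Comp A ?a ?b = Ident A X"
      using functorD(7)[OF F lX(3)[OF X] lX(1)[OF X]] lX(2,4)[OF X] idid functorD(6)[OF F X]
      by (intro faithful[OF A.comp_hom[OF lX(3)[OF X] lX(1)[OF X]] A.ident_hom[OF X]]) simp
    then show "Comp A ?a ?b = Ident A (FObj (fid A) X)" using X by simp
  next
    fix X Y f assume f: "f \<in> Hom A X Y"
    have o: "X \<in> Obj A" "Y \<in> Obj A" using A.hom_obj[OF f] by auto
    note Ff = functorD(5)[OF F f]
    note aX = lX(1,2)[OF o(1)] and aY = lX(1,2)[OF o(2)]
    have "Comp A (l (p (FObj F Y)) Y (Ident B (FObj F Y))) (FArr G (FArr F f)) =
        Comp A f (l (p (FObj F X)) X (Ident B (FObj F X)))"
    proof (rule faithful[OF A.comp_hom[OF Ga(1)[OF Ff] aY(1)] A.comp_hom[OF aX(1) f]])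
      show "FArr F (Comp A (l (p (FObj F Y)) Y (Ident B (FObj F Y))) (FArr G (FArr F f))) =
          FArr F (Comp A f (l (p (FObj F X)) X (Ident B (FObj F X))))"
        using functorD(7)[OF F Ga(1)[OF Ff] aY(1)] functorD(7)[OF F aX(1) f] Ga(2)[OF Ff] aX(2) aY(2)
          B.comp_ident_left[OF Ff] B.comp_ident_right[OF Ff] by simp
    qed
    then show "Comp A (l (p (FObj F Y)) Y (Ident B (FObj F Y))) (FArr (fcomp A G F) f) =
        Comp A (FArr (fid A) f) (l (p (FObj F X)) X (Ident B (FObj F X)))"
      using homD(1)[OF f] by simp
  qed (use fcomp_functor[OF F G] fid_functor[OF A.category_axioms] in simp_all)
  show ?thesis unfolding equivalence_def using F G 1 2 by blast
qed

text \<open>Composite and identity functors take a default value outside their source, so image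
  diagrams that should coincide do so only at their nodes. Limit cones do not see the
  difference.\<close>

lemma limit_cone_diagram_cong:
  assumes L: "limit_cone C d X p" and "Nodes d = Nodes d'" "Edges d = Edges d'"
    "\<And>i. i \<in> Nodes d \<Longrightarrow> NObj d i = NObj d' i" "\<And>i. i \<in> Nodes d \<Longrightarrow> p i = p' i"
    and fin: "finite_diagram C d"
  shows "limit_cone C d' X p'"
proof -
  have e: "\<forall>(i, f, j) \<in> Edges d. i \<in> Nodes d \<and> j \<in> Nodes d"
    using fin unfolding finite_diagram_def by auto
  have "limit_cone C d X p'" by (rule limit_cone_cong[OF L _ e]) (simp add: assms(5))
  moreover have "cone C d Y q \<longleftrightarrow> cone C d' Y q" for Y q
    using assms(2-4) unfolding cone_def by auto
  ultimately show ?thesis using assms(2) unfolding limit_cone_def by simp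
qed

lemma lex_functor_fcomp:
  assumes F: "lex_functor C D F" and G: "lex_functor D E G"
  shows "lex_functor C E (fcomp C G F)"
proof -
  note F' = lex_functorD(1)[OF F] and G' = lex_functorD(1)[OF G]
  show ?thesis unfolding lex_functor_def
  proof (intro conjI allI impI fcomp_functor[OF F' G'])
    fix d X p assume d: "finite_diagram C d \<and> limit_cone C d X p"
    then have c: "cone C d X p" by (simp add: limit_cone_def)
    have Fd: "finite_diagram D (map_diagram F d)" using finite_map_diagram[OF F'] d by blast
    have "limit_cone D (map_diagram F d) (FObj F X) (\<lambda>i. FArr F (p i))"
      using F d unfolding lex_functor_def by blast
    then have "limit_cone E (map_diagram G (map_diagram F d)) (FObj G (FObj F X)) (\<lambda>i. FArr G (FArr F (p i)))"
      using G Fd unfolding lex_functor_def by blast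
    moreover have "X \<in> Obj C" using c by (simp add: cone_def)
    ultimately have 1: "limit_cone E (map_diagram G (map_diagram F d)) (FObj (fcomp C G F) X)
        (\<lambda>i. FArr G (FArr F (p i)))" by simp
    have "f \<in> Arr C" if "(i, f, j) \<in> Edges d" for i f j
      using d that homD(1) unfolding finite_diagram_def by fastforce
    then have e: "Edges (map_diagram G (map_diagram F d)) = Edges (map_diagram (fcomp C G F) d)"
      unfolding map_diagram_def by (force simp: image_image intro!: image_cong)
    show "limit_cone E (map_diagram (fcomp C G F) d) (FObj (fcomp C G F) X) (\<lambda>i. FArr (fcomp C G F) (p i))"
    proof (rule limit_cone_diagram_cong[OF 1 _ e])
      show "finite_diagram E (map_diagram G (map_diagram F d))" by (rule finite_map_diagram[OF G' Fd])
      show "NObj (map_diagram G (map_diagram F d)) i = NObj (map_diagram (fcomp C G F) d) i"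
        if "i \<in> Nodes (map_diagram G (map_diagram F d))" for i
        using that d by (simp add: map_diagram_def finite_diagram_def)
      show "FArr G (FArr F (p i)) = FArr (fcomp C G F) (p i)"
        if "i \<in> Nodes (map_diagram G (map_diagram F d))" for i
        using that c homD(1)[of "p i" C X "NObj d i"] by (simp add: map_diagram_def cone_def)
    qed (simp add: map_diagram_def)
  qed
qed

lemma lex_functor_fid:
  assumes "category C"
  shows "lex_functor C C (fid C)"
  unfolding lex_functor_def
proof (intro conjI allI impI fid_functor[OF assms])
  fix d X p assume d: "finite_diagram C d \<and> limit_cone C d X p"
  then have c: "cone C d X p" by (simp add: limit_cone_def)
  have "f \<in> Arr C" if "(i, f, j) \<in> Edges d" for i f j
    using d that homD(1) unfolding finite_diagram_def by fastforce
  then have e: "Edges d = Edges (map_diagram (fid C) d)"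
    unfolding map_diagram_def by (force simp: image_iff)
  have "X \<in> Obj C" using c by (simp add: cone_def)
  moreover have "limit_cone C (map_diagram (fid C) d) X (\<lambda>i. FArr (fid C) (p i))"
  proof (rule limit_cone_diagram_cong[OF _ _ e])
    show "limit_cone C d X p" "finite_diagram C d" using d by blast+
    show "NObj d i = NObj (map_diagram (fid C) d) i" if "i \<in> Nodes d" for i
      using that d by (simp add: map_diagram_def finite_diagram_def)
    show "p i = FArr (fid C) (p i)" if "i \<in> Nodes d" for i
      using that c homD(1)[of "p i" C X "NObj d i"] by (simp add: cone_def)
  qed (simp add: map_diagram_def)
  ultimately show "limit_cone C (map_diagram (fid C) d) (FObj (fid C) X) (\<lambda>i. FArr (fid C) (p i))"
    by simp
qed

lemma regular_functor_fcomp: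
  assumes F: "regular_functor C D F" and G: "regular_functor D E G"
  shows "regular_functor C E (fcomp C G F)"
  using assms lex_functor_fcomp regular_epi_arr unfolding regular_functor_def by fastforce

lemma regular_functor_fid:
  assumes "category C"
  shows "regular_functor C C (fid C)"
  using lex_functor_fid[OF assms] regular_epi_arr unfolding regular_functor_def by fastforce

lemma precomp_simps [simp]:
  "G \<in> Obj E \<Longrightarrow> FObj (precomp C H E) G = fcomp C G H"
  "t \<in> Arr E \<Longrightarrow> NDom (FArr (precomp C H E) t) = fcomp C (NDom t) H"
  "t \<in> Arr E \<Longrightarrow> NCod (FArr (precomp C H E) t) = fcomp C (NCod t) H"
  "t \<in> Arr E \<Longrightarrow> X \<in> Obj C \<Longrightarrow> NMap (FArr (precomp C H E) t) X = NMap t (FObj H X)"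
  by (simp_all add: precomp_def compose_def)

lemma Reg_simps [simp]:
  "Obj (Reg C D) = {F. regular_functor C D F}" "Comp (Reg C D) = Comp (functor_cat C D)"
  "Ident (Reg C D) = Ident (functor_cat C D)"
  by (auto simp: Reg_def regular_functor_def lex_functor_def)

lemma Lex_simps [simp]:
  "Obj (Lex C D) = {F. lex_functor C D F}" "Comp (Lex C D) = Comp (functor_cat C D)"
  "Ident (Lex C D) = Ident (functor_cat C D)"
  by (auto simp: Lex_def lex_functor_def)

lemma hom_Reg: "t \<in> Hom (Reg C D) F G \<longleftrightarrow>
    regular_functor C D F \<and> regular_functor C D G \<and> t \<in> Hom (functor_cat C D) F G"
  by (auto simp: Reg_def hom_full_sub)

lemma hom_Lex: "t \<in> Hom (Lex C D) F G \<longleftrightarrow>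
    lex_functor C D F \<and> lex_functor C D G \<and> t \<in> Hom (functor_cat C D) F G"
  by (auto simp: Lex_def hom_full_sub)

lemma precomp_functor:
  assumes H: "lex_functor C R H" and D: "category D"
  shows "is_functor (Reg R D) (Lex C D) (precomp C H (Reg R D))"
proof -
  note H' = lex_functorD(1)[OF H]
  interpret C: category C using functorD(1)[OF H'] .
  interpret R: category R using functorD(2)[OF H'] .
  interpret D: category D by fact
  interpret RD: category "functor_cat R D" by (intro category_functor_cat R.category_axioms D.category_axioms)
  interpret CD: category "functor_cat C D" by (intro category_functor_cat C.category_axioms D.category_axioms)
  let ?P = "precomp C H (Reg R D)"
  interpret rd: category "Reg R D" unfolding Reg_def by (intro category_full_sub RD.category_axioms)
  have hom: "FArr ?P t \<in> Hom (Lex C D) (FObj ?P F) (FObj ?P G)" if t: "t \<in> Hom (Reg R D) F G" for t F G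
  proof -
    have t': "nat_trans R D t" "NDom t = F" "NCod t = G" and FG: "regular_functor R D F" "regular_functor R D G"
      using t by (simp_all add: hom_Reg hom_functor_cat)
    note T = nat_transD[OF t'(1), unfolded t'(2,3)]
    have lex: "lex_functor C D (fcomp C F H)" "lex_functor C D (fcomp C G H)"
      using FG lex_functor_fcomp[OF H] by (auto simp: regular_functor_def)
    have "nat_trans C D (FArr ?P t)"
      unfolding nat_trans_def
    proof (intro conjI ballI allI)
      show "is_functor C D (NDom (FArr ?P t))" "is_functor C D (NCod (FArr ?P t))"
        using lex_functorD(1)[OF lex(1)] lex_functorD(1)[OF lex(2)] homD(1)[OF t] t' by simp_all
      show "NMap (FArr ?P t) \<in> extensional (Obj C)"
        using homD(1)[OF t] by (simp add: precomp_def compose_def)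
      show "NMap (FArr ?P t) X \<in> Hom D (FObj (NDom (FArr ?P t)) X) (FObj (NCod (FArr ?P t)) X)"
        if "X \<in> Obj C" for X
        using that T(4) functorD(3)[OF H' that] homD(1)[OF t] t' by simp
      show "Comp D (NMap (FArr ?P t) Y) (FArr (NDom (FArr ?P t)) f) =
          Comp D (FArr (NCod (FArr ?P t)) f) (NMap (FArr ?P t) X)" if f: "f \<in> Hom C X Y" for X Y f
        using T(5)[OF functorD(5)[OF H' f]] C.hom_obj[OF f] homD(1)[OF f] homD(1)[OF t] t' by simp
    qed
    then show ?thesis using lex FG t' homD(1)[OF t] by (simp add: hom_Lex hom_functor_cat)
  qed
  show ?thesis
  proof (rule is_functorI)
    show "category (Lex C D)" unfolding Lex_def by (intro category_full_sub CD.category_axioms)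
    show "FObj ?P F \<in> Obj (Lex C D)" if "F \<in> Obj (Reg R D)" for F
      using that lex_functor_fcomp[OF H, of D F] by (simp add: regular_functor_def)
    show "FArr ?P (Ident (Reg R D) F) = Ident (Lex C D) (FObj ?P F)" if F: "F \<in> Obj (Reg R D)" for F
    proof -
      have 1: "FArr ?P (Ident (Reg R D) F) \<in> Hom (functor_cat C D) (FObj ?P F) (FObj ?P F)"
        using hom[OF rd.ident_hom[OF F]] by (simp add: hom_Lex)
      have 2: "Ident (functor_cat C D) (FObj ?P F) \<in> Hom (functor_cat C D) (FObj ?P F) (FObj ?P F)"
        using CD.hom_obj[OF 1] by (intro CD.ident_hom) blast
      have "FArr ?P (Ident (Reg R D) F) = Ident (functor_cat C D) (FObj ?P F)"
        by (rule nat_trans_eqI[OF 1 2])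
          (use rd.ident_arr(1)[OF F] F functorD(3)[OF H'] in simp)
      then show ?thesis by simp
    qed
    show "FArr ?P (Comp (Reg R D) t s) = Comp (Lex C D) (FArr ?P t) (FArr ?P s)"
      if s: "s \<in> Hom (Reg R D) F G" and t: "t \<in> Hom (Reg R D) G K" for F G K s t
    proof -
      note ts = rd.comp_hom[OF s t]
      have 1: "FArr ?P (Comp (Reg R D) t s) \<in> Hom (functor_cat C D) (FObj ?P F) (FObj ?P K)"
        using hom[OF ts] by (simp add: hom_Lex)
      have 2: "Comp (functor_cat C D) (FArr ?P t) (FArr ?P s) \<in> Hom (functor_cat C D) (FObj ?P F) (FObj ?P K)"
        using hom[OF s] hom[OF t] CD.comp_hom unfolding hom_Lex by blast
      have "FArr ?P (Comp (Reg R D) t s) = Comp (functor_cat C D) (FArr ?P t) (FArr ?P s)"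
        by (rule nat_trans_eqI[OF 1 2])
          (use homD(1)[OF s] homD(1)[OF t] homD(1)[OF ts] functorD(3)[OF H'] in simp)
      then show ?thesis by simp
    qed
  qed (fact rd.category_axioms hom | simp add: precomp_def)+
qed

section \<open>Regular categories with enough projectives\<close>

text \<open>Closure of \<open>S\<close> under finite limits is encoded by two conditions: the full
  subcategory has finite limits, and the inclusion preserves them, so they are the limits of
  \<open>R\<close>.\<close>

locale enough_projectives = regular_cat R for R :: "('r, 's) cat" +
  fixes S :: "'r set"
  assumes lex_sub: "lex_category (full_sub R S)"
    and lex_incl: "lex_functor (full_sub R S) R (inclusion R S)"
    and proj: "P \<in> Obj R \<Longrightarrow> P \<in> S \<Longrightarrow> projective R P"
    and cover: "X \<in> Obj R \<Longrightarrow> \<exists>P \<in> S. \<exists>e \<in> Hom R P X. regular_epi R e"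
    and embed: "X \<in> Obj R \<Longrightarrow> \<exists>Q \<in> S. \<exists>m \<in> Hom R X Q. monic R m"
begin

abbreviation (input) "PR \<equiv> full_sub R S"

text \<open>For objects of \<open>S\<close> the chosen cover and the chosen embedding are identities, so that the
  extension of a functor from \<open>PR\<close> constructed below restricts to it on the nose.\<close>

definition "cov X = (if X \<in> S then (X, Ident R X)
  else SOME (P, e). P \<in> S \<and> e \<in> Hom R P X \<and> regular_epi R e)"

definition "emb X = (if X \<in> S then (X, Ident R X)
  else SOME (Q, m). Q \<in> S \<and> m \<in> Hom R X Q \<and> monic R m)"

definition "Pc X = fst (cov X)"
definition "ec X = snd (cov X)"
definition "Qc X = fst (emb X)"
definition "mc X = snd (emb X)"

lemma chosen_S: "X \<in> S \<Longrightarrow> Pc X = X \<and> ec X = Ident R X \<and> Qc X = X \<and> mc X = Ident R X"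
  by (simp add: cov_def emb_def Pc_def ec_def Qc_def mc_def)

lemma chosen:
  assumes X: "X \<in> Obj R"
  shows "Pc X \<in> S" "ec X \<in> Hom R (Pc X) X" "regular_epi R (ec X)"
    "Qc X \<in> S" "mc X \<in> Hom R X (Qc X)" "monic R (mc X)"
proof -
  have "\<exists>x. case x of (P, e) \<Rightarrow> P \<in> S \<and> e \<in> Hom R P X \<and> regular_epi R e"
    using cover[OF X] by auto
  from someI_ex[OF this]
  have "case cov X of (P, e) \<Rightarrow> P \<in> S \<and> e \<in> Hom R P X \<and> regular_epi R e"
    using ident_hom[OF X] regular_epi_ident[OF X] unfolding cov_def by auto
  then show "Pc X \<in> S" "ec X \<in> Hom R (Pc X) X" "regular_epi R (ec X)"
    by (simp_all add: Pc_def ec_def case_prod_beta)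
  have "\<exists>x. case x of (Q, m) \<Rightarrow> Q \<in> S \<and> m \<in> Hom R X Q \<and> monic R m"
    using embed[OF X] by auto
  from someI_ex[OF this]
  have "case emb X of (Q, m) \<Rightarrow> Q \<in> S \<and> m \<in> Hom R X Q \<and> monic R m"
    using ident_hom[OF X] monic_ident[OF X] unfolding emb_def by auto
  then show "Qc X \<in> S" "mc X \<in> Hom R X (Qc X)" "monic R (mc X)"
    by (simp_all add: Qc_def mc_def case_prod_beta)
qed

lemma chosen_obj: "X \<in> Obj R \<Longrightarrow> Pc X \<in> Obj R" "X \<in> Obj R \<Longrightarrow> Qc X \<in> Obj R"
  using hom_obj[OF chosen(2)] hom_obj[OF chosen(5)] by blast+

lemma hom_PR: "X \<in> S \<Longrightarrow> Y \<in> S \<Longrightarrow> Hom PR X Y = Hom R X Y"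
  by (simp add: hom_full_sub)

lemma lift:
  assumes "P \<in> S" "f \<in> Hom R P X" "e \<in> Hom R Y X" "regular_epi R e"
  obtains h where "h \<in> Hom R P Y" "Comp R e h = f"
  using proj[OF hom_obj1[OF assms(2)] assms(1)] assms(2-4) unfolding projective_def by blast

text \<open>Projectivity of \<open>Pc X\<close> against the cover of \<open>Y\<close> represents
  every arrow by one between objects of \<open>S\<close>. Two such lifts become equal after
  \<open>ec Y\<close>.\<close>

lemma lift_arr:
  assumes f: "f \<in> Hom R X Y"
  obtains h where "h \<in> Hom R (Pc X) (Pc Y)" "Comp R (ec Y) h = Comp R f (ec X)"
proof -
  have o: "X \<in> Obj R" "Y \<in> Obj R" using hom_obj[OF f] by auto
  show thesis
    using lift[OF chosen(1)[OF o(1)] comp_hom[OF chosen(2)[OF o(1)] f] chosen(2)[OF o(2)] chosen(3)[OF o(2)]] that .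
qed

section \<open>Restriction of regular functors to the projectives is fully faithful\<close>

lemma regular_functor_cancel:
  assumes G: "regular_functor R D G" and X: "X \<in> Obj R"
    and ab: "a \<in> Hom D (FObj G X) W" "b \<in> Hom D (FObj G X) W"
      "Comp D a (FArr G (ec X)) = Comp D b (FArr G (ec X))"
  shows "a = b"
proof -
  have G': "is_functor R D G" using G by (simp add: regular_functor_def lex_functor_def)
  show ?thesis
    using category.regular_epi_cancel[OF functorD(2)[OF G'] _ functorD(5)[OF G' chosen(2)[OF X]] ab]
      G chosen(3)[OF X] by (simp add: regular_functor_def)
qed

text \<open>A regular functor keeps \<open>ec X\<close> a regular epi, so by naturality the
  component at \<open>X\<close> is determined by the component at \<open>Pc X\<close>.\<close>

lemma precomp_faithful:
  assumes t: "t \<in> Hom (Reg R D) G G'" and s: "s \<in> Hom (Reg R D) G G'"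
    and eq: "FArr (precomp PR (inclusion R S) (Reg R D)) t = FArr (precomp PR (inclusion R S) (Reg R D)) s"
  shows "t = s"
proof -
  have G: "regular_functor R D G" and t': "nat_trans R D t" "NDom t = G" "NCod t = G'"
    and s': "nat_trans R D s" "NDom s = G" "NCod s = G'"
    using t s by (simp_all add: hom_Reg hom_functor_cat)
  note T = nat_transD[OF t'(1), unfolded t'(2,3)] and T' = nat_transD[OF s'(1), unfolded s'(2,3)]
  have on_S: "NMap t P = NMap s P" if "P \<in> S" "P \<in> Obj R" for P
    using arg_cong[OF eq, of "\<lambda>t. NMap t P"] homD(1)[OF t] homD(1)[OF s] that by simp
  have "NMap t X = NMap s X" if X: "X \<in> Obj R" for X
    using regular_functor_cancel[OF G X T(4)[OF X] T'(4)[OF X]] T(5)[OF chosen(2)[OF X]]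
      T'(5)[OF chosen(2)[OF X]] on_S[OF chosen(1)[OF X] chosen_obj(1)[OF X]] by simp
  then show ?thesis using nat_trans_eqI t s unfolding hom_Reg by blast
qed

text \<open>The component at \<open>X\<close> has to be the factorization through \<open>G\<close>
  of \<open>ec X\<close> of the composite \<open>Comp D (FArr G' (ec X)) (NMap t (Pc X))\<close>.
  The work is to show that this composite respects the kernel pair of \<open>G\<close> of
  \<open>ec X\<close>, which is the image of a kernel pair \<open>K\<close> in
  \<open>R\<close>.\<close>

lemma precomp_full:
  assumes D: "regular_category D" and G: "regular_functor R D G" and G': "regular_functor R D G'"
    and t: "t \<in> Hom (Lex PR D) (fcomp PR G (inclusion R S)) (fcomp PR G' (inclusion R S))"
  shows "\<exists>s \<in> Hom (Reg R D) G G'. FArr (precomp PR (inclusion R S) (Reg R D)) s = t"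
proof -
  interpret D: regular_cat D by unfold_locales (rule D)
  have GL: "lex_functor R D G" "lex_functor R D G'" using G G' by (simp_all add: regular_functor_def)
  note GF = lex_functorD(1)[OF GL(1)] and GF' = lex_functorD(1)[OF GL(2)]
  note h = functorD(5)[OF GF] and h' = functorD(5)[OF GF'] and c = functorD(7)[OF GF] and c' = functorD(7)[OF GF']
  have t': "nat_trans PR D t" "NDom t = fcomp PR G (inclusion R S)" "NCod t = fcomp PR G' (inclusion R S)"
    using t by (simp_all add: hom_Lex hom_functor_cat)
  note T = nat_transD[OF t'(1), unfolded t'(2,3)]
  have tP: "NMap t P \<in> Hom D (FObj G P) (FObj G' P)" if "P \<in> S" "P \<in> Obj R" for P
    using T(4)[of P] that by simp
  have nat: "Comp D (NMap t Q) (FArr G f) = Comp D (FArr G' f) (NMap t P)"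
    if "P \<in> S" "Q \<in> S" "f \<in> Hom R P Q" for P Q f
    using T(5)[of f P Q] that homD[OF that(3)] homD(1)[of f PR P Q] by (simp add: hom_PR)
  have ex: "\<exists>u \<in> Hom D (FObj G X) (FObj G' X). Comp D u (FArr G (ec X)) = Comp D (FArr G' (ec X)) (NMap t (Pc X))"
    if X: "X \<in> Obj R" for X
  proof -
    let ?e = "ec X" and ?t = "NMap t (Pc X)"
    note e = chosen(2)[OF X] and ptX = tP[OF chosen(1)[OF X] chosen_obj(1)[OF X]]
    obtain K p q where pq: "p \<in> Hom R K (Pc X)" "q \<in> Hom R K (Pc X)" "Comp R ?e p = Comp R ?e q"
      and K: "\<And>W a b. a \<in> Hom D W (FObj G (Pc X)) \<Longrightarrow> b \<in> Hom D W (FObj G (Pc X)) \<Longrightarrow>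
        Comp D (FArr G ?e) a = Comp D (FArr G ?e) b \<Longrightarrow>
        \<exists>z \<in> Hom D W (FObj G K). Comp D (FArr G p) z = a \<and> Comp D (FArr G q) z = b"
      by (rule lex_functor_kernel_pair[OF lex GL(1) e]) blast
    have Ko: "K \<in> Obj R" using hom_obj1[OF pq(1)] .
    note k = chosen(2)[OF Ko] and tK = tP[OF chosen(1)[OF Ko] chosen_obj(1)[OF Ko]]
    let ?n = "Comp D (FArr G' ?e) ?t"
    have n: "?n \<in> Hom D (FObj G (Pc X)) (FObj G' X)" using D.comp_hom[OF ptX h'[OF e]] .
    \<comment> \<open>\<open>K\<close> need not lie in \<open>S\<close>, so \<open>t\<close> has no
      component there. Precomposing with the cover of \<open>K\<close> turns each projection into an
      arrow of \<open>S\<close>, for which \<open>t\<close> is natural.\<close>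
    have aux: "Comp D (Comp D ?n (FArr G r)) (FArr G (ec K)) =
        Comp D (FArr G' (Comp R (Comp R ?e r) (ec K))) (NMap t (Pc K))"
      if r: "r \<in> Hom R K (Pc X)" for r
    proof -
      note rk = comp_hom[OF k r]
      have "Comp D (Comp D ?n (FArr G r)) (FArr G (ec K)) = Comp D ?n (FArr G (Comp R r (ec K)))"
        using D.comp_assoc[OF h[OF k] h[OF r] n] c[OF k r] by simp
      also have "\<dots> = Comp D (FArr G' ?e) (Comp D ?t (FArr G (Comp R r (ec K))))"
        using D.comp_assoc[OF h[OF rk] ptX h'[OF e]] by simp
      also have "\<dots> = Comp D (FArr G' ?e) (Comp D (FArr G' (Comp R r (ec K))) (NMap t (Pc K)))"
        using nat[OF chosen(1)[OF Ko] chosen(1)[OF X] rk] by simp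
      also have "\<dots> = Comp D (FArr G' (Comp R (Comp R ?e r) (ec K))) (NMap t (Pc K))"
        using D.comp_assoc[OF tK h'[OF rk] h'[OF e]] c'[OF rk e] comp_assoc[OF k r e] by simp
      finally show ?thesis .
    qed
    have npq: "Comp D ?n (FArr G p) = Comp D ?n (FArr G q)"
      by (rule regular_functor_cancel[OF G Ko D.comp_hom[OF h[OF pq(1)] n] D.comp_hom[OF h[OF pq(2)] n]])
        (use aux[OF pq(1)] aux[OF pq(2)] pq(3) in simp)
    have "kle D (FArr G ?e) ?n"
    proof (rule kleI[OF h[OF e]])
      fix W a b assume "a \<in> Hom D W (FObj G (Pc X))" "b \<in> Hom D W (FObj G (Pc X))"
        "Comp D (FArr G ?e) a = Comp D (FArr G ?e) b"
      then obtain z where z: "z \<in> Hom D W (FObj G K)" "Comp D (FArr G p) z = a" "Comp D (FArr G q) z = b"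
        using K by blast
      then show "Comp D ?n a = Comp D ?n b"
        using D.comp_eq_ext[OF npq z(1) h[OF pq(1)] n h[OF pq(2)] n] by simp
    qed
    then show ?thesis
      using D.regular_epi_factor[OF _ h[OF e] n] G chosen(3)[OF X] unfolding regular_functor_def by blast
  qed
  then obtain u where u: "\<And>X. X \<in> Obj R \<Longrightarrow> u X \<in> Hom D (FObj G X) (FObj G' X)"
    "\<And>X. X \<in> Obj R \<Longrightarrow> Comp D (u X) (FArr G (ec X)) = Comp D (FArr G' (ec X)) (NMap t (Pc X))"
    by metis
  have natu: "Comp D (u Y) (FArr G f) = Comp D (FArr G' f) (u X)" if f: "f \<in> Hom R X Y" for X Y f
  proof -
    have o: "X \<in> Obj R" "Y \<in> Obj R" using hom_obj[OF f] by auto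
    note eX = chosen(2)[OF o(1)] and eY = chosen(2)[OF o(2)] and S' = chosen(1)[OF o(1)] chosen(1)[OF o(2)]
    note pX = tP[OF S'(1) chosen_obj(1)[OF o(1)]] and pY = tP[OF S'(2) chosen_obj(1)[OF o(2)]]
    note uX = u(1)[OF o(1)] and uY = u(1)[OF o(2)]
    obtain g where g: "g \<in> Hom R (Pc X) (Pc Y)" "Comp R (ec Y) g = Comp R f (ec X)"
      using lift_arr[OF f] .
    have "Comp D (Comp D (u Y) (FArr G f)) (FArr G (ec X)) = Comp D (u Y) (FArr G (Comp R (ec Y) g))"
      using D.comp_assoc[OF h[OF eX] h[OF f] uY] c[OF eX f] g(2) by simp
    also have "\<dots> = Comp D (FArr G' (ec Y)) (Comp D (NMap t (Pc Y)) (FArr G g))"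
      using D.comp_eq_ext[OF u(2)[OF o(2)] h[OF g(1)] h[OF eY] uY pY h'[OF eY]] c[OF g(1) eY] by simp
    also have "\<dots> = Comp D (FArr G' (Comp R f (ec X))) (NMap t (Pc X))"
      using nat[OF S' g(1)] D.comp_assoc[OF pX h'[OF g(1)] h'[OF eY]] c'[OF g(1) eY] g(2) by simp
    also have "\<dots> = Comp D (Comp D (FArr G' f) (u X)) (FArr G (ec X))"
      using c'[OF eX f] D.comp_assoc[OF pX h'[OF eX] h'[OF f]] u(2)[OF o(1)]
        D.comp_assoc[OF h[OF eX] uX h'[OF f]] by simp
    finally show ?thesis
      by (rule regular_functor_cancel[OF G o(1) D.comp_hom[OF h[OF f] uY] D.comp_hom[OF uX h'[OF f]]])
  qed
  define s where "s = \<lparr>NDom = G, NCod = G', NMap = restrict u (Obj R)\<rparr>"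
  have s: "s \<in> Hom (Reg R D) G G'"
    unfolding hom_Reg hom_functor_cat nat_trans_def s_def
    using G G' GF GF' u(1) natu hom_obj by auto
  have "FArr (precomp PR (inclusion R S) (Reg R D)) s \<in> Hom (Lex PR D) (fcomp PR G (inclusion R S)) (fcomp PR G' (inclusion R S))"
    using functorD(5)[OF precomp_functor[OF lex_incl D.category_axioms] s] G G' by simp
  moreover have "NMap (FArr (precomp PR (inclusion R S) (Reg R D)) s) P = NMap t P" if "P \<in> Obj PR" for P
  proof -
    have P: "P \<in> S" "P \<in> Obj R" using that by auto
    \<comment> \<open>For \<open>P\<close> in \<open>S\<close> the chosen cover is an identity, so
      the factorization returns the given component.\<close>
    have "u P = NMap t P"
      using u(2)[OF P(2)] chosen_S[OF P(1)] functorD(6)[OF GF P(2)] functorD(6)[OF GF' P(2)]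
        D.comp_ident_right[OF u(1)[OF P(2)]] D.comp_ident_left[OF tP[OF P]] by simp
    then show ?thesis using homD(1)[OF s] P that by (simp add: s_def)
  qed
  ultimately have "FArr (precomp PR (inclusion R S) (Reg R D)) s = t"
    using nat_trans_eqI t unfolding hom_Lex by blast
  with s show ?thesis by blast
qed

end

section \<open>Extension of a finite limit preserving functor along images\<close>

locale regular_extension = enough_projectives R S for R :: "('r, 's) cat" and S +
  fixes D :: "('d, 'e) cat" and F
  assumes regD: "regular_category D" and F: "lex_functor (full_sub R S) D F"
begin

sublocale D: regular_cat D
  by unfold_locales (rule regD)

lemma F_hom: "A \<in> S \<Longrightarrow> B \<in> S \<Longrightarrow> f \<in> Hom R A B \<Longrightarrow> FArr F f \<in> Hom D (FObj F A) (FObj F B)"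
  using functorD(5)[OF lex_functorD(1)[OF F]] by (simp add: hom_PR)

lemma F_comp: "A \<in> S \<Longrightarrow> B \<in> S \<Longrightarrow> E \<in> S \<Longrightarrow> f \<in> Hom R A B \<Longrightarrow> g \<in> Hom R B E \<Longrightarrow>
    FArr F (Comp R g f) = Comp D (FArr F g) (FArr F f)"
  using functorD(7)[OF lex_functorD(1)[OF F], of f A B g E] by (simp add: hom_PR)

lemma F_id: "A \<in> S \<Longrightarrow> A \<in> Obj R \<Longrightarrow> FArr F (Ident R A) = Ident D (FObj F A)"
  using functorD(6)[OF lex_functorD(1)[OF F], of A] by simp

lemma F_obj: "A \<in> S \<Longrightarrow> A \<in> Obj R \<Longrightarrow> FObj F A \<in> Obj D"
  using functorD(3)[OF lex_functorD(1)[OF F], of A] by simp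

text \<open>In \<open>R\<close> the inclusion is tested against all stages, hence also against those
  in \<open>S\<close>. It therefore holds in the subcategory on which \<open>F\<close> is
  defined.\<close>

lemma F_kle:
  assumes "A \<in> S" "B \<in> S" "B' \<in> S" "m \<in> Hom R A B" "n \<in> Hom R A B'" "kle R m n"
  shows "kle D (FArr F m) (FArr F n)"
proof (rule lex_functor_kle[OF lex_sub F])
  show "m \<in> Hom PR A B" "n \<in> Hom PR A B'" using assms by (simp_all add: hom_PR)
  then show "kle PR m n"
  proof (intro kleI[of m PR A B])
    fix W a b assume "a \<in> Hom PR W A" "b \<in> Hom PR W A" "Comp PR m a = Comp PR m b"
    then show "Comp PR n a = Comp PR n b"
      using kleD[OF assms(6,4), of a W b] by (simp add: hom_full_sub split: if_splits)
  qed
qed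

text \<open>The triple is a factorization of \<open>F\<close> at \<open>Pc X -> X -> Qc X\<close>.
  On \<open>S\<close> that arrow is an identity, and the trivial factorization is fixed so that the
  extension restricts to \<open>F\<close> strictly.\<close>

definition "img X = (if X \<in> S then (FObj F X, Ident D (FObj F X), Ident D (FObj F X))
  else SOME (I, e, m). e \<in> Hom D (FObj F (Pc X)) I \<and> regular_epi D e \<and>
    m \<in> Hom D I (FObj F (Qc X)) \<and> monic D m \<and> Comp D m e = FArr F (Comp R (mc X) (ec X)))"

definition "Im X = fst (img X)"
definition "eps X = fst (snd (img X))"
definition "mu X = snd (snd (img X))"

lemma img_S: "X \<in> S \<Longrightarrow> Im X = FObj F X \<and> eps X = Ident D (FObj F X)"
  by (simp add: img_def Im_def eps_def)

lemma img:
  assumes X: "X \<in> Obj R"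
  shows "eps X \<in> Hom D (FObj F (Pc X)) (Im X)" "regular_epi D (eps X)"
    "mu X \<in> Hom D (Im X) (FObj F (Qc X))" "monic D (mu X)"
    "Comp D (mu X) (eps X) = FArr F (Comp R (mc X) (ec X))"
proof -
  have "FArr F (Comp R (mc X) (ec X)) \<in> Hom D (FObj F (Pc X)) (FObj F (Qc X))"
    using F_hom[OF chosen(1)[OF X] chosen(4)[OF X] comp_hom[OF chosen(2)[OF X] chosen(5)[OF X]]] .
  from D.image_factorization[OF this]
  have "\<exists>x. case x of (I, e, m) \<Rightarrow> e \<in> Hom D (FObj F (Pc X)) I \<and> regular_epi D e \<and>
    m \<in> Hom D I (FObj F (Qc X)) \<and> monic D m \<and> Comp D m e = FArr F (Comp R (mc X) (ec X))"
    by (smt (verit) case_prod_conv)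
  from someI_ex[OF this]
  have "case img X of (I, e, m) \<Rightarrow> e \<in> Hom D (FObj F (Pc X)) I \<and> regular_epi D e \<and>
    m \<in> Hom D I (FObj F (Qc X)) \<and> monic D m \<and> Comp D m e = FArr F (Comp R (mc X) (ec X))"
  proof (cases "X \<in> S")
    case True
    then have o: "FObj F X \<in> Obj D" using F_obj X by blast
    have "Comp R (Ident R X) (Ident R X) = Ident R X" using X by simp
    then show ?thesis
      using True chosen_S[OF True] F_id[OF True X] D.ident_hom[OF o] D.regular_epi_ident[OF o]
        D.monic_ident[OF o] o by (simp add: img_def)
  qed (simp add: img_def)
  then show "eps X \<in> Hom D (FObj F (Pc X)) (Im X)" "regular_epi D (eps X)"
    "mu X \<in> Hom D (Im X) (FObj F (Qc X))" "monic D (mu X)"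
    "Comp D (mu X) (eps X) = FArr F (Comp R (mc X) (ec X))"
    by (simp_all add: Im_def eps_def mu_def case_prod_beta)
qed

lemma eps_cancel:
  assumes "X \<in> Obj R" "a \<in> Hom D (Im X) W" "b \<in> Hom D (Im X) W" "Comp D a (eps X) = Comp D b (eps X)"
  shows "a = b"
  using D.regular_epi_cancel[OF img(2)[OF assms(1)] img(1)[OF assms(1)] assms(2-4)] .

text \<open>Behind the mono \<open>mu Y\<close>, an arrow built from \<open>eps Y\<close> becomes
  \<open>F\<close> of an arrow of \<open>S\<close>. Equations into \<open>Im Y\<close> can thereby
  be verified in \<open>R\<close>.\<close>

lemma mu_eps_comp:
  assumes A: "A \<in> S" and g: "g \<in> Hom R A (Pc Y)" and Y: "Y \<in> Obj R"
  shows "Comp D (mu Y) (Comp D (eps Y) (FArr F g)) = FArr F (Comp R (mc Y) (Comp R (ec Y) g))"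
proof -
  note e = chosen(2)[OF Y] and m = chosen(5)[OF Y]
  show ?thesis
    using D.comp_assoc[OF F_hom[OF A chosen(1)[OF Y] g] img(1)[OF Y] img(3)[OF Y]] img(5)[OF Y]
      F_comp[OF A chosen(1)[OF Y] chosen(4)[OF Y] g comp_hom[OF e m]] comp_assoc[OF g e m] by simp
qed

text \<open>Lifts along \<open>ec Y\<close> are not unique; this shows that passing to the image
  removes the ambiguity.\<close>

lemma eps_comp_eq:
  assumes A: "A \<in> S" and g: "g \<in> Hom R A (Pc Y)" "g' \<in> Hom R A (Pc Y)"
    and Y: "Y \<in> Obj R" and eq: "Comp R (ec Y) g = Comp R (ec Y) g'"
  shows "Comp D (eps Y) (FArr F g) = Comp D (eps Y) (FArr F g')"
proof -
  note h = D.comp_hom[OF F_hom[OF A chosen(1)[OF Y] g(1)] img(1)[OF Y]]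
    D.comp_hom[OF F_hom[OF A chosen(1)[OF Y] g(2)] img(1)[OF Y]]
  show ?thesis
    by (rule monicD[OF img(4)[OF Y] img(3)[OF Y] h])
      (simp add: mu_eps_comp[OF A g(1) Y] mu_eps_comp[OF A g(2) Y] eq)
qed

text \<open>The quantifier over all lifts \<open>g\<close> makes the resulting arrow independent of
  the lift, so that any convenient one may be used to compute it. Existence is a factorization
  through \<open>eps X\<close>.\<close>

lemma ext_ex:
  assumes f: "f \<in> Hom R X Y"
  shows "\<exists>h \<in> Hom D (Im X) (Im Y). \<forall>g \<in> Hom R (Pc X) (Pc Y).
    Comp R (ec Y) g = Comp R f (ec X) \<longrightarrow> Comp D h (eps X) = Comp D (eps Y) (FArr F g)"
proof -
  have o: "X \<in> Obj R" "Y \<in> Obj R" using hom_obj[OF f] by auto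
  note eX = chosen(2)[OF o(1)] and mX = chosen(5)[OF o(1)] and eY = chosen(2)[OF o(2)] and mY = chosen(5)[OF o(2)]
  note Sx = chosen(1)[OF o(1)] and Sy = chosen(1)[OF o(2)]
  obtain g where g: "g \<in> Hom R (Pc X) (Pc Y)" "Comp R (ec Y) g = Comp R f (ec X)"
    using lift_arr[OF f] .
  note eg = comp_hom[OF g(1) eY]
  let ?m = "Comp R (mc X) (ec X)" and ?n = "Comp R (mc Y) (Comp R (ec Y) g)"
  have mh: "?m \<in> Hom R (Pc X) (Qc X)" and nh: "?n \<in> Hom R (Pc X) (Qc Y)"
    using comp_hom[OF eX mX] comp_hom[OF eg mY] by auto
  \<comment> \<open>What \<open>mc X\<close> after \<open>ec X\<close> identifies is identified by
    \<open>ec X\<close>, because \<open>mc X\<close> is monic, hence also by \<open>f\<close> after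
    \<open>ec X\<close>, which is \<open>ec Y\<close> after \<open>g\<close>.\<close>
  have "kle R ?m ?n"
  proof (rule kleI[OF mh])
    fix W a b assume ab: "a \<in> Hom R W (Pc X)" "b \<in> Hom R W (Pc X)" "Comp R ?m a = Comp R ?m b"
    then have "Comp R (mc X) (Comp R (ec X) a) = Comp R (mc X) (Comp R (ec X) b)"
      using comp_assoc[OF ab(1) eX mX] comp_assoc[OF ab(2) eX mX] by simp
    then have "Comp R (ec X) a = Comp R (ec X) b"
      using monicD[OF chosen(6)[OF o(1)] mX comp_hom[OF ab(1) eX] comp_hom[OF ab(2) eX]] by blast
    then have "Comp R (Comp R f (ec X)) a = Comp R (Comp R f (ec X)) b"
      using comp_assoc[OF ab(1) eX f] comp_assoc[OF ab(2) eX f] by simp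
    then show "Comp R ?n a = Comp R ?n b"
      unfolding g(2)[symmetric] using comp_assoc[OF ab(1) eg mY] comp_assoc[OF ab(2) eg mY] by simp
  qed
  then have k: "kle D (FArr F ?m) (FArr F ?n)"
    by (rule F_kle[OF Sx chosen(4)[OF o(1)] chosen(4)[OF o(2)] mh nh])
  note Fg = F_hom[OF Sx Sy g(1)]
  note eFg = D.comp_hom[OF Fg img(1)[OF o(2)]]
  have "kle D (eps X) (FArr F ?n)"
    using D.kle_comp_monic[OF _ img(1)[OF o(1)] img(3)[OF o(1)]] k img(5)[OF o(1)] by simp
  then have "kle D (eps X) (Comp D (eps Y) (FArr F g))"
    using D.kle_monic_cancel[OF _ img(1)[OF o(1)] eFg img(3)[OF o(2)] img(4)[OF o(2)]] mu_eps_comp[OF Sx g(1) o(2)] by simp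
  then obtain h where h: "h \<in> Hom D (Im X) (Im Y)" "Comp D h (eps X) = Comp D (eps Y) (FArr F g)"
    using D.regular_epi_factor[OF img(2)[OF o(1)] img(1)[OF o(1)] eFg] by blast
  show ?thesis
  proof (intro bexI[OF _ h(1)] ballI impI)
    fix g' assume g': "g' \<in> Hom R (Pc X) (Pc Y)" "Comp R (ec Y) g' = Comp R f (ec X)"
    show "Comp D h (eps X) = Comp D (eps Y) (FArr F g')"
      using h(2) eps_comp_eq[OF Sx g(1) g'(1) o(2)] g(2) g'(2) by simp
  qed
qed

definition "extA f = (SOME h. h \<in> Hom D (Im (Dom R f)) (Im (Cod R f)) \<and>
  (\<forall>g \<in> Hom R (Pc (Dom R f)) (Pc (Cod R f)).
    Comp R (ec (Cod R f)) g = Comp R f (ec (Dom R f)) \<longrightarrow>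
    Comp D h (eps (Dom R f)) = Comp D (eps (Cod R f)) (FArr F g)))"

lemma extA:
  assumes f: "f \<in> Hom R X Y"
  shows "extA f \<in> Hom D (Im X) (Im Y)"
    "g \<in> Hom R (Pc X) (Pc Y) \<Longrightarrow> Comp R (ec Y) g = Comp R f (ec X) \<Longrightarrow>
      Comp D (extA f) (eps X) = Comp D (eps Y) (FArr F g)"
proof -
  have "\<exists>h. h \<in> Hom D (Im X) (Im Y) \<and> (\<forall>g \<in> Hom R (Pc X) (Pc Y).
    Comp R (ec Y) g = Comp R f (ec X) \<longrightarrow> Comp D h (eps X) = Comp D (eps Y) (FArr F g))"
    using ext_ex[OF f] by blast
  from someI_ex[OF this] show "extA f \<in> Hom D (Im X) (Im Y)"
    "g \<in> Hom R (Pc X) (Pc Y) \<Longrightarrow> Comp R (ec Y) g = Comp R f (ec X) \<Longrightarrow>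
      Comp D (extA f) (eps X) = Comp D (eps Y) (FArr F g)"
    unfolding extA_def homD(2,3)[OF f] by blast+
qed

definition "Ext = \<lparr>FObj = restrict Im (Obj R), FArr = restrict extA (Arr R)\<rparr>"

lemma Ext_FObj: "X \<in> Obj R \<Longrightarrow> FObj Ext X = Im X"
  by (simp add: Ext_def)

lemma Ext_lift:
  assumes f: "f \<in> Hom R X Y" and g: "g \<in> Hom R (Pc X) (Pc Y)" "Comp R (ec Y) g = Comp R f (ec X)"
  shows "Comp D (FArr Ext f) (eps X) = Comp D (eps Y) (FArr F g)"
  using extA(2)[OF f g] homD(1)[OF f] by (simp add: Ext_def)

text \<open>Both laws are checked after precomposing with \<open>eps X\<close>. For a composite, the
  composite of two lifts serves as a lift.\<close>

lemma Ext_functor: "is_functor R D Ext"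
proof (rule is_functorI)
  have hom: "FArr Ext f \<in> Hom D (Im X) (Im Y)" if f: "f \<in> Hom R X Y" for X Y f
    using extA(1)[OF f] homD(1)[OF f] by (simp add: Ext_def)
  then show "FArr Ext f \<in> Hom D (FObj Ext X) (FObj Ext Y)" if f: "f \<in> Hom R X Y" for X Y f
    using that hom_obj[OF that] Ext_FObj by simp
  show "FObj Ext X \<in> Obj D" if "X \<in> Obj R" for X
    using D.hom_obj[OF img(1)[OF that]] Ext_FObj[OF that] by simp
  show "FArr Ext (Ident R X) = Ident D (FObj Ext X)" if X: "X \<in> Obj R" for X
  proof -
    have "Im X \<in> Obj D" using D.hom_obj[OF img(1)[OF X]] by blast
    moreover have "Comp D (FArr Ext (Ident R X)) (eps X) = Comp D (Ident D (Im X)) (eps X)"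
      using Ext_lift[OF ident_hom[OF X] ident_hom[OF chosen_obj(1)[OF X]]] F_id[OF chosen(1)[OF X] chosen_obj(1)[OF X]]
        comp_ident_left[OF chosen(2)[OF X]] comp_ident_right[OF chosen(2)[OF X]]
        D.comp_ident_left[OF img(1)[OF X]] D.comp_ident_right[OF img(1)[OF X]] by simp
    ultimately show ?thesis
      using eps_cancel[OF X hom[OF ident_hom[OF X]] D.ident_hom] Ext_FObj[OF X] by simp
  qed
  show "FArr Ext (Comp R g f) = Comp D (FArr Ext g) (FArr Ext f)"
    if f: "f \<in> Hom R X Y" and g: "g \<in> Hom R Y Z" for X Y Z f g
  proof -
    have o: "X \<in> Obj R" "Y \<in> Obj R" "Z \<in> Obj R" using hom_obj[OF f] hom_obj[OF g] by auto
    note eX = chosen(2)[OF o(1)] and eY = chosen(2)[OF o(2)] and eZ = chosen(2)[OF o(3)]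
    note SS = chosen(1)[OF o(1)] chosen(1)[OF o(2)] chosen(1)[OF o(3)]
    obtain a where a: "a \<in> Hom R (Pc X) (Pc Y)" "Comp R (ec Y) a = Comp R f (ec X)" using lift_arr[OF f] .
    obtain b where b: "b \<in> Hom R (Pc Y) (Pc Z)" "Comp R (ec Z) b = Comp R g (ec Y)" using lift_arr[OF g] .
    have "Comp R (ec Z) (Comp R b a) = Comp R (Comp R g f) (ec X)"
      using comp_eq_ext[OF b(2) a(1) b(1) eZ eY g] a(2) comp_assoc[OF eX f g] by simp
    then have "Comp D (FArr Ext (Comp R g f)) (eps X) = Comp D (eps Z) (FArr F (Comp R b a))"
      using Ext_lift[OF comp_hom[OF f g] comp_hom[OF a(1) b(1)]] by blast
    also have "\<dots> = Comp D (Comp D (eps Z) (FArr F b)) (FArr F a)"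
      using F_comp[OF SS a(1) b(1)] D.comp_assoc[OF F_hom[OF SS(1,2) a(1)] F_hom[OF SS(2,3) b(1)] img(1)[OF o(3)]] by simp
    also have "\<dots> = Comp D (FArr Ext g) (Comp D (eps Y) (FArr F a))"
      using Ext_lift[OF g b] D.comp_assoc[OF F_hom[OF SS(1,2) a(1)] img(1)[OF o(2)] hom[OF g]] by simp
    also have "\<dots> = Comp D (Comp D (FArr Ext g) (FArr Ext f)) (eps X)"
      using Ext_lift[OF f a] D.comp_assoc[OF img(1)[OF o(1)] hom[OF f] hom[OF g]] by simp
    finally show ?thesis
      by (rule eps_cancel[OF o(1) hom[OF comp_hom[OF f g]] D.comp_hom[OF hom[OF f] hom[OF g]]])
  qed
qed (simp_all add: Ext_def category_axioms D.category_axioms)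

lemma Ext_hom: "f \<in> Hom R X Y \<Longrightarrow> FArr Ext f \<in> Hom D (Im X) (Im Y)"
  using functorD(5)[OF Ext_functor] Ext_FObj hom_obj by metis

lemma Ext_comp: "f \<in> Hom R X Y \<Longrightarrow> g \<in> Hom R Y Z \<Longrightarrow>
    FArr Ext (Comp R g f) = Comp D (FArr Ext g) (FArr Ext f)"
  using functorD(7)[OF Ext_functor] .

text \<open>The cover of an object of \<open>S\<close> is an identity, so a lift of \<open>f\<close>
  is simply a factorization of \<open>f\<close> through \<open>ec X\<close>.\<close>

lemma Ext_from_S:
  assumes A: "A \<in> S" and f: "f \<in> Hom R A X" and g: "g \<in> Hom R A (Pc X)" "Comp R (ec X) g = f"
  shows "FArr Ext f = Comp D (eps X) (FArr F g)"
proof -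
  have Ao: "A \<in> Obj R" using hom_obj[OF f] by blast
  note c = chosen_S[OF A]
  have "Comp D (FArr Ext f) (eps A) = Comp D (eps X) (FArr F g)"
    using Ext_lift[OF f, of g] c g comp_ident_right[OF f] by simp
  then show ?thesis
    using img_S[OF A] D.comp_ident_right[OF Ext_hom[OF f]] by simp
qed

lemma Ext_S:
  assumes "A \<in> S" "B \<in> S" "f \<in> Hom R A B"
  shows "FArr Ext f = FArr F f"
  using Ext_from_S[OF assms(1,3), of f] chosen_S[OF assms(2)] comp_ident_left[OF assms(3)] assms(3)
    img_S[OF assms(2)] D.comp_ident_left[OF F_hom[OF assms]] by simp

text \<open>Since the chosen covers go to the regular epis of the image factorizations,
  \<open>Ext\<close> is regular at least on them; the general case is reduced to this one.\<close>

lemma Ext_ec: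
  assumes X: "X \<in> Obj R"
  shows "FArr Ext (ec X) = eps X"
  using Ext_from_S[OF chosen(1)[OF X] chosen(2)[OF X] ident_hom[OF chosen_obj(1)[OF X]]]
    comp_ident_right[OF chosen(2)[OF X]] F_id[OF chosen(1)[OF X] chosen_obj(1)[OF X]]
    D.comp_ident_right[OF img(1)[OF X]] by simp

lemma Ext_restrict: "fcomp PR Ext (inclusion R S) = F"
proof (rule functor_eqI)
  show "is_functor PR D (fcomp PR Ext (inclusion R S))"
    by (rule fcomp_functor[OF lex_functorD(1)[OF lex_incl] Ext_functor])
  show "is_functor PR D F" using lex_functorD(1)[OF F] .
  show "FObj (fcomp PR Ext (inclusion R S)) A = FObj F A" if "A \<in> Obj PR" for A
    using that Ext_FObj img_S by simp
  show "FArr (fcomp PR Ext (inclusion R S)) f = FArr F f" if f: "f \<in> Arr PR" for f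
  proof -
    have "f \<in> Hom R (Dom R f) (Cod R f)" "Dom R f \<in> S" "Cod R f \<in> S"
      using f by (auto simp: full_sub_def Hom_def)
    then show ?thesis using Ext_S f by simp
  qed
qed

text \<open>Any mono from \<open>X\<close> into an object of \<open>S\<close> gives the same kernel
  pair on \<open>Pc X\<close> as the chosen mono. Applying \<open>F\<close>, the arrow
  \<open>FArr Ext m\<close> after \<open>eps X\<close> identifies no more than \<open>eps X\<close>,
  so \<open>monic_of_kle\<close> applies.\<close>

lemma Ext_monic_S:
  assumes m: "m \<in> Hom R X Q" "monic R m" and Q: "Q \<in> S"
  shows "monic D (FArr Ext m)"
proof -
  have X: "X \<in> Obj R" using hom_obj[OF m(1)] by blast
  note e = chosen(2)[OF X] and n = chosen(5)[OF X] and SS = chosen(1)[OF X] chosen(4)[OF X]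
  note me = comp_hom[OF e m(1)] and ne = comp_hom[OF e n]
  have "kle R (Comp R m (ec X)) (Comp R (mc X) (ec X))"
  proof (rule kleI[OF me])
    fix W a b assume ab: "a \<in> Hom R W (Pc X)" "b \<in> Hom R W (Pc X)"
      "Comp R (Comp R m (ec X)) a = Comp R (Comp R m (ec X)) b"
    then have "Comp R m (Comp R (ec X) a) = Comp R m (Comp R (ec X) b)"
      using comp_assoc[OF ab(1) e m(1)] comp_assoc[OF ab(2) e m(1)] by simp
    then have "Comp R (ec X) a = Comp R (ec X) b"
      using monicD[OF m(2,1) comp_hom[OF ab(1) e] comp_hom[OF ab(2) e]] by blast
    then show "Comp R (Comp R (mc X) (ec X)) a = Comp R (Comp R (mc X) (ec X)) b"
      using comp_assoc[OF ab(1) e n] comp_assoc[OF ab(2) e n] by simp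
  qed
  then have "kle D (FArr F (Comp R m (ec X))) (FArr F (Comp R (mc X) (ec X)))"
    using F_kle[OF SS(1) Q SS(2) me ne] by blast
  moreover have "FArr F (Comp R m (ec X)) = Comp D (FArr Ext m) (eps X)"
    using Ext_S[OF SS(1) Q me] Ext_comp[OF e m(1)] Ext_ec[OF X] by simp
  ultimately have "kle D (Comp D (FArr Ext m) (eps X)) (eps X)"
    using D.kle_monic_cancel[OF _ D.comp_hom[OF img(1)[OF X] Ext_hom[OF m(1)]] img(1)[OF X] img(3)[OF X] img(4)[OF X]]
      img(5)[OF X] by simp
  then show ?thesis by (rule D.monic_of_kle[OF img(2)[OF X] img(1)[OF X] Ext_hom[OF m(1)]])
qed

text \<open>Composing with the embedding of \<open>Y\<close> moves the target into \<open>S\<close>;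
  a first factor of a mono is a mono.\<close>

lemma Ext_monic:
  assumes m: "m \<in> Hom R X Y" "monic R m"
  shows "monic D (FArr Ext m)"
proof -
  have Y: "Y \<in> Obj R" using hom_obj[OF m(1)] by blast
  note n = chosen(5)[OF Y] chosen(6)[OF Y]
  have "monic D (FArr Ext (Comp R (mc Y) m))"
    by (rule Ext_monic_S[OF comp_hom[OF m(1) n(1)] monic_comp[OF m(2) n(2) m(1) n(1)] chosen(4)[OF Y]])
  then show ?thesis
    using D.monic_cancel[OF _ Ext_hom[OF m(1)] Ext_hom[OF n(1)]] Ext_comp[OF m(1) n(1)] by simp
qed

section \<open>Finite limits and regular epimorphisms under the extension\<close>

lemma product_PR:
  assumes "product PR X Y Z p q"
  shows "product R X Y Z p q" "Z \<in> S"
proof -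
  note pq = productD(1,2)[OF assms]
  interpret PR: category PR by (rule lex_categoryD(1)[OF lex_sub])
  have o: "X \<in> Obj PR" "Y \<in> Obj PR" "Z \<in> Obj PR" using PR.hom_obj[OF pq(1)] PR.hom_obj[OF pq(2)] by auto
  show "product R X Y Z p q"
    using lex_functorD(3)[OF lex_incl assms] o homD(1)[OF pq(1)] homD(1)[OF pq(2)] by simp
  show "Z \<in> S" using o by simp
qed

text \<open>\<open>Z\<close> is squeezed between two products in \<open>S\<close>: it maps by a mono
  into the product \<open>Q\<close> of \<open>Qc X\<close> and \<open>Qc Y\<close>, and it receives
  an arrow from the product \<open>A\<close> of \<open>Pc X\<close> and \<open>Pc Y\<close>. Since
  \<open>F\<close> preserves both, uniqueness of pairings comes from \<open>Q\<close> and their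
  local existence from \<open>A\<close>.\<close>

lemma Ext_product:
  assumes Z: "product R X Y Z p q"
  shows "product D (Im X) (Im Y) (Im Z) (FArr Ext p) (FArr Ext q)"
proof -
  note pq = productD(1,2)[OF Z]
  have o: "X \<in> Obj R" "Y \<in> Obj R" "Z \<in> Obj R" using hom_obj[OF pq(1)] hom_obj[OF pq(2)] by auto
  note eX = chosen(2)[OF o(1)] and eY = chosen(2)[OF o(2)] and mX = chosen(5)[OF o(1)] and mY = chosen(5)[OF o(2)]
  have oS: "Pc X \<in> Obj PR" "Pc Y \<in> Obj PR" "Qc X \<in> Obj PR" "Qc Y \<in> Obj PR"
    using chosen(1,4) chosen_obj o by auto
  obtain Q q1 q2 where Q: "product PR (Qc X) (Qc Y) Q q1 q2" using lex_categoryD(3)[OF lex_sub oS(3,4)] by blast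
  obtain A p1 p2 where A: "product PR (Pc X) (Pc Y) A p1 p2" using lex_categoryD(3)[OF lex_sub oS(1,2)] by blast
  note QR = product_PR[OF Q] and AR = product_PR[OF A]
  note q12 = productD(1,2)[OF QR(1)] and p12 = productD(1,2)[OF AR(1)]
  obtain m where m: "m \<in> Hom R Z Q" "Comp R q1 m = Comp R (mc X) p" "Comp R q2 m = Comp R (mc Y) q"
    using productD(3)[OF QR(1) comp_hom[OF pq(1) mX] comp_hom[OF pq(2) mY]] by blast
  have "monic R m"
  proof (rule monicI[OF m(1)])
    fix W a b assume ab: "a \<in> Hom R W Z" "b \<in> Hom R W Z" "Comp R m a = Comp R m b"
    have "Comp R (mc X) (Comp R p a) = Comp R (mc X) (Comp R p b)"
      using comp_eq_ext[OF m(2) ab(1) m(1) q12(1) pq(1) mX] comp_eq_ext[OF m(2) ab(2) m(1) q12(1) pq(1) mX] ab(3) by simp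
    then have 1: "Comp R p a = Comp R p b"
      using monicD[OF chosen(6)[OF o(1)] mX comp_hom[OF ab(1) pq(1)] comp_hom[OF ab(2) pq(1)]] by blast
    have "Comp R (mc Y) (Comp R q a) = Comp R (mc Y) (Comp R q b)"
      using comp_eq_ext[OF m(3) ab(1) m(1) q12(2) pq(2) mY] comp_eq_ext[OF m(3) ab(2) m(1) q12(2) pq(2) mY] ab(3) by simp
    then have 2: "Comp R q a = Comp R q b"
      using monicD[OF chosen(6)[OF o(2)] mY comp_hom[OF ab(1) pq(2)] comp_hom[OF ab(2) pq(2)]] by blast
    show "a = b" by (rule productD(4)[OF Z ab(1,2) 1 2 category_axioms])
  qed
  then have mono: "monic D (FArr Ext m)" using Ext_monic[OF m(1)] by blast
  note FQ = lex_functorD(3)[OF F Q] and FA = lex_functorD(3)[OF F A]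
  have Eq: "FArr Ext q1 = FArr F q1" "FArr Ext q2 = FArr F q2" "FArr Ext p1 = FArr F p1" "FArr Ext p2 = FArr F p2"
    using Ext_S[OF _ _ q12(1)] Ext_S[OF _ _ q12(2)] Ext_S[OF _ _ p12(1)] Ext_S[OF _ _ p12(2)] QR(2) AR(2) oS by auto
  have IS: "Im Q = FObj F Q" "Im A = FObj F A" "Im (Qc X) = FObj F (Qc X)" "Im (Qc Y) = FObj F (Qc Y)"
    "Im (Pc X) = FObj F (Pc X)" "Im (Pc Y) = FObj F (Pc Y)"
    using img_S QR(2) AR(2) oS by auto
  note Em = Ext_hom[OF m(1)] and Ep = Ext_hom[OF pq(1)] and Eq' = Ext_hom[OF pq(2)]
  have uniq: "a = b" if ab: "a \<in> Hom D W (Im Z)" "b \<in> Hom D W (Im Z)"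
    "Comp D (FArr Ext p) a = Comp D (FArr Ext p) b" "Comp D (FArr Ext q) a = Comp D (FArr Ext q) b" for W a b
  proof -
    have 1: "Comp D (FArr Ext q1) (FArr Ext m) = Comp D (FArr Ext (mc X)) (FArr Ext p)"
      using Ext_comp[OF m(1) q12(1)] Ext_comp[OF pq(1) mX] m(2) by simp
    have 2: "Comp D (FArr Ext q2) (FArr Ext m) = Comp D (FArr Ext (mc Y)) (FArr Ext q)"
      using Ext_comp[OF m(1) q12(2)] Ext_comp[OF pq(2) mY] m(3) by simp
    note x1 = D.comp_eq_ext[OF 1 _ Em Ext_hom[OF q12(1)] Ep Ext_hom[OF mX]]
    note x2 = D.comp_eq_ext[OF 2 _ Em Ext_hom[OF q12(2)] Eq' Ext_hom[OF mY]]
    have "Comp D (FArr Ext m) a = Comp D (FArr Ext m) b"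
    proof (rule productD(4)[OF FQ _ _ _ _ D.category_axioms])
      show "Comp D (FArr Ext m) a \<in> Hom D W (FObj F Q)" "Comp D (FArr Ext m) b \<in> Hom D W (FObj F Q)"
        using D.comp_hom[OF ab(1) Em] D.comp_hom[OF ab(2) Em] IS by auto
      show "Comp D (FArr F q1) (Comp D (FArr Ext m) a) = Comp D (FArr F q1) (Comp D (FArr Ext m) b)"
        using x1[OF ab(1)] x1[OF ab(2)] ab(3) Eq by simp
      show "Comp D (FArr F q2) (Comp D (FArr Ext m) a) = Comp D (FArr F q2) (Comp D (FArr Ext m) b)"
        using x2[OF ab(1)] x2[OF ab(2)] ab(4) Eq by simp
    qed
    then show "a = b" by (rule monicD[OF mono Em ab(1,2)])
  qed
  obtain c where c: "c \<in> Hom R A Z" "Comp R p c = Comp R (ec X) p1" "Comp R q c = Comp R (ec Y) p2"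
    using productD(3)[OF Z comp_hom[OF p12(1) eX] comp_hom[OF p12(2) eY]] by blast
  note Ec = Ext_hom[OF c(1)]
  have ex: "\<exists>d \<in> Hom D W (Im Z). Comp D (FArr Ext p) d = u \<and> Comp D (FArr Ext q) d = v"
    if uv: "u \<in> Hom D W (Im X)" "v \<in> Hom D W (Im Y)" for W u v
  proof -
    \<comment> \<open>After passing to a cover \<open>w\<close> of \<open>W\<close>, both arrows
      lift to the covers and pair up in \<open>FObj F A\<close>.\<close>
    obtain W' w u' v' where w: "w \<in> Hom D W' W" "regular_epi D w"
      and u': "u' \<in> Hom D W' (FObj F (Pc X))" "Comp D (eps X) u' = Comp D u w"
      and v': "v' \<in> Hom D W' (FObj F (Pc Y))" "Comp D (eps Y) v' = Comp D v w"
      using D.cover_lift2[OF img(2)[OF o(1)] img(1)[OF o(1)] uv(1) img(2)[OF o(2)] img(1)[OF o(2)] uv(2)] .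
    obtain s where s: "s \<in> Hom D W' (FObj F A)" "Comp D (FArr F p1) s = u'" "Comp D (FArr F p2) s = v'"
      using productD(3)[OF FA u'(1) v'(1)] by blast
    have s': "s \<in> Hom D W' (Im A)" using s(1) IS by simp
    let ?t = "Comp D (FArr Ext c) s"
    have t: "?t \<in> Hom D W' (Im Z)" using D.comp_hom[OF s' Ec] .
    have pc: "Comp D (FArr Ext p) (FArr Ext c) = Comp D (FArr Ext (ec X)) (FArr Ext p1)"
      using Ext_comp[OF c(1) pq(1)] Ext_comp[OF p12(1) eX] c(2) by simp
    have pt: "Comp D (FArr Ext p) ?t = Comp D u w"
      using D.comp_eq_ext[OF pc s' Ec Ep Ext_hom[OF p12(1)] Ext_hom[OF eX]] Ext_ec[OF o(1)] Eq s u' by simp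
    have qc: "Comp D (FArr Ext q) (FArr Ext c) = Comp D (FArr Ext (ec Y)) (FArr Ext p2)"
      using Ext_comp[OF c(1) pq(2)] Ext_comp[OF p12(2) eY] c(3) by simp
    have qt: "Comp D (FArr Ext q) ?t = Comp D v w"
      using D.comp_eq_ext[OF qc s' Ec Eq' Ext_hom[OF p12(2)] Ext_hom[OF eY]] Ext_ec[OF o(2)] Eq s v' by simp
    \<comment> \<open>Descent of the local pairing: elements identified by \<open>w\<close> have
      equal projections after \<open>?t\<close>, so \<open>uniq\<close> makes their images
      equal.\<close>
    have "kle D w ?t"
    proof (rule kleI[OF w(1)])
      fix V a b assume ab: "a \<in> Hom D V W'" "b \<in> Hom D V W'" "Comp D w a = Comp D w b"
      have 1: "Comp D (FArr Ext p) (Comp D ?t x) = Comp D u (Comp D w x)" if "x \<in> Hom D V W'" for x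
        using D.comp_eq_ext[OF pt that t Ep w(1) uv(1)] .
      have 2: "Comp D (FArr Ext q) (Comp D ?t x) = Comp D v (Comp D w x)" if "x \<in> Hom D V W'" for x
        using D.comp_eq_ext[OF qt that t Eq' w(1) uv(2)] .
      show "Comp D ?t a = Comp D ?t b"
        by (rule uniq[OF D.comp_hom[OF ab(1) t] D.comp_hom[OF ab(2) t]])
          (simp_all add: 1[OF ab(1)] 1[OF ab(2)] 2[OF ab(1)] 2[OF ab(2)] ab(3))
    qed
    then obtain d where d: "d \<in> Hom D W (Im Z)" "Comp D d w = ?t"
      using D.regular_epi_factor[OF w(2,1) t] by blast
    have "Comp D (FArr Ext p) d = u"
      by (rule D.regular_epi_cancel[OF w(2,1) D.comp_hom[OF d(1) Ep] uv(1)])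
        (use D.comp_assoc[OF w(1) d(1) Ep] d(2) pt in simp)
    moreover have "Comp D (FArr Ext q) d = v"
      by (rule D.regular_epi_cancel[OF w(2,1) D.comp_hom[OF d(1) Eq'] uv(2)])
        (use D.comp_assoc[OF w(1) d(1) Eq'] d(2) qt in simp)
    ultimately show ?thesis using d(1) by blast
  qed
  show ?thesis unfolding product_def
  proof (intro conjI Ep Eq' allI ballI)
    fix W a b assume ab: "a \<in> Hom D W (Im X)" "b \<in> Hom D W (Im Y)"
    obtain d where d: "d \<in> Hom D W (Im Z)" "Comp D (FArr Ext p) d = a" "Comp D (FArr Ext q) d = b"
      using ex[OF ab] by blast
    show "\<exists>!u. u \<in> Hom D W (Im Z) \<and> Comp D (FArr Ext p) u = a \<and> Comp D (FArr Ext q) u = b"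
      by (rule ex1I[of _ d]) (use d uniq in blast)+
  qed
qed

text \<open>The pair \<open>f\<close>, \<open>g\<close> is replaced by the pair \<open>F1\<close>,
  \<open>G1\<close> in \<open>S\<close>, whose equalizer \<open>J\<close> the functor
  \<open>F\<close> preserves. As \<open>mc Y\<close> is monic, \<open>J\<close> maps into
  \<open>E\<close>; this gives solutions locally, and they descend because \<open>Ext\<close> keeps
  \<open>i\<close> monic.\<close>

lemma Ext_equalizer:
  assumes E: "equalizer R X Y f g E i"
  shows "equalizer D (Im X) (Im Y) (FArr Ext f) (FArr Ext g) (Im E) (FArr Ext i)"
proof -
  note fg = equalizerD(1,2)[OF E] and i = equalizerD(3)[OF E]
  have o: "X \<in> Obj R" "Y \<in> Obj R" "E \<in> Obj R" using hom_obj[OF fg(1)] hom_obj[OF i] by auto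
  note eX = chosen(2)[OF o(1)] and mY = chosen(5)[OF o(2)]
  note Ei = Ext_hom[OF i] and Ef = Ext_hom[OF fg(1)] and Eg = Ext_hom[OF fg(2)]
  have mono: "monic D (FArr Ext i)" using Ext_monic[OF i equalizerD(6)[OF E category_axioms]] .
  have eq: "Comp D (FArr Ext f) (FArr Ext i) = Comp D (FArr Ext g) (FArr Ext i)"
    using Ext_comp[OF i fg(1)] Ext_comp[OF i fg(2)] equalizerD(4)[OF E] by simp
  define F1 where "F1 = Comp R (mc Y) (Comp R f (ec X))"
  define G1 where "G1 = Comp R (mc Y) (Comp R g (ec X))"
  note fe = comp_hom[OF eX fg(1)] and ge = comp_hom[OF eX fg(2)]
  have FG: "F1 \<in> Hom R (Pc X) (Qc Y)" "G1 \<in> Hom R (Pc X) (Qc Y)"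
    unfolding F1_def G1_def using comp_hom[OF fe mY] comp_hom[OF ge mY] by auto
  have SS: "Pc X \<in> S" "Qc Y \<in> S" using chosen o by auto
  obtain J j where J: "equalizer PR (Pc X) (Qc Y) F1 G1 J j"
    using lex_categoryD(4)[OF lex_sub, of F1 "Pc X" "Qc Y" G1] FG SS by (auto simp: hom_PR)
  have j': "j \<in> Hom PR J (Pc X)" using equalizerD(3)[OF J] .
  then have j: "j \<in> Hom R J (Pc X)" "J \<in> S" by (auto simp: hom_full_sub split: if_splits)
  have "Comp R F1 j = Comp R G1 j" using equalizerD(4)[OF J] by simp
  then have "Comp R (mc Y) (Comp R f (Comp R (ec X) j)) = Comp R (mc Y) (Comp R g (Comp R (ec X) j))"
    unfolding F1_def G1_def
    using comp_assoc[OF j(1) fe mY] comp_assoc[OF j(1) ge mY] comp_assoc[OF j(1) eX fg(1)] comp_assoc[OF j(1) eX fg(2)] by simp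
  note ej = comp_hom[OF j(1) eX]
  then have "Comp R f (Comp R (ec X) j) = Comp R g (Comp R (ec X) j)"
    using monicD[OF chosen(6)[OF o(2)] mY comp_hom[OF ej fg(1)] comp_hom[OF ej fg(2)]]
      \<open>Comp R (mc Y) (Comp R f (Comp R (ec X) j)) = Comp R (mc Y) (Comp R g (Comp R (ec X) j))\<close> by blast
  then obtain c where c: "c \<in> Hom R J E" "Comp R i c = Comp R (ec X) j"
    using equalizerD(5)[OF E ej] by blast
  note Ec = Ext_hom[OF c(1)]
  have ex: "\<exists>d \<in> Hom D W (Im E). Comp D (FArr Ext i) d = u"
    if u: "u \<in> Hom D W (Im X)" and fu: "Comp D (FArr Ext f) u = Comp D (FArr Ext g) u" for W u
  proof -
    obtain W' w u' where w: "w \<in> Hom D W' W" "regular_epi D w"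
      and u': "u' \<in> Hom D W' (FObj F (Pc X))" "Comp D (eps X) u' = Comp D u w"
      using D.cover_lift[OF img(2)[OF o(1)] img(1)[OF o(1)] u] .
    have x: "Comp D (FArr F (Comp R (mc Y) (Comp R h (ec X)))) u' =
        Comp D (FArr Ext (mc Y)) (Comp D (Comp D (FArr Ext h) u) w)" if h: "h \<in> Hom R X Y" for h
    proof -
      note he = comp_hom[OF eX h]
      have "FArr F (Comp R (mc Y) (Comp R h (ec X))) = Comp D (FArr Ext (mc Y)) (Comp D (FArr Ext h) (eps X))"
        using Ext_S[OF SS comp_hom[OF he mY]] Ext_comp[OF he mY] Ext_comp[OF eX h] Ext_ec[OF o(1)] by simp
      then have "Comp D (FArr F (Comp R (mc Y) (Comp R h (ec X)))) u' =
          Comp D (FArr Ext (mc Y)) (Comp D (Comp D (FArr Ext h) (eps X)) u')"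
        using D.comp_assoc[OF u'(1) D.comp_hom[OF img(1)[OF o(1)] Ext_hom[OF h]] Ext_hom[OF mY]] by simp
      also have "Comp D (Comp D (FArr Ext h) (eps X)) u' = Comp D (Comp D (FArr Ext h) u) w"
        using D.comp_assoc[OF u'(1) img(1)[OF o(1)] Ext_hom[OF h]] D.comp_assoc[OF w(1) u Ext_hom[OF h]] u'(2) by simp
      finally show ?thesis .
    qed
    have "Comp D (FArr F F1) u' = Comp D (FArr F G1) u'"
      unfolding F1_def G1_def x[OF fg(1)] x[OF fg(2)] fu ..
    then obtain z where z: "z \<in> Hom D W' (FObj F J)" "Comp D (FArr F j) z = u'"
      using equalizerD(5)[OF lex_functorD(4)[OF F J] u'(1)] by blast
    have z': "z \<in> Hom D W' (Im J)" using z(1) img_S[OF j(2)] by simp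
    let ?t = "Comp D (FArr Ext c) z"
    have t: "?t \<in> Hom D W' (Im E)" using D.comp_hom[OF z' Ec] .
    have ic: "Comp D (FArr Ext i) (FArr Ext c) = Comp D (FArr Ext (ec X)) (FArr Ext j)"
      using Ext_comp[OF c(1) i] Ext_comp[OF j(1) eX] c(2) by simp
    have it: "Comp D (FArr Ext i) ?t = Comp D u w"
      using D.comp_eq_ext[OF ic z' Ec Ei Ext_hom[OF j(1)] Ext_hom[OF eX]] Ext_ec[OF o(1)]
        Ext_S[OF j(2) SS(1) j(1)] z u' by simp
    \<comment> \<open>Descent may be tested behind the mono \<open>FArr Ext i\<close>, where the
      local solution becomes \<open>u\<close> after \<open>w\<close>.\<close>
    have "kle D w (Comp D (FArr Ext i) ?t)"
    proof (rule kleI[OF w(1)])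
      fix V a b assume ab: "a \<in> Hom D V W'" "b \<in> Hom D V W'" "Comp D w a = Comp D w b"
      show "Comp D (Comp D (FArr Ext i) ?t) a = Comp D (Comp D (FArr Ext i) ?t) b"
        unfolding it using D.comp_assoc[OF ab(1) w(1) u] D.comp_assoc[OF ab(2) w(1) u] ab(3) by simp
    qed
    then have "kle D w ?t" by (rule D.kle_monic_cancel[OF _ w(1) t Ei mono])
    then obtain d where d: "d \<in> Hom D W (Im E)" "Comp D d w = ?t"
      using D.regular_epi_factor[OF w(2,1) t] by blast
    have "Comp D (FArr Ext i) d = u"
      by (rule D.regular_epi_cancel[OF w(2,1) D.comp_hom[OF d(1) Ei] u])
        (use D.comp_assoc[OF w(1) d(1) Ei] d(2) it in simp)
    then show ?thesis using d(1) by blast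
  qed
  show ?thesis unfolding equalizer_def
  proof (intro conjI Ef Eg Ei eq allI ballI impI)
    fix W a assume a: "a \<in> Hom D W (Im X)" "Comp D (FArr Ext f) a = Comp D (FArr Ext g) a"
    obtain d where d: "d \<in> Hom D W (Im E)" "Comp D (FArr Ext i) d = a" using ex[OF a] by blast
    show "\<exists>!u. u \<in> Hom D W (Im E) \<and> Comp D (FArr Ext i) u = a"
      by (rule ex1I[of _ d]) (use d monicD[OF mono Ei] in auto)
  qed
qed

lemma Ext_lex: "lex_functor R D Ext"
proof (rule lex_of_products_equalizers(2)[OF Ext_functor])
  obtain T where T: "terminal PR T" using lex_categoryD(2)[OF lex_sub] by blast
  then have "T \<in> S" "T \<in> Obj R" by (auto simp: terminal_def)
  then show "\<exists>T. terminal R T \<and> terminal D (FObj Ext T)"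
    using lex_functorD(2)[OF lex_incl T] lex_functorD(2)[OF F T] Ext_FObj img_S by auto
next
  fix X Y assume o: "X \<in> Obj R" "Y \<in> Obj R"
  obtain Z p q where Z: "product R X Y Z p q" using lex_categoryD(3)[OF lex o] by blast
  moreover have "Z \<in> Obj R" using hom_obj[OF productD(1)[OF Z]] by blast
  ultimately show "\<exists>Z p q. product R X Y Z p q \<and>
      product D (FObj Ext X) (FObj Ext Y) (FObj Ext Z) (FArr Ext p) (FArr Ext q)"
    using Ext_product[OF Z] Ext_FObj o by metis
next
  fix X Y f g assume fg: "f \<in> Hom R X Y" "g \<in> Hom R X Y"
  obtain E e where E: "equalizer R X Y f g E e" using lex_categoryD(4)[OF lex fg] by blast
  moreover have "E \<in> Obj R" "X \<in> Obj R" "Y \<in> Obj R" using hom_obj[OF equalizerD(3)[OF E]] hom_obj[OF fg(1)] by auto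
  ultimately show "\<exists>Z e. equalizer R X Y f g Z e \<and>
      equalizer D (FObj Ext X) (FObj Ext Y) (FArr Ext f) (FArr Ext g) (FObj Ext Z) (FArr Ext e)"
    using Ext_equalizer[OF E] Ext_FObj by metis
qed

text \<open>By projectivity the cover of \<open>Y\<close> factors through \<open>f\<close>. Its
  image \<open>eps Y\<close> is a regular epi that factors through \<open>FArr Ext f\<close>, and
  right cancellation applies.\<close>

lemma Ext_regular: "regular_functor R D Ext"
  unfolding regular_functor_def
proof (intro conjI Ext_lex allI impI)
  fix f assume re: "regular_epi R f"
  obtain X Y where f: "f \<in> Hom R X Y" using arr_hom[OF regular_epi_arr[OF re]] by blast
  have Y: "Y \<in> Obj R" using hom_obj[OF f] by blast
  obtain k where k: "k \<in> Hom R (Pc Y) X" "Comp R f k = ec Y"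
    using lift[OF chosen(1)[OF Y] chosen(2)[OF Y] f re] .
  have "Comp D (FArr Ext f) (FArr Ext k) = eps Y"
    using Ext_comp[OF k(1) f] k(2) Ext_ec[OF Y] by simp
  then show "regular_epi D (FArr Ext f)"
    using D.regular_epi_right_cancel[OF _ Ext_hom[OF k(1)] Ext_hom[OF f]] img(2)[OF Y] by simp
qed

end

context enough_projectives
begin

text \<open>The type of the test category is a free variable, so the statement can later be
  instantiated at every type that a comparison requires.\<close>

theorem reg_lex_completion_inclusion:
  "reg_lex_completion TYPE(('d, 'e) cat) PR R (inclusion R S)"
  unfolding reg_lex_completion_def
proof (intro conjI allI impI lex_sub reg lex_incl)
  fix D :: "('d, 'e) cat"
  assume D: "regular_category D"
  then interpret D: regular_cat D by unfold_locales
  let ?P = "precomp PR (inclusion R S) (Reg R D)"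
  show "equivalence (Reg R D) (Lex PR D) ?P"
  proof (rule equivalenceI)
    show "is_functor (Reg R D) (Lex PR D) ?P" by (rule precomp_functor[OF lex_incl D.category_axioms])
    fix F assume "F \<in> Obj (Lex PR D)"
    then interpret X: regular_extension R S D F
      using D by unfold_locales auto
    show "\<exists>G \<in> Obj (Reg R D). FObj ?P G = F"
      using X.Ext_regular X.Ext_restrict by (intro bexI[of _ X.Ext]) auto
  next
    fix G G' t assume "G \<in> Obj (Reg R D)" "G' \<in> Obj (Reg R D)" "t \<in> Hom (Lex PR D) (FObj ?P G) (FObj ?P G')"
    then show "\<exists>s \<in> Hom (Reg R D) G G'. FArr ?P s = t"
      using precomp_full[OF D] by simp
  next
    fix G G' t s assume "t \<in> Hom (Reg R D) G G'" "s \<in> Hom (Reg R D) G G'" "FArr ?P t = FArr ?P s"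
    then show "t = s" by (rule precomp_faithful)
  qed
qed

end

section \<open>Uniqueness of the reg/lex-completion\<close>

lemma reg_lex_completion_comparison:
  fixes D :: "('d, 'e) cat"
  assumes R: "reg_lex_completion TYPE(('d, 'e) cat) C R H" and D: "regular_category D" and K: "lex_functor C D K"
  obtains L where "regular_functor R D L" "isomorphic (functor_cat C D) (fcomp C L H) K"
proof -
  have eq: "equivalence (Reg R D) (Lex C D) (precomp C H (Reg R D))"
    using R D by (simp add: reg_lex_completion_def)
  have "K \<in> Obj (Lex C D)" using K by simp
  from equivalence_essentially_surjective[OF eq this] obtain L where L: "L \<in> Obj (Reg R D)"
    "isomorphic (Lex C D) (FObj (precomp C H (Reg R D)) L) K" .
  then show thesis using that[of L] by (simp add: Lex_def isomorphic_full_sub)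
qed

text \<open>\<open>L\<close> and the identity have isomorphic restrictions along \<open>H\<close>,
  and the restriction functor, being an equivalence, reflects isomorphism.\<close>

lemma reg_lex_completion_endofunctor:
  fixes R :: "('r, 's) cat"
  assumes R: "reg_lex_completion TYPE(('r, 's) cat) C R H" and L: "regular_functor R R L"
    and i: "isomorphic (functor_cat C R) (fcomp C L H) H"
  shows "isomorphic (functor_cat R R) L (fid R)"
proof -
  have H: "lex_functor C R H" and reg: "regular_category R"
    and eq: "equivalence (Reg R R) (Lex C R) (precomp C H (Reg R R))"
    using R by (simp_all add: reg_lex_completion_def)
  have cat: "category R" using lex_functorD(1)[OF H] functorD(2) by blast
  have id: "regular_functor R R (fid R)" by (rule regular_functor_fid[OF cat])
  have H': "fcomp C (fid R) H = H" by (rule fcomp_fid(2)[OF lex_functorD(1)[OF H]])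
  have "lex_functor C R (fcomp C L H)"
    using lex_functor_fcomp[OF H, of R L] L by (simp add: regular_functor_def)
  then have "isomorphic (Lex C R) (FObj (precomp C H (Reg R R)) L) (FObj (precomp C H (Reg R R)) (fid R))"
    using L id H H' i by (simp add: Lex_def isomorphic_full_sub)
  then have "isomorphic (Reg R R) L (fid R)"
    using equivalence_reflects_isomorphic[OF eq] L id by simp
  then show ?thesis by (simp add: Reg_def isomorphic_full_sub)
qed

text \<open>Each completion is tested against the type of the other to obtain the comparison
  functors, and against its own type to show that their composites are isomorphic to
  identities.\<close>

theorem reg_lex_completion_unique:
  fixes R :: "('r, 's) cat" and R' :: "('t, 'v) cat"
  assumes 1: "reg_lex_completion TYPE(('r, 's) cat) C R H" "reg_lex_completion TYPE(('t, 'v) cat) C R H"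
    and 2: "reg_lex_completion TYPE(('r, 's) cat) C R' H'" "reg_lex_completion TYPE(('t, 'v) cat) C R' H'"
  shows "equivalent_cats R R'"
proof -
  have H: "lex_functor C R H" "lex_functor C R' H'" and reg: "regular_category R" "regular_category R'"
    using 1 2 by (simp_all add: reg_lex_completion_def)
  note HF = lex_functorD(1)[OF H(1)] lex_functorD(1)[OF H(2)]
  obtain K where K: "regular_functor R R' K" "isomorphic (functor_cat C R') (fcomp C K H) H'"
    using reg_lex_completion_comparison[OF 1(2) reg(2) H(2)] .
  obtain L where L: "regular_functor R' R L" "isomorphic (functor_cat C R) (fcomp C L H') H"
    using reg_lex_completion_comparison[OF 2(1) reg(1) H(1)] .
  have KF: "is_functor R R' K" and LF: "is_functor R' R L"
    using K(1) L(1) by (simp_all add: regular_functor_def lex_functor_def)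
  interpret CR: category "functor_cat C R" using HF(1) functorD(1,2) by (metis category_functor_cat)
  interpret CR': category "functor_cat C R'" using HF(2) functorD(1,2) by (metis category_functor_cat)
  have "isomorphic (functor_cat C R) (fcomp C L (fcomp C K H)) H"
    using CR.isomorphic_trans[OF isomorphic_fcomp_right[OF K(2) LF] L(2)] .
  then have "isomorphic (functor_cat C R) (fcomp C (fcomp R L K) H) H"
    by (simp add: fcomp_assoc[OF HF(1)])
  then have a: "isomorphic (functor_cat R R) (fcomp R L K) (fid R)"
    by (rule reg_lex_completion_endofunctor[OF 1(1) regular_functor_fcomp[OF K(1) L(1)]])
  have "isomorphic (functor_cat C R') (fcomp C K (fcomp C L H')) H'"
    using CR'.isomorphic_trans[OF isomorphic_fcomp_right[OF L(2) KF] K(2)] .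
  then have "isomorphic (functor_cat C R') (fcomp C (fcomp R' K L) H') H'"
    by (simp add: fcomp_assoc[OF HF(2)])
  then have b: "isomorphic (functor_cat R' R') (fcomp R' K L) (fid R')"
    by (rule reg_lex_completion_endofunctor[OF 2(2) regular_functor_fcomp[OF L(1) K(1)]])
  show ?thesis unfolding equivalent_cats_def equivalence_def using KF LF a b by blast
qed

section \<open>Combinatory completeness and binding of sequences\<close>

datatype 'p tm = Var nat | Cst 'p | Ap "'p tm" "'p tm"

context pca
begin

primrec ev :: "(nat \<Rightarrow> 'p) \<Rightarrow> 'p tm \<Rightarrow> 'p option" where
  "ev e (Var n) = Some (e n)"
| "ev e (Cst c) = Some c"
| "ev e (Ap t u) = papp ap (ev e t) (ev e u)"

text \<open>Bracket abstraction without shortcuts. Distributing \<open>s\<close> down to the leaves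
  makes the abstraction denote even where the body does not, which a partial application operation
  demands.\<close>

primrec lam :: "nat \<Rightarrow> 'p tm \<Rightarrow> 'p tm" where
  "lam n (Var m) = (if m = n then Ap (Ap (Cst s) (Cst k)) (Cst k) else Ap (Cst k) (Var m))"
| "lam n (Cst c) = Ap (Cst k) (Cst c)"
| "lam n (Ap t u) = Ap (Ap (Cst s) (lam n t)) (lam n u)"

lemma papp_simps [simp]:
  "papp ap (Some x) (Some y) = ap x y" "papp ap None u = None" "papp ap u None = None"
  by (cases u; simp add: papp_def)+

lemma ap_k: obtains q where "ap k x = Some q" "\<And>y. ap q y = Some x"
proof (cases "ap k x")
  case None
  then show thesis using k_app[of x x] by simp
next
  case (Some q)
  then show thesis using that k_app[of x] by simp
qed

lemma papp_kk [simp]: "papp ap (ap k x) (ap k y) = Some x"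
proof -
  obtain q where "ap k x = Some q" "\<And>z. ap q z = Some x" by (rule ap_k[of x]) blast
  moreover obtain r where "ap k y = Some r" by (rule ap_k[of y])
  ultimately show ?thesis by simp
qed

lemma ap_s:
  obtains p q where "ap s x = Some p" "ap p y = Some q" "\<And>z. ap q z = papp ap (ap x z) (ap y z)"
proof -
  obtain p where p: "ap s x = Some p" using s_defined[of x y] by (cases "ap s x") auto
  obtain q where q: "ap p y = Some q" using s_defined[of x y] p by (cases "ap p y") auto
  show thesis using that[OF p q] s_app[of x y] p q by simp
qed

lemma lam: "\<exists>q. ev e (lam n t) = Some q \<and> (\<forall>x. ap q x = ev (e(n := x)) t)"
proof (induction t)
  case (Var m)
  obtain p q where s: "ap s k = Some p" "ap p k = Some q" "\<And>z. ap q z = papp ap (ap k z) (ap k z)"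
    by (rule ap_s) blast
  have "ap q z = Some z" for z
    using s(3)[of z] by simp
  moreover obtain r where "ap k (e m) = Some r" "\<And>y. ap r y = Some (e m)" by (rule ap_k) blast
  ultimately show ?case using s by simp
next
  case (Cst c)
  obtain r where "ap k c = Some r" "\<And>y. ap r y = Some c" by (rule ap_k) blast
  then show ?case by simp
next
  case (Ap t u)
  then obtain a b where a: "ev e (lam n t) = Some a" "\<forall>x. ap a x = ev (e(n := x)) t"
    and b: "ev e (lam n u) = Some b" "\<forall>x. ap b x = ev (e(n := x)) u" by blast
  obtain p q where "ap s a = Some p" "ap p b = Some q" "\<And>z. ap q z = papp ap (ap a z) (ap b z)"
    by (rule ap_s) blast
  then show ?case using a b by (simp del: fun_upd_apply)
qed

lemma complete1: "\<exists>q. \<forall>x. ap q x = ev (e(0 := x)) t"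
  using lam[of e 0 t] by blast

lemma complete2: "\<exists>q. \<forall>x. \<exists>r. ap q x = Some r \<and> (\<forall>y. ap r y = ev (e(0 := x, 1 := y)) t)"
proof -
  obtain q where "\<forall>x. ap q x = ev (e(0 := x)) (lam 1 t)" using complete1 by blast
  then show ?thesis using lam[of _ 1 t] by metis
qed

lemma complete3: "\<exists>q. \<forall>x. \<exists>r. ap q x = Some r \<and> (\<forall>y. \<exists>r'. ap r y = Some r' \<and>
    (\<forall>z. ap r' z = ev (e(0 := x, 1 := y, 2 := z)) t))"
proof -
  obtain q where "\<forall>x. \<exists>r. ap q x = Some r \<and> (\<forall>y. ap r y = ev (e(0 := x, 1 := y)) (lam 2 t))"
    using complete2 by blast
  then show ?thesis using lam[of _ 2 t] by metis
qed

text \<open>A fixed point operator in the style of Turing: \<open>z\<close> is \<open>w w\<close>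
  with \<open>w = \<lambda>x y v. y (x x y) v\<close>. The third argument delays the unfolding, so
  that \<open>z f\<close> is always defined.\<close>

lemma fixpoint: "\<exists>z. \<forall>f. \<exists>r. ap z f = Some r \<and> (\<forall>x. ap r x = papp ap (ap f r) (Some x))"
proof -
  obtain w where w: "\<forall>x. \<exists>r. ap w x = Some r \<and> (\<forall>y. \<exists>r'. ap r y = Some r' \<and>
    (\<forall>z. ap r' z = ev ((\<lambda>_. k)(0 := x, 1 := y, 2 := z))
      (Ap (Ap (Var 1) (Ap (Ap (Var 0) (Var 0)) (Var 1))) (Var 2))))"
    using complete3 by blast
  then obtain z where z: "ap w w = Some z" "\<forall>y. \<exists>r'. ap z y = Some r' \<and>
    (\<forall>x. ap r' x = ev ((\<lambda>_. k)(0 := w, 1 := y, 2 := x))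
      (Ap (Ap (Var 1) (Ap (Ap (Var 0) (Var 0)) (Var 1))) (Var 2)))"
    by blast
  have "\<exists>r. ap z f = Some r \<and> (\<forall>x. ap r x = papp ap (ap f r) (Some x))" for f
  proof -
    obtain r where "ap z f = Some r" "\<forall>x. ap r x = ev ((\<lambda>_. k)(0 := w, 1 := f, 2 := x))
      (Ap (Ap (Var 1) (Ap (Ap (Var 0) (Var 0)) (Var 1))) (Var 2))"
      using z(2) by blast
    then show ?thesis using z(1) by simp
  qed
  then show ?thesis by blast
qed

section \<open>Booleans and pairing\<close>

lemma ap_comb_i [simp]: "ap comb_i x = Some x"
proof -
  obtain p q where s: "ap s k = Some p" "ap p k = Some q" "\<And>z. ap q z = papp ap (ap k z) (ap k z)"
    by (rule ap_s) blast
  then have "comb_i = q" by (simp add: comb_i_def app_def)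
  then show ?thesis using s(3)[of x] by simp
qed

abbreviation "false \<equiv> app k comb_i"

lemma ap_false [simp]: "ap false x = Some comb_i"
  by (rule ap_k[of comb_i]) (simp add: app_def)

text \<open>It repeats the closed form of \<open>pair\<close> with terms as components, so that
  evaluation yields the element \<open>pair x y\<close> itself and not merely one that behaves like
  it.\<close>

definition pair_tm :: "'p tm \<Rightarrow> 'p tm \<Rightarrow> 'p tm" where
  "pair_tm a b = Ap (Ap (Cst s) (Ap (Ap (Cst s) (Cst comb_i)) (Ap (Cst k) a))) (Ap (Cst k) b)"

lemma pair_props:
  "ev e a = Some x \<Longrightarrow> ev e b = Some y \<Longrightarrow> ev e (pair_tm a b) = Some (pair x y)"
  "ap (pair x y) z = papp ap (ap z x) (Some y)"
proof -
  obtain kx where kx: "ap k x = Some kx" "\<And>z. ap kx z = Some x" by (rule ap_k) blast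
  obtain ky where ky: "ap k y = Some ky" "\<And>z. ap ky z = Some y" by (rule ap_k) blast
  obtain p q where pq: "ap s comb_i = Some p" "ap p kx = Some q" "\<And>z. ap q z = papp ap (ap comb_i z) (ap kx z)"
    by (rule ap_s) blast
  obtain p' q' where pq': "ap s q = Some p'" "ap p' ky = Some q'" "\<And>z. ap q' z = papp ap (ap q z) (ap ky z)"
    by (rule ap_s) blast
  have "pair x y = q'" using kx(1) ky(1) pq(1,2) pq'(1,2) by (simp add: pair_def app_def)
  then show "ev e a = Some x \<Longrightarrow> ev e b = Some y \<Longrightarrow> ev e (pair_tm a b) = Some (pair x y)"
    "ap (pair x y) z = papp ap (ap z x) (Some y)"
    using kx ky pq pq' by (simp_all add: pair_tm_def)
qed

lemma pair_proj [simp]: "ap (pair x y) k = Some x" "ap (pair x y) false = Some y"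
  using k_app[of x y] by (simp_all add: pair_props)

end

context coded_pca
begin

text \<open>Recursion on the number of entries already treated. The two branches of the case distinction
  are abstracted over a dummy variable because application is strict.\<close>

lemma bind_rep:
  "\<exists>B. \<forall>f. \<exists>r. ap B f = Some r \<and>
    (\<forall>xs \<phi>. (\<forall>x \<in> set xs. ap f x = Some (code (\<phi> x))) \<longrightarrow>
      ap r (code xs) = Some (code (concat (map \<phi> xs))))"
proof -
  obtain l where l: "\<And>xs. ap l (code xs) = Some (numeral_of (length xs))" using length_rep by blast
  obtain p where p: "\<And>xs i. i < length xs \<Longrightarrow> papp ap (ap p (code xs)) (Some (numeral_of i)) = Some (xs ! i)"
    using proj_rep by blast
  obtain c where c: "\<And>xs ys. papp ap (ap c (code xs)) (Some (code ys)) = Some (code (xs @ ys))"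
    using concat_rep by blast
  obtain z where z: "\<And>f. \<exists>r. ap z f = Some r \<and> (\<forall>x. ap r x = papp ap (ap f r) (Some x))"
    using fixpoint by blast
  \<comment> \<open>Variable 0 is \<open>f\<close>, 1 the code of the sequence, 2 the recursive
    call, 3 the counter and 4 the dummy. A successor numeral is a pair with second component its
    predecessor, which \<open>pr\<close> extracts.\<close>
  define pr where "pr = Ap (Var 3) (Cst false)"
  define U where "U = Ap (Ap (Cst c) (Ap (Var 2) pr)) (Ap (Var 0) (Ap (Ap (Cst p) (Var 1)) pr))"
  \<comment> \<open>Applied to \<open>k\<close>, zero yields \<open>k\<close> and a successor yields
    \<open>false\<close>, so the numeral itself selects the branch. The final \<open>k\<close> feeds
    the dummy variable of the branch selected.\<close>
  define T where "T = Ap (Ap (Ap (Ap (Var 3) (Cst k)) (lam 4 (Cst (code [])))) (lam 4 U)) (Cst k)"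
  define e where "e = (\<lambda>_ :: nat. k)"
  obtain B where B: "\<And>x. \<exists>r. ap B x = Some r \<and> (\<forall>y. ap r y =
      ev (e(0 := x, 1 := y)) (Ap (Ap (Cst z) (lam 2 (lam 3 T))) (Ap (Cst l) (Var 1))))"
    using complete2 by blast
  have "\<exists>r. ap B f = Some r \<and> (\<forall>xs \<phi>. (\<forall>x \<in> set xs. ap f x = Some (code (\<phi> x))) \<longrightarrow>
      ap r (code xs) = Some (code (concat (map \<phi> xs))))" for f
  proof -
    obtain r where r: "ap B f = Some r" "\<And>y. ap r y =
      ev (e(0 := f, 1 := y)) (Ap (Ap (Cst z) (lam 2 (lam 3 T))) (Ap (Cst l) (Var 1)))"
      using B by blast
    have "ap r (code xs) = Some (code (concat (map \<phi> xs)))"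
      if \<phi>: "\<forall>x \<in> set xs. ap f x = Some (code (\<phi> x))" for xs \<phi>
    proof -
      let ?e = "e(0 := f, 1 := code xs)"
      obtain G where G: "ev ?e (lam 2 (lam 3 T)) = Some G" "\<And>x. ap G x = ev (?e(2 := x)) (lam 3 T)"
        using lam by blast
      obtain h where h: "ap z G = Some h" "\<And>x. ap h x = papp ap (ap G h) (Some x)"
        using z by blast
      obtain Gh where Gh: "ev (?e(2 := h)) (lam 3 T) = Some Gh" "\<And>x. ap Gh x = ev (?e(2 := h, 3 := x)) T"
        using lam by blast
      have hT: "ap h x = ev (?e(2 := h, 3 := x)) T" for x
        using h(2) G(2) Gh by simp
      \<comment> \<open>Counter \<open>n\<close> accounts for the prefix of length \<open>n\<close>:
        the body at \<open>Suc n\<close> reads the entry with index \<open>n\<close> and appends its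
        block.\<close>
      have "ap h (numeral_of n) = Some (code (concat (map \<phi> (take n xs))))" if "n \<le> length xs" for n
        using that
      proof (induction n)
        case 0
        let ?e' = "?e(2 := h, 3 := numeral_of 0)"
        obtain t0 where t0: "ev ?e' (lam 4 (Cst (code []))) = Some t0" "\<And>x. ap t0 x = Some (code [])"
          using lam[of ?e' 4 "Cst (code [])"] by (metis ev.simps(2))
        obtain t1 where t1: "ev ?e' (lam 4 U) = Some t1"
          using lam by blast
        obtain q where q: "ap k t0 = Some q" "\<And>y. ap q y = Some t0" by (rule ap_k) blast
        have "ev ?e' T = Some (code [])"
          unfolding T_def ev.simps(3) t0(1) t1 using q t0(2) by simp
        then show ?case unfolding hT by simp
      next
        case (Suc n)
        let ?e' = "?e(2 := h, 3 := numeral_of (Suc n))"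
        obtain t0 where t0: "ev ?e' (lam 4 (Cst (code []))) = Some t0"
          using lam by blast
        obtain t1 where t1: "ev ?e' (lam 4 U) = Some t1" "\<And>x. ap t1 x = ev (?e'(4 := x)) U"
          using lam by blast
        have n: "n < length xs" using Suc.prems by simp
        have "ev (?e'(4 := k)) U = papp ap (papp ap (Some c) (ap h (numeral_of n))) (ap f (xs ! n))"
          unfolding U_def pr_def using p[OF n] by simp
        also have "\<dots> = Some (code (concat (map \<phi> (take n xs)) @ \<phi> (xs ! n)))"
          using Suc.IH n \<phi> c by simp
        also have "concat (map \<phi> (take n xs)) @ \<phi> (xs ! n) = concat (map \<phi> (take (Suc n) xs))"
          using n by (simp add: take_Suc_conv_app_nth)
        finally have u: "ap t1 k = Some (code (concat (map \<phi> (take (Suc n) xs))))" unfolding t1(2) .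
        have "ev ?e' T = ap t1 k"
          unfolding T_def ev.simps(3) t0 t1(1) by simp
        then show ?case unfolding hT using u by simp
      qed
      then have "ap h (numeral_of (length xs)) = Some (code (concat (map \<phi> xs)))" by simp
      then show ?thesis using r(2) G(1) h(1) l by simp
    qed
    then show ?thesis using r(1) by blast
  qed
  then show ?thesis by blast
qed

end

section \<open>Herbrand assemblies\<close>

text \<open>The map \<open>emb\<close> of the universe hypothesis makes \<open>'u\<close> infinite, hence closed under products
  and under pairing with \<open>'p\<close>.\<close>

locale assemblies = coded_pca ap k s code
  for ap :: "'p \<Rightarrow> 'p \<Rightarrow> 'p option" and k s :: 'p and code :: "'p list \<Rightarrow> 'p" +
  fixes emb :: "'p \<Rightarrow> 'u"
  assumes inj_emb: "inj emb"
begin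

abbreviation H :: "(('u, 'p) hasm, ('u, 'p) hmor) cat" where
  "H \<equiv> HAsm ap code"

lemma inv_code [simp]: "inv code (code xs) = xs"
  using inj_code by simp

lemma code_eq [simp]: "code xs = code ys \<longleftrightarrow> xs = ys"
  using inj_code by (simp add: inj_eq)

lemma code_in_bang [simp]: "code xs \<in> bang code A \<longleftrightarrow> set xs \<subseteq> A"
  by (auto simp: bang_def)

lemma bangE:
  assumes "m \<in> bang code A" obtains xs where "m = code xs" "set xs \<subseteq> A"
  using assms by (auto simp: bang_def)

text \<open>Upward closure thereby becomes monotonicity in the set of entries, the form in which it
  is used from here on.\<close>

lemma seq_le_code [simp]: "seq_le code (code xs) (code ys) \<longleftrightarrow> set xs \<subseteq> set ys"
  unfolding seq_le_def code_len_def code_nth_def by (fastforce simp: in_set_conv_nth subset_eq)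

lemma code_in_up [simp]: "code ys \<in> up code A (code xs) \<longleftrightarrow> set ys \<subseteq> A \<and> set xs \<subseteq> set ys"
  by (simp add: up_def)

lemma ex_inj_pair: "\<exists>f :: 'u \<times> 'u \<Rightarrow> 'u. inj f"
proof -
  have "infinite (range code)" using inj_code by (simp add: finite_image_iff infinite_UNIV_listI)
  then have "infinite (UNIV :: 'p set)" by (rule infinite_super[OF subset_UNIV])
  then have "infinite (range emb)" using inj_emb by (simp add: finite_image_iff)
  then have "infinite (UNIV :: 'u set)" by (rule infinite_super[OF subset_UNIV])
  from card_of_Times_same_infinite[OF this] show ?thesis
    unfolding card_of_ordIso[symmetric] by (auto simp: bij_betw_def)
qed

definition enc :: "'u \<times> 'u \<Rightarrow> 'u" where "enc = (SOME f. inj f)"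

lemma inj_enc: "inj enc"
  unfolding enc_def using ex_inj_pair by (rule someI_ex)

definition "dec = inv enc"
definition "encp a m = enc (a, emb m)"
definition "decp u = (fst (dec u), inv emb (snd (dec u)))"

lemma dec [simp]: "dec (enc x) = x" "decp (encp a m) = (a, m)"
  using inj_enc inj_emb by (simp_all add: dec_def decp_def encp_def)

text \<open>This is \<open>tracks\<close> for decoded sequences with its two clauses merged: one
  output sequence serves all elements that the input realizes.\<close>

definition "realizes X Y n f \<longleftrightarrow> (\<forall>xs. set xs \<subseteq> Realz X \<longrightarrow> (\<exists>ys. set ys \<subseteq> Realz Y \<and>
  ap n (code xs) = Some (code ys) \<and> (\<forall>a \<in> Under X. code xs \<in> Rlz X a \<longrightarrow> code ys \<in> Rlz Y (f a))))"

lemma realizesI: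
  assumes "\<And>xs. set xs \<subseteq> Realz X \<Longrightarrow> \<exists>ys. set ys \<subseteq> Realz Y \<and>
    ap n (code xs) = Some (code ys) \<and> (\<forall>a \<in> Under X. code xs \<in> Rlz X a \<longrightarrow> code ys \<in> Rlz Y (f a))"
  shows "realizes X Y n f"
  using assms unfolding realizes_def by blast

lemma realizesE:
  assumes "realizes X Y n f" "set xs \<subseteq> Realz X"
  obtains ys where "set ys \<subseteq> Realz Y" "ap n (code xs) = Some (code ys)"
    "\<And>a. a \<in> Under X \<Longrightarrow> code xs \<in> Rlz X a \<Longrightarrow> code ys \<in> Rlz Y (f a)"
  using assms unfolding realizes_def by blast

lemma hasm_code:
  assumes "is_hasm code X" "a \<in> Under X" "m \<in> Rlz X a"
  obtains xs where "m = code xs" "set xs \<subseteq> Realz X"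
proof -
  have "m \<in> bang code (Realz X)" using assms by (auto simp: is_hasm_def upclosed_def)
  then show thesis using that by (rule bangE)
qed

lemma hasm_ex:
  assumes "is_hasm code X" "a \<in> Under X"
  obtains xs where "code xs \<in> Rlz X a" "set xs \<subseteq> Realz X"
proof -
  obtain m where "m \<in> Rlz X a" using assms by (auto simp: is_hasm_def)
  then show thesis using that hasm_code[OF assms] by metis
qed

lemma hasm_up:
  assumes "is_hasm code X" "a \<in> Under X" "code xs \<in> Rlz X a" "set xs \<subseteq> set ys" "set ys \<subseteq> Realz X"
  shows "code ys \<in> Rlz X a"
proof -
  have "upclosed code (Realz X) (Rlz X a)" using assms by (simp add: is_hasm_def)
  then show ?thesis using assms(3-5) unfolding upclosed_def by force
qed

lemma is_hasmI:
  assumes "Rlz X \<in> extensional (Under X)"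
    and ne: "\<And>a. a \<in> Under X \<Longrightarrow> Rlz X a \<noteq> {}"
    and sub: "\<And>a. a \<in> Under X \<Longrightarrow> Rlz X a \<subseteq> bang code (Realz X)"
    and up: "\<And>a xs ys. a \<in> Under X \<Longrightarrow> code xs \<in> Rlz X a \<Longrightarrow> set xs \<subseteq> set ys \<Longrightarrow> set ys \<subseteq> Realz X \<Longrightarrow> code ys \<in> Rlz X a"
  shows "is_hasm code X"
proof -
  have "n \<in> Rlz X a"
    if a: "a \<in> Under X" and m: "m \<in> Rlz X a" and n: "n \<in> bang code (Realz X)" and mn: "seq_le code m n" for a m n
  proof -
    obtain xs where "m = code xs" using sub[OF a] m by (blast elim: bangE)
    moreover obtain ys where "n = code ys" "set ys \<subseteq> Realz X" using n by (rule bangE)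
    ultimately show ?thesis using up[OF a] m mn by simp
  qed
  then show ?thesis using assms(1) ne sub by (simp add: is_hasm_def upclosed_def)
qed

lemma tracks_iff:
  assumes X: "is_hasm code X"
  shows "tracks ap code X Y n f \<longleftrightarrow> realizes X Y n f"
proof
  assume T: "tracks ap code X Y n f"
  show "realizes X Y n f"
  proof (rule realizesI)
    fix xs assume xs: "set xs \<subseteq> Realz X"
    then obtain r where r: "r \<in> bang code (Realz Y)" "ap n (code xs) = Some r"
      using T unfolding tracks_def by (metis code_in_bang)
    obtain ys where ys: "r = code ys" "set ys \<subseteq> Realz Y" using r(1) by (rule bangE)
    have "code ys \<in> Rlz Y (f a)" if "a \<in> Under X" "code xs \<in> Rlz X a" for a
      using T that r(2) ys(1) unfolding tracks_def by fastforce
    then show "\<exists>ys. set ys \<subseteq> Realz Y \<and> ap n (code xs) = Some (code ys) \<and>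
        (\<forall>a \<in> Under X. code xs \<in> Rlz X a \<longrightarrow> code ys \<in> Rlz Y (f a))"
      using r ys by blast
  qed
next
  assume R: "realizes X Y n f"
  have "\<exists>r \<in> bang code (Realz Y). ap n m = Some r" if m: "m \<in> bang code (Realz X)" for m
  proof -
    obtain xs where xs: "m = code xs" "set xs \<subseteq> Realz X" using m by (rule bangE)
    obtain ys where "set ys \<subseteq> Realz Y" "ap n (code xs) = Some (code ys)" using realizesE[OF R xs(2)] .
    then show ?thesis using xs by simp
  qed
  moreover have "\<exists>r \<in> Rlz Y (f a). ap n m = Some r" if m: "a \<in> Under X" "m \<in> Rlz X a" for a m
  proof -
    obtain xs where xs: "m = code xs" "set xs \<subseteq> Realz X" using hasm_code[OF X m] .
    obtain ys where "ap n (code xs) = Some (code ys)"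
      "\<And>a. a \<in> Under X \<Longrightarrow> code xs \<in> Rlz X a \<Longrightarrow> code ys \<in> Rlz Y (f a)"
      using realizesE[OF R xs(2)] by metis
    then show ?thesis using xs m by auto
  qed
  ultimately show "tracks ap code X Y n f" unfolding tracks_def by blast
qed

lemma realizes_cong: "(\<And>a. a \<in> Under X \<Longrightarrow> f a = g a) \<Longrightarrow> realizes X Y n f \<Longrightarrow> realizes X Y n g"
  unfolding realizes_def by simp

lemma realizes_id:
  assumes "Realz X \<subseteq> Realz Y" "\<And>a. a \<in> Under X \<Longrightarrow> Rlz X a \<subseteq> Rlz Y (f a)"
  shows "realizes X Y comb_i f"
  using assms by (intro realizesI) auto

lemma realizes_comp:
  assumes "realizes X Y n f" "realizes Y Z m g" "f \<in> Under X \<rightarrow> Under Y"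
  shows "\<exists>q. realizes X Z q (\<lambda>a. g (f a))"
proof -
  obtain q where q: "\<And>x. ap q x = papp ap (Some m) (ap n x)"
    using complete1[of "\<lambda>_. k" "Ap (Cst m) (Ap (Cst n) (Var 0))"] by auto
  have "realizes X Z q (\<lambda>a. g (f a))"
  proof (rule realizesI)
    fix xs assume "set xs \<subseteq> Realz X"
    then obtain ys where ys: "set ys \<subseteq> Realz Y" "ap n (code xs) = Some (code ys)"
      "\<And>a. a \<in> Under X \<Longrightarrow> code xs \<in> Rlz X a \<Longrightarrow> code ys \<in> Rlz Y (f a)"
      using realizesE[OF assms(1)] by metis
    obtain zs where zs: "set zs \<subseteq> Realz Z" "ap m (code ys) = Some (code zs)"
      "\<And>a. a \<in> Under Y \<Longrightarrow> code ys \<in> Rlz Y a \<Longrightarrow> code zs \<in> Rlz Z (g a)"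
      using realizesE[OF assms(2) ys(1)] by metis
    show "\<exists>zs. set zs \<subseteq> Realz Z \<and> ap q (code xs) = Some (code zs) \<and>
        (\<forall>a \<in> Under X. code xs \<in> Rlz X a \<longrightarrow> code zs \<in> Rlz Z (g (f a)))"
      using ys zs q funcset_mem[OF assms(3)] by (intro exI[of _ zs]) auto
  qed
  then show ?thesis by blast
qed

lemma realizes_const:
  assumes "set ys \<subseteq> Realz Y" "\<And>a. a \<in> Under X \<Longrightarrow> code ys \<in> Rlz Y (f a)"
  shows "\<exists>n. realizes X Y n f"
proof -
  obtain n where "\<And>x. ap n x = Some (code ys)" by (rule ap_k[of "code ys"]) blast
  then have "realizes X Y n f" using assms by (intro realizesI) auto
  then show ?thesis by blast
qed

text \<open>This is the principal source of realizers. The entrywise function refers to entries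
  only, and elements of the assembly appear just in the condition on the concatenation.\<close>

lemma realizes_bind:
  assumes h: "\<And>x. x \<in> Realz X \<Longrightarrow> ap h x = Some (code (\<phi> x)) \<and> set (\<phi> x) \<subseteq> Realz Y"
    and f: "\<And>a xs. a \<in> Under X \<Longrightarrow> code xs \<in> Rlz X a \<Longrightarrow> set xs \<subseteq> Realz X \<Longrightarrow>
      code (concat (map \<phi> xs)) \<in> Rlz Y (f a)"
  shows "\<exists>n. realizes X Y n f"
proof -
  obtain n where n: "\<And>xs \<phi>. (\<forall>x \<in> set xs. ap h x = Some (code (\<phi> x))) \<longrightarrow>
      ap n (code xs) = Some (code (concat (map \<phi> xs)))"
    using bind_rep by metis
  have "realizes X Y n f"
  proof (rule realizesI)
    fix xs assume xs: "set xs \<subseteq> Realz X"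
    then have "ap n (code xs) = Some (code (concat (map \<phi> xs)))" using n h by blast
    moreover have "set (concat (map \<phi> xs)) \<subseteq> Realz Y" using xs h by fastforce
    ultimately show "\<exists>ys. set ys \<subseteq> Realz Y \<and> ap n (code xs) = Some (code ys) \<and>
        (\<forall>a \<in> Under X. code xs \<in> Rlz X a \<longrightarrow> code ys \<in> Rlz Y (f a))"
      using f xs by blast
  qed
  then show ?thesis by blast
qed

section \<open>The category of Herbrand assemblies\<close>

lemma Obj_H [simp]: "X \<in> Obj H \<longleftrightarrow> is_hasm code X"
  by (simp add: HAsm_def)

lemma hom_H: "f \<in> Hom H X Y \<longleftrightarrow> is_hasm code X \<and> is_hasm code Y \<and> Src f = X \<and> Tgt f = Y \<and>
    Fun f \<in> Under X \<rightarrow>\<^sub>E Under Y \<and> (\<exists>n. realizes X Y n (Fun f))"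
  by (auto simp: Hom_def HAsm_def tracks_iff)

lemma hom_Fun: "f \<in> Hom H X Y \<Longrightarrow> x \<in> Under X \<Longrightarrow> Fun f x \<in> Under Y"
  by (auto simp: hom_H)

lemma hom_realized:
  assumes "f \<in> Hom H X Y" obtains n where "realizes X Y n (Fun f)"
  using assms by (auto simp: hom_H)

lemma hom_hasm: "f \<in> Hom H X Y \<Longrightarrow> is_hasm code X" "f \<in> Hom H X Y \<Longrightarrow> is_hasm code Y"
  by (auto simp: hom_H)

lemma hom_eqI:
  assumes "f \<in> Hom H X Y" "g \<in> Hom H X Y" "\<And>x. x \<in> Under X \<Longrightarrow> Fun f x = Fun g x"
  shows "f = g"
proof -
  have "Fun f = Fun g" using assms by (auto simp: hom_H intro: PiE_ext)
  then show ?thesis using assms(1,2) by (simp add: hom_H)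
qed

definition mor :: "('u, 'p) hasm \<Rightarrow> ('u, 'p) hasm \<Rightarrow> ('u \<Rightarrow> 'u) \<Rightarrow> ('u, 'p) hmor" where
  "mor X Y f = \<lparr>Src = X, Tgt = Y, Fun = restrict f (Under X)\<rparr>"

lemma mor_hom:
  assumes "is_hasm code X" "is_hasm code Y" "\<And>a. a \<in> Under X \<Longrightarrow> f a \<in> Under Y" "\<exists>n. realizes X Y n f"
  shows "mor X Y f \<in> Hom H X Y"
  using assms realizes_cong[of X f "restrict f (Under X)"] by (auto simp: hom_H mor_def)

lemma Fun_mor [simp]: "x \<in> Under X \<Longrightarrow> Fun (mor X Y f) x = f x"
  by (simp add: mor_def)

lemma Fun_comp: "f \<in> Hom H X Y \<Longrightarrow> x \<in> Under X \<Longrightarrow> Fun (Comp H g f) x = Fun g (Fun f x)"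
  unfolding hom_H by (auto simp: HAsm_def compose_def)

lemma Fun_ident: "x \<in> Under X \<Longrightarrow> Fun (Ident H X) x = x"
  by (simp add: HAsm_def)

lemma category_H: "category H"
proof -
  have id: "Ident H X \<in> Hom H X X" if "is_hasm code X" for X
  proof -
    have "Ident H X = mor X X (\<lambda>a. a)" by (simp add: HAsm_def mor_def)
    then show ?thesis using that by (auto intro!: mor_hom exI[of _ comb_i] realizes_id)
  qed
  have comp: "Comp H g f \<in> Hom H X Z" if f: "f \<in> Hom H X Y" and g: "g \<in> Hom H Y Z" for X Y Z f g
  proof -
    have "Comp H g f = mor X Z (\<lambda>x. Fun g (Fun f x))"
      using f g unfolding hom_H by (auto simp: HAsm_def mor_def compose_def)
    moreover obtain n m where "realizes X Y n (Fun f)" "realizes Y Z m (Fun g)"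
      using f g hom_realized by metis
    then have "\<exists>q. realizes X Z q (\<lambda>a. Fun g (Fun f a))"
      using realizes_comp hom_Fun[OF f] by blast
    ultimately show ?thesis using hom_Fun[OF f] hom_Fun[OF g] hom_hasm f g by (auto intro!: mor_hom)
  qed
  show ?thesis
  proof
    fix f assume "f \<in> Arr H"
    then show "Dom H f \<in> Obj H" "Cod H f \<in> Obj H" by (simp_all add: HAsm_def)
  next
    fix f X Y assume f: "f \<in> Hom H X Y"
    show "Comp H f (Ident H X) = f"
      by (rule hom_eqI[OF comp[OF id[OF hom_hasm(1)[OF f]] f] f])
        (simp add: Fun_comp[OF id[OF hom_hasm(1)[OF f]]] Fun_ident)
    show "Comp H (Ident H Y) f = f"
      by (rule hom_eqI[OF comp[OF f id[OF hom_hasm(2)[OF f]]] f])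
        (simp add: Fun_comp[OF f] Fun_ident hom_Fun[OF f])
  next
    fix f g h W X Y Z assume f: "f \<in> Hom H W X" and g: "g \<in> Hom H X Y" and h: "h \<in> Hom H Y Z"
    show "Comp H h (Comp H g f) = Comp H (Comp H h g) f"
      by (rule hom_eqI[OF comp[OF comp[OF f g] h] comp[OF f comp[OF g h]]])
        (simp add: Fun_comp[OF f] Fun_comp[OF g] Fun_comp[OF comp[OF f g]] hom_Fun[OF f])
  qed (use id comp in auto)
qed

sublocale H: category H
  by (rule category_H)

lemma comp_eq_iff:
  assumes "f \<in> Hom H X Y" "g \<in> Hom H Y Z" "f' \<in> Hom H X Y'" "g' \<in> Hom H Y' Z"
  shows "Comp H g f = Comp H g' f' \<longleftrightarrow> (\<forall>x \<in> Under X. Fun g (Fun f x) = Fun g' (Fun f' x))"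
  using hom_eqI[OF H.comp_hom[OF assms(1,2)] H.comp_hom[OF assms(3,4)]] Fun_comp[OF assms(1)] Fun_comp[OF assms(3)]
  by metis

lemma comp_eq_iff1:
  assumes "f \<in> Hom H X Y" "g \<in> Hom H Y Z" "h \<in> Hom H X Z"
  shows "Comp H g f = h \<longleftrightarrow> (\<forall>x \<in> Under X. Fun g (Fun f x) = Fun h x)"
  using hom_eqI[OF H.comp_hom[OF assms(1,2)] assms(3)] Fun_comp[OF assms(1)] by metis

lemma monic_inj:
  assumes m: "m \<in> Hom H X Y" and inj: "inj_on (Fun m) (Under X)"
  shows "monic H m"
proof (rule monicI[OF m])
  fix W a b assume ab: "a \<in> Hom H W X" "b \<in> Hom H W X" "Comp H m a = Comp H m b"
  show "a = b"
    using ab(3) inj hom_Fun[OF ab(1)] hom_Fun[OF ab(2)] unfolding comp_eq_iff[OF ab(1) m ab(2) m]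
    by (intro hom_eqI[OF ab(1,2)]) (auto dest: inj_onD)
qed

section \<open>Partitioned assemblies, subassemblies and finite limits\<close>

definition part :: "'u set \<Rightarrow> 'p set \<Rightarrow> ('u \<Rightarrow> 'p) \<Rightarrow> ('u, 'p) hasm" where
  "part U A g = \<lparr>Under = U, Realz = A, Rlz = (\<lambda>a \<in> U. up code A (code [g a]))\<rparr>"

lemma part_simps [simp]:
  "Under (part U A g) = U" "Realz (part U A g) = A"
  "a \<in> U \<Longrightarrow> code xs \<in> Rlz (part U A g) a \<longleftrightarrow> set xs \<subseteq> A \<and> g a \<in> set xs"
  by (simp_all add: part_def)

lemma part_hasm:
  assumes "\<And>a. a \<in> U \<Longrightarrow> g a \<in> A"
  shows "is_hasm code (part U A g)" "partitioned code (part U A g)"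
proof -
  show 1: "is_hasm code (part U A g)"
  proof (rule is_hasmI)
    fix a assume a: "a \<in> Under (part U A g)"
    then have "code [g a] \<in> Rlz (part U A g) a" using assms by simp
    then show "Rlz (part U A g) a \<noteq> {}" by blast
    show "Rlz (part U A g) a \<subseteq> bang code (Realz (part U A g))"
      using a by (auto simp: part_def up_def)
  qed (auto simp: part_def)
  show "partitioned code (part U A g)"
    using 1 assms unfolding partitioned_def by (auto simp: part_def)
qed

lemma partitionedE:
  assumes "partitioned code X"
  obtains g where "is_hasm code X" "\<And>a. a \<in> Under X \<Longrightarrow> g a \<in> Realz X"
    "\<And>a xs. a \<in> Under X \<Longrightarrow> code xs \<in> Rlz X a \<longleftrightarrow> set xs \<subseteq> Realz X \<and> g a \<in> set xs"
proof -
  obtain g where g: "\<And>a. a \<in> Under X \<Longrightarrow> g a \<in> Realz X \<and> Rlz X a = up code (Realz X) (code [g a])"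
    using assms unfolding partitioned_def by metis
  show thesis using that[of g] g assms by (simp add: partitioned_def)
qed

text \<open>\<open>Realz\<close> is kept whole, so the identity combinator realizes the inclusion
  and a map into the subassembly keeps its realizer.\<close>

definition sub :: "('u, 'p) hasm \<Rightarrow> 'u set \<Rightarrow> ('u, 'p) hasm" where
  "sub X U = \<lparr>Under = Under X \<inter> U, Realz = Realz X, Rlz = restrict (Rlz X) (Under X \<inter> U)\<rparr>"

lemma sub_simps [simp]: "Under (sub X U) = Under X \<inter> U" "Realz (sub X U) = Realz X"
  "a \<in> Under X \<Longrightarrow> a \<in> U \<Longrightarrow> Rlz (sub X U) a = Rlz X a"
  by (simp_all add: sub_def)

lemma sub_hasm: "is_hasm code X \<Longrightarrow> is_hasm code (sub X U)"
  by (auto simp: is_hasm_def sub_def)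

lemma sub_partitioned: "partitioned code X \<Longrightarrow> partitioned code (sub X U)"
  by (auto simp: partitioned_def sub_hasm)

lemma sub_incl: "is_hasm code X \<Longrightarrow> mor (sub X U) X (\<lambda>a. a) \<in> Hom H (sub X U) X"
  by (rule mor_hom) (auto intro!: sub_hasm exI[of _ comb_i] realizes_id)

lemma sub_into:
  assumes h: "h \<in> Hom H W X" and U: "\<And>w. w \<in> Under W \<Longrightarrow> Fun h w \<in> U"
  shows "mor W (sub X U) (Fun h) \<in> Hom H W (sub X U)"
proof (rule mor_hom)
  obtain n where "realizes W X n (Fun h)" using h by (rule hom_realized)
  then have "realizes W (sub X U) n (Fun h)"
    unfolding realizes_def using hom_Fun[OF h] U by simp
  then show "\<exists>n. realizes W (sub X U) n (Fun h)" by blast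
qed (use hom_Fun[OF h] U hom_hasm[OF h] sub_hasm in auto)

lemma equalizer_sub:
  assumes f: "f \<in> Hom H X Y" and g: "g \<in> Hom H X Y"
  shows "equalizer H X Y f g (sub X {a. Fun f a = Fun g a}) (mor (sub X {a. Fun f a = Fun g a}) X (\<lambda>a. a))"
    (is "equalizer H X Y f g ?E ?i")
proof -
  note i = sub_incl[OF hom_hasm(1)[OF f], of "{a. Fun f a = Fun g a}"]
  have "\<exists>!u. u \<in> Hom H W ?E \<and> Comp H ?i u = a"
    if a: "a \<in> Hom H W X" and eq: "Comp H f a = Comp H g a" for W a
  proof -
    have U: "Fun a w \<in> {a. Fun f a = Fun g a}" if "w \<in> Under W" for w
      using eq that unfolding comp_eq_iff[OF a f a g] by simp
    have u: "mor W ?E (Fun a) \<in> Hom H W ?E" by (rule sub_into[OF a U])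
    show ?thesis
    proof (rule ex1I[of _ "mor W ?E (Fun a)"])
      show "mor W ?E (Fun a) \<in> Hom H W ?E \<and> Comp H ?i (mor W ?E (Fun a)) = a"
        using u U hom_Fun[OF a] unfolding comp_eq_iff1[OF u i a] by simp
      fix v assume v: "v \<in> Hom H W ?E \<and> Comp H ?i v = a"
      then have v1: "v \<in> Hom H W ?E" by blast
      show "v = mor W ?E (Fun a)"
        using v hom_Fun[OF v1] unfolding comp_eq_iff1[OF v1 i a] by (intro hom_eqI[OF v1 u]) auto
    qed
  qed
  moreover have "Comp H f ?i = Comp H g ?i" unfolding comp_eq_iff[OF i f i g] by simp
  ultimately show ?thesis unfolding equalizer_def using f g i by blast
qed

text \<open>\<open>undefined\<close> and \<open>k\<close> serve as available elements of the two
  types.\<close>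

definition "one = part {undefined} {k} (\<lambda>_. k)"

lemma one_hasm: "is_hasm code one" "partitioned code one"
  unfolding one_def by (rule part_hasm; simp)+

lemma terminal_one: "terminal H one"
proof -
  have "\<exists>!u. u \<in> Hom H X one" if X: "is_hasm code X" for X
  proof (rule ex1I)
    have "\<exists>n. realizes X one n (\<lambda>_. undefined)"
      by (rule realizes_const[of "[k]"]) (simp_all add: one_def)
    then show u: "mor X one (\<lambda>_. undefined) \<in> Hom H X one"
      by (intro mor_hom X one_hasm) (auto simp: one_def)
    show "v = mor X one (\<lambda>_. undefined)" if v: "v \<in> Hom H X one" for v
      by (rule hom_eqI[OF v u]) (use hom_Fun[OF v] in \<open>auto simp: one_def\<close>)
  qed
  then show ?thesis using one_hasm by (simp add: terminal_def)
qed

text \<open>One sequence realizing \<open>a\<close> can be output constantly, so every element is a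
  global point. This gives access to the elements of a pullback.\<close>

lemma point_hom:
  assumes X: "is_hasm code X" "a \<in> Under X"
  shows "mor one X (\<lambda>_. a) \<in> Hom H one X"
proof -
  obtain xs where "code xs \<in> Rlz X a" "set xs \<subseteq> Realz X" using hasm_ex[OF X] .
  then show ?thesis
    by (intro mor_hom one_hasm X realizes_const[of xs]) (auto simp: X)
qed

text \<open>\<open>c\<close> is a curried realizer of the operation \<open>ap'\<close> that merges
  realizers of the two components. Leaving it open covers both the product of arbitrary assemblies
  and the partitioned product.\<close>

lemma productI:
  assumes X: "is_hasm code X" and Y: "is_hasm code Y" and Q: "is_hasm code Q"
    and U: "Under Q = enc ` (Under X \<times> Under Y)"
    and p1: "\<exists>n. realizes Q X n (\<lambda>u. fst (dec u))" and p2: "\<exists>n. realizes Q Y n (\<lambda>u. snd (dec u))"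
    and c: "\<And>x. \<exists>r. ap c x = Some r \<and> (\<forall>y. ap r y = ap' x y)"
    and c': "\<And>xs ys. set xs \<subseteq> Realz X \<Longrightarrow> set ys \<subseteq> Realz Y \<Longrightarrow> \<exists>zs. set zs \<subseteq> Realz Q \<and>
      ap' (code xs) (code ys) = Some (code zs) \<and>
      (\<forall>a \<in> Under X. \<forall>b \<in> Under Y. code xs \<in> Rlz X a \<longrightarrow> code ys \<in> Rlz Y b \<longrightarrow> code zs \<in> Rlz Q (enc (a, b)))"
  shows "product H X Y Q (mor Q X (\<lambda>u. fst (dec u))) (mor Q Y (\<lambda>u. snd (dec u)))"
proof -
  let ?p = "mor Q X (\<lambda>u. fst (dec u))" and ?q = "mor Q Y (\<lambda>u. snd (dec u))"
  have p: "?p \<in> Hom H Q X" and q: "?q \<in> Hom H Q Y"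
    using p1 p2 U by (auto intro!: mor_hom X Y Q)
  have "\<exists>!u. u \<in> Hom H W Q \<and> Comp H ?p u = f \<and> Comp H ?q u = g"
    if f: "f \<in> Hom H W X" and g: "g \<in> Hom H W Y" for W f g
  proof -
    obtain nf where nf: "realizes W X nf (Fun f)" using f by (rule hom_realized)
    obtain ng where ng: "realizes W Y ng (Fun g)" using g by (rule hom_realized)
    obtain n where n: "\<And>x. ap n x = papp ap (papp ap (Some c) (ap nf x)) (ap ng x)"
      using complete1[of "\<lambda>_. k" "Ap (Ap (Cst c) (Ap (Cst nf) (Var 0))) (Ap (Cst ng) (Var 0))"] by auto
    let ?h = "\<lambda>w. enc (Fun f w, Fun g w)"
    have "realizes W Q n ?h"
    proof (rule realizesI)
      fix ws assume ws: "set ws \<subseteq> Realz W"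
      obtain xs where xs: "set xs \<subseteq> Realz X" "ap nf (code ws) = Some (code xs)"
        "\<And>a. a \<in> Under W \<Longrightarrow> code ws \<in> Rlz W a \<Longrightarrow> code xs \<in> Rlz X (Fun f a)"
        using realizesE[OF nf ws] by metis
      obtain ys where ys: "set ys \<subseteq> Realz Y" "ap ng (code ws) = Some (code ys)"
        "\<And>a. a \<in> Under W \<Longrightarrow> code ws \<in> Rlz W a \<Longrightarrow> code ys \<in> Rlz Y (Fun g a)"
        using realizesE[OF ng ws] by metis
      obtain r where r: "ap c (code xs) = Some r" "\<And>y. ap r y = ap' (code xs) y" using c by blast
      obtain zs where zs: "set zs \<subseteq> Realz Q" "ap' (code xs) (code ys) = Some (code zs)"
        "\<forall>a \<in> Under X. \<forall>b \<in> Under Y. code xs \<in> Rlz X a \<longrightarrow> code ys \<in> Rlz Y b \<longrightarrow> code zs \<in> Rlz Q (enc (a, b))"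
        using c'[OF xs(1) ys(1)] by blast
      show "\<exists>zs. set zs \<subseteq> Realz Q \<and> ap n (code ws) = Some (code zs) \<and>
          (\<forall>a \<in> Under W. code ws \<in> Rlz W a \<longrightarrow> code zs \<in> Rlz Q (enc (Fun f a, Fun g a)))"
        using zs xs ys r n hom_Fun[OF f] hom_Fun[OF g] by (intro exI[of _ zs]) simp
    qed
    then have u: "mor W Q ?h \<in> Hom H W Q"
      using hom_Fun[OF f] hom_Fun[OF g] U by (intro mor_hom hom_hasm(1)[OF f] Q) auto
    have Uh: "?h w \<in> Under Q" if "w \<in> Under W" for w
      using that hom_Fun[OF f] hom_Fun[OF g] U by auto
    show ?thesis
    proof (rule ex1I[of _ "mor W Q ?h"])
      show "mor W Q ?h \<in> Hom H W Q \<and> Comp H ?p (mor W Q ?h) = f \<and> Comp H ?q (mor W Q ?h) = g"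
        using u Uh unfolding comp_eq_iff1[OF u p f] comp_eq_iff1[OF u q g] by simp
      fix v assume v: "v \<in> Hom H W Q \<and> Comp H ?p v = f \<and> Comp H ?q v = g"
      then have v1: "v \<in> Hom H W Q" by blast
      show "v = mor W Q ?h"
      proof (rule hom_eqI[OF v1 u])
        fix w assume w: "w \<in> Under W"
        have "fst (dec (Fun v w)) = Fun f w" "snd (dec (Fun v w)) = Fun g w"
          using v w hom_Fun[OF v1 w] unfolding comp_eq_iff1[OF v1 p f] comp_eq_iff1[OF v1 q g] by auto
        moreover obtain x where "Fun v w = enc x" using hom_Fun[OF v1 w] U by auto
        ultimately show "Fun v w = Fun (mor W Q ?h) w" using w by (metis Fun_mor dec(1) prod.collapse)
      qed
    qed
  qed
  then show ?thesis unfolding product_def using p q by blast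
qed

definition "pfst z = the (ap z k)"
definition "psnd z = the (ap z false)"

lemma pfst_pair [simp]: "pfst (pair x y) = x" "psnd (pair x y) = y"
  by (simp_all add: pfst_def psnd_def)

text \<open>An entry is a pair of codes of whole sequences. Concatenating first and second
  components separately over all entries makes the condition monotone in the set of entries, as
  upward closure demands.\<close>

definition "prod_asm X Y = \<lparr>Under = enc ` (Under X \<times> Under Y),
  Realz = {pair x y |x y. x \<in> bang code (Realz X) \<and> y \<in> bang code (Realz Y)},
  Rlz = (\<lambda>u \<in> enc ` (Under X \<times> Under Y).
    {code zs |zs. set zs \<subseteq> {pair x y |x y. x \<in> bang code (Realz X) \<and> y \<in> bang code (Realz Y)} \<and>
      code (concat (map (\<lambda>z. inv code (pfst z)) zs)) \<in> Rlz X (fst (dec u)) \<and>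
      code (concat (map (\<lambda>z. inv code (psnd z)) zs)) \<in> Rlz Y (snd (dec u))})\<rparr>"

lemma prod_asm:
  assumes X: "is_hasm code X" and Y: "is_hasm code Y"
  shows "is_hasm code (prod_asm X Y)"
    "product H X Y (prod_asm X Y) (mor (prod_asm X Y) X (\<lambda>u. fst (dec u))) (mor (prod_asm X Y) Y (\<lambda>u. snd (dec u)))"
proof -
  let ?Q = "prod_asm X Y"
  let ?f = "\<lambda>z. inv code (pfst z)" and ?g = "\<lambda>z. inv code (psnd z)"
  have U: "Under ?Q = enc ` (Under X \<times> Under Y)" by (simp add: prod_asm_def)
  have rz: "pair (code xs) (code ys) \<in> Realz ?Q"
    if "set xs \<subseteq> Realz X" "set ys \<subseteq> Realz Y" for xs ys
    using that by (force simp: prod_asm_def)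
  have rzE: "\<exists>xs ys. z = pair (code xs) (code ys) \<and> set xs \<subseteq> Realz X \<and> set ys \<subseteq> Realz Y"
    if "z \<in> Realz ?Q" for z
    using that by (auto simp: prod_asm_def elim!: bangE)
  have R: "code zs \<in> Rlz ?Q (enc (a, b)) \<longleftrightarrow> set zs \<subseteq> Realz ?Q \<and>
      code (concat (map ?f zs)) \<in> Rlz X a \<and> code (concat (map ?g zs)) \<in> Rlz Y b"
    if "a \<in> Under X" "b \<in> Under Y" for a b zs
    using that by (simp add: prod_asm_def)
  have sub: "Rlz ?Q u \<subseteq> bang code (Realz ?Q)" if "u \<in> Under ?Q" for u
    using that U by (auto simp: prod_asm_def)
  have fg: "set (?f z) \<subseteq> Realz X" "set (?g z) \<subseteq> Realz Y" if "z \<in> Realz ?Q" for z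
    using rzE[OF that] by auto
  have cc: "set (concat (map ?f zs)) \<subseteq> Realz X" "set (concat (map ?g zs)) \<subseteq> Realz Y" if "set zs \<subseteq> Realz ?Q" for zs
    using fg that by (fastforce)+
  show Q: "is_hasm code ?Q"
  proof (rule is_hasmI)
    show "Rlz ?Q \<in> extensional (Under ?Q)" by (simp add: prod_asm_def)
    fix u assume u: "u \<in> Under ?Q"
    then obtain a b where ab: "u = enc (a, b)" "a \<in> Under X" "b \<in> Under Y" using U by auto
    obtain xs where xs: "code xs \<in> Rlz X a" "set xs \<subseteq> Realz X" using hasm_ex[OF X ab(2)] .
    obtain ys where ys: "code ys \<in> Rlz Y b" "set ys \<subseteq> Realz Y" using hasm_ex[OF Y ab(3)] .
    have "code [pair (code xs) (code ys)] \<in> Rlz ?Q u"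
      unfolding ab(1) R[OF ab(2,3)] using xs ys rz by simp
    then show "Rlz ?Q u \<noteq> {}" by blast
    show "Rlz ?Q u \<subseteq> bang code (Realz ?Q)" using sub[OF u] .
    fix zs zs' assume z: "code zs \<in> Rlz ?Q u" "set zs \<subseteq> set zs'" "set zs' \<subseteq> Realz ?Q"
    have "set (concat (map ?f zs)) \<subseteq> set (concat (map ?f zs'))" "set (concat (map ?g zs)) \<subseteq> set (concat (map ?g zs'))"
      using z(2) by auto
    then show "code zs' \<in> Rlz ?Q u"
      using z hasm_up[OF X ab(2) _ _ cc(1)[OF z(3)]] hasm_up[OF Y ab(3) _ _ cc(2)[OF z(3)]]
      unfolding ab(1) R[OF ab(2,3)] by blast
  qed
  obtain f0 where f0: "\<And>x. ap f0 x = papp ap (Some x) (Some k)"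
    using complete1[of "\<lambda>_. k" "Ap (Var 0) (Cst k)"] by auto
  obtain g0 where g0: "\<And>x. ap g0 x = papp ap (Some x) (Some false)"
    using complete1[of "\<lambda>_. k" "Ap (Var 0) (Cst false)"] by auto
  obtain g where g: "\<And>x. ap g x = Some (code [x])" using singleton_rep by blast
  obtain c where c: "\<And>x. \<exists>r. ap c x = Some r \<and> (\<forall>y. ap r y =
      ev ((\<lambda>_. k)(0 := x, 1 := y)) (Ap (Cst g) (pair_tm (Var 0) (Var 1))))"
    using complete2 by blast
  have evp: "ev ((\<lambda>_. k)(0 := x, 1 := y)) (Ap (Cst g) (pair_tm (Var 0) (Var 1))) = Some (code [pair x y])" for x y
    using pair_props(1)[of "(\<lambda>_. k)(0 := x, 1 := y)" "Var 0" x "Var 1" y] g by simp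
  show "product H X Y ?Q (mor ?Q X (\<lambda>u. fst (dec u))) (mor ?Q Y (\<lambda>u. snd (dec u)))"
  proof (rule productI[OF X Y Q U])
    show "\<exists>n. realizes ?Q X n (\<lambda>u. fst (dec u))"
    proof (rule realizes_bind[where h = f0 and \<phi> = ?f])
      show "ap f0 z = Some (code (?f z)) \<and> set (?f z) \<subseteq> Realz X" if z: "z \<in> Realz ?Q" for z
        using rzE[OF z] fg[OF z] f0 by auto
      show "code (concat (map ?f zs)) \<in> Rlz X (fst (dec u))"
        if "u \<in> Under ?Q" "code zs \<in> Rlz ?Q u" for u zs
        using that U R by auto
    qed
    show "\<exists>n. realizes ?Q Y n (\<lambda>u. snd (dec u))"
    proof (rule realizes_bind[where h = g0 and \<phi> = ?g])
      show "ap g0 z = Some (code (?g z)) \<and> set (?g z) \<subseteq> Realz Y" if z: "z \<in> Realz ?Q" for z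
        using rzE[OF z] fg[OF z] g0 by auto
      show "code (concat (map ?g zs)) \<in> Rlz Y (snd (dec u))"
        if "u \<in> Under ?Q" "code zs \<in> Rlz ?Q u" for u zs
        using that U R by auto
    qed
    show "\<exists>r. ap c x = Some r \<and> (\<forall>y. ap r y = Some (code [pair x y]))" for x
      using c[of x] unfolding evp .
    show "\<exists>zs. set zs \<subseteq> Realz ?Q \<and> Some (code [pair (code xs) (code ys)]) = Some (code zs) \<and>
      (\<forall>a \<in> Under X. \<forall>b \<in> Under Y. code xs \<in> Rlz X a \<longrightarrow> code ys \<in> Rlz Y b \<longrightarrow> code zs \<in> Rlz ?Q (enc (a, b)))"
      if "set xs \<subseteq> Realz X" "set ys \<subseteq> Realz Y" for xs ys
      using that rz R by (intro exI[of _ "[pair (code xs) (code ys)]"]) simp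
  qed
qed

text \<open>The designated entry of a pair of elements is the pair of their designated entries. A
  realizer cannot tell which entries of its inputs are the designated ones, so it forms all pairs,
  by one bind nested in another.\<close>

lemma partitioned_product:
  assumes X: "partitioned code X" and Y: "partitioned code Y"
  shows "\<exists>Q p q. partitioned code Q \<and> product H X Y Q p q"
proof -
  obtain gx where Xh: "is_hasm code X" and gx: "\<And>a. a \<in> Under X \<Longrightarrow> gx a \<in> Realz X"
    "\<And>a xs. a \<in> Under X \<Longrightarrow> code xs \<in> Rlz X a \<longleftrightarrow> set xs \<subseteq> Realz X \<and> gx a \<in> set xs"
    using partitionedE[OF X] by blast
  obtain gy where Yh: "is_hasm code Y" and gy: "\<And>a. a \<in> Under Y \<Longrightarrow> gy a \<in> Realz Y"
    "\<And>a xs. a \<in> Under Y \<Longrightarrow> code xs \<in> Rlz Y a \<longleftrightarrow> set xs \<subseteq> Realz Y \<and> gy a \<in> set xs"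
    using partitionedE[OF Y] by blast
  define A where "A = {pair x y |x y. x \<in> Realz X \<and> y \<in> Realz Y}"
  define Q where "Q = part (enc ` (Under X \<times> Under Y)) A (\<lambda>u. pair (gx (fst (dec u))) (gy (snd (dec u))))"
  have Q: "is_hasm code Q" "partitioned code Q"
  proof -
    have *: "pair (gx (fst (dec u))) (gy (snd (dec u))) \<in> A" if "u \<in> enc ` (Under X \<times> Under Y)" for u
      using that gx(1) gy(1) unfolding A_def by fastforce
    show "is_hasm code Q" unfolding Q_def by (rule part_hasm(1)[OF *])
    show "partitioned code Q" unfolding Q_def by (rule part_hasm(2)[OF *])
  qed
  have AE: "\<exists>x y. z = pair x y \<and> x \<in> Realz X \<and> y \<in> Realz Y" if "z \<in> A" for z
    using that by (auto simp: A_def)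
  have U: "Under Q = enc ` (Under X \<times> Under Y)" "Realz Q = A" by (simp_all add: Q_def)
  have R: "code zs \<in> Rlz Q (enc (a, b)) \<longleftrightarrow> set zs \<subseteq> A \<and> pair (gx a) (gy b) \<in> set zs"
    if "a \<in> Under X" "b \<in> Under Y" for a b zs
    using that by (simp add: Q_def)
  obtain g where g: "\<And>x. ap g x = Some (code [x])" using singleton_rep by blast
  obtain f0 where f0: "\<And>x. ap f0 x = papp ap (Some g) (papp ap (Some x) (Some k))"
    using complete1[of "\<lambda>_. k" "Ap (Cst g) (Ap (Var 0) (Cst k))"] by auto
  obtain g0 where g0: "\<And>x. ap g0 x = papp ap (Some g) (papp ap (Some x) (Some false))"
    using complete1[of "\<lambda>_. k" "Ap (Cst g) (Ap (Var 0) (Cst false))"] by auto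
  obtain B where B: "\<And>f. \<exists>r. ap B f = Some r \<and>
    (\<forall>xs \<phi>. (\<forall>x \<in> set xs. ap f x = Some (code (\<phi> x))) \<longrightarrow> ap r (code xs) = Some (code (concat (map \<phi> xs))))"
    using bind_rep by blast
  \<comment> \<open>Variables 0 and 1 are the two input codes, 2 and 3 the current entries.
    \<open>I\<close> forms the singleton of a pair, and \<open>J\<close> runs over the second
    sequence for a fixed first entry.\<close>
  define I where "I = lam 3 (Ap (Cst g) (pair_tm (Var 2) (Var 3)))"
  define J where "J = lam 2 (Ap (Ap (Cst B) I) (Var 1))"
  define ap' where "ap' x y = ev ((\<lambda>_. k)(0 := x, 1 := y)) (Ap (Ap (Cst B) J) (Var 0))" for x y
  obtain c where c: "\<And>x. \<exists>r. ap c x = Some r \<and> (\<forall>y. ap r y = ap' x y)"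
    unfolding ap'_def using complete2 by blast
  have ap': "ap' (code xs) (code ys) = Some (code (concat (map (\<lambda>x. map (pair x) ys) xs)))" for xs ys
  proof -
    let ?e = "(\<lambda>_. k)(0 := code xs, 1 := code ys)"
    obtain j where j: "ev ?e J = Some j" "\<And>x. ap j x = ev (?e(2 := x)) (Ap (Ap (Cst B) I) (Var 1))"
      unfolding J_def using lam by blast
    have jx: "ap j x = Some (code (map (pair x) ys))" for x
    proof -
      obtain i where i: "ev (?e(2 := x)) I = Some i"
        "\<And>y. ap i y = ev (?e(2 := x, 3 := y)) (Ap (Cst g) (pair_tm (Var 2) (Var 3)))"
        unfolding I_def using lam by blast
      have iy: "ap i y = Some (code [pair x y])" for y
        unfolding i(2) using pair_props(1)[of "?e(2 := x, 3 := y)" "Var 2" x "Var 3" y] g by simp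
      obtain r where r: "ap B i = Some r" "\<And>xs \<phi>. (\<forall>x \<in> set xs. ap i x = Some (code (\<phi> x))) \<Longrightarrow>
          ap r (code xs) = Some (code (concat (map \<phi> xs)))"
        using B by blast
      have "ap r (code ys) = Some (code (concat (map (\<lambda>y. [pair x y]) ys)))"
        by (rule r(2)) (simp add: iy)
      then have "ap r (code ys) = Some (code (map (pair x) ys))" by simp
      then show ?thesis unfolding j(2) ev.simps(3) i(1) using r(1) by simp
    qed
    obtain r where r: "ap B j = Some r" "\<And>xs \<phi>. (\<forall>x \<in> set xs. ap j x = Some (code (\<phi> x))) \<Longrightarrow>
        ap r (code xs) = Some (code (concat (map \<phi> xs)))"
      using B by blast
    have "ap r (code xs) = Some (code (concat (map (\<lambda>x. map (pair x) ys) xs)))"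
      by (rule r(2)) (simp add: jx)
    then show ?thesis unfolding ap'_def ev.simps(3) j(1) using r(1) by simp
  qed
  have "product H X Y Q (mor Q X (\<lambda>u. fst (dec u))) (mor Q Y (\<lambda>u. snd (dec u)))"
  proof (rule productI[OF Xh Yh Q(1) U(1)])
    show "\<exists>n. realizes Q X n (\<lambda>u. fst (dec u))"
    proof (rule realizes_bind[where h = f0 and \<phi> = "\<lambda>z. [pfst z]"])
      show "ap f0 z = Some (code [pfst z]) \<and> set [pfst z] \<subseteq> Realz X" if "z \<in> Realz Q" for z
        using AE[of z] that U(2) f0 g by auto
      fix u zs assume u: "u \<in> Under Q" "code zs \<in> Rlz Q u"
      then obtain a b where ab: "u = enc (a, b)" "a \<in> Under X" "b \<in> Under Y" using U by auto
      then have zs: "set zs \<subseteq> A" "pair (gx a) (gy b) \<in> set zs" using u R by auto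
      have "pfst ` set zs \<subseteq> Realz X" using zs(1) AE by fastforce
      moreover have "gx a \<in> pfst ` set zs" using zs(2) by (metis image_eqI pfst_pair(1))
      ultimately show "code (concat (map (\<lambda>z. [pfst z]) zs)) \<in> Rlz X (fst (dec u))"
        using gx(2)[OF ab(2)] ab(1) by simp
    qed
    show "\<exists>n. realizes Q Y n (\<lambda>u. snd (dec u))"
    proof (rule realizes_bind[where h = g0 and \<phi> = "\<lambda>z. [psnd z]"])
      show "ap g0 z = Some (code [psnd z]) \<and> set [psnd z] \<subseteq> Realz Y" if "z \<in> Realz Q" for z
        using AE[of z] that U(2) g0 g by auto
      fix u zs assume u: "u \<in> Under Q" "code zs \<in> Rlz Q u"
      then obtain a b where ab: "u = enc (a, b)" "a \<in> Under X" "b \<in> Under Y" using U by auto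
      then have zs: "set zs \<subseteq> A" "pair (gx a) (gy b) \<in> set zs" using u R by auto
      have "psnd ` set zs \<subseteq> Realz Y" using zs(1) AE by fastforce
      moreover have "gy b \<in> psnd ` set zs" using zs(2) by (metis image_eqI pfst_pair(2))
      ultimately show "code (concat (map (\<lambda>z. [psnd z]) zs)) \<in> Rlz Y (snd (dec u))"
        using gy(2)[OF ab(3)] ab(1) by simp
    qed
    show "\<exists>r. ap c x = Some r \<and> (\<forall>y. ap r y = ap' x y)" for x by (rule c)
    fix xs ys assume xy: "set xs \<subseteq> Realz X" "set ys \<subseteq> Realz Y"
    let ?zs = "concat (map (\<lambda>x. map (pair x) ys) xs)"
    have "set ?zs \<subseteq> A" using xy by (auto simp: A_def)
    moreover have "code ?zs \<in> Rlz Q (enc (a, b))"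
      if "a \<in> Under X" "b \<in> Under Y" "code xs \<in> Rlz X a" "code ys \<in> Rlz Y b" for a b
      using \<open>set ?zs \<subseteq> A\<close> R[OF that(1,2)] that gx(2)[OF that(1)] gy(2)[OF that(2)] by auto
    ultimately show "\<exists>zs. set zs \<subseteq> Realz Q \<and> ap' (code xs) (code ys) = Some (code zs) \<and>
      (\<forall>a \<in> Under X. \<forall>b \<in> Under Y. code xs \<in> Rlz X a \<longrightarrow> code ys \<in> Rlz Y b \<longrightarrow> code zs \<in> Rlz Q (enc (a, b)))"
      using ap' U(2) by (intro exI[of _ ?zs]) simp
  qed
  then show ?thesis using Q(2) by blast
qed

end

section \<open>Regular epimorphisms and projective assemblies\<close>

context assemblies
begin

abbreviation PS :: "('u, 'p) hasm set" where
  "PS \<equiv> {X. partitioned code X}"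

lemma partitioned_hasm: "partitioned code X \<Longrightarrow> is_hasm code X"
  by (simp add: partitioned_def)

lemma lex_H: "lex_category H"
proof (rule lex_of_products_equalizers(1)[OF fid_functor[OF category_H]])
  show "\<exists>T. terminal H T \<and> terminal H (FObj (fid H) T)"
    using terminal_one one_hasm by (intro exI[of _ one]) simp
next
  fix X Y assume "X \<in> Obj H" "Y \<in> Obj H"
  then have XY: "is_hasm code X" "is_hasm code Y" by simp_all
  note P = prod_asm[OF XY]
  show "\<exists>Z p q. product H X Y Z p q \<and>
      product H (FObj (fid H) X) (FObj (fid H) Y) (FObj (fid H) Z) (FArr (fid H) p) (FArr (fid H) q)"
    using P XY homD(1)[OF productD(1)[OF P(2)]] homD(1)[OF productD(2)[OF P(2)]]
    by (intro exI[of _ "prod_asm X Y"] exI[of _ "mor (prod_asm X Y) X (\<lambda>u. fst (dec u))"]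
        exI[of _ "mor (prod_asm X Y) Y (\<lambda>u. snd (dec u))"]) simp
next
  fix X Y f g assume f: "f \<in> Hom H X Y" and g: "g \<in> Hom H X Y"
  note E = equalizer_sub[OF f g]
  show "\<exists>Z e. equalizer H X Y f g Z e \<and>
      equalizer H (FObj (fid H) X) (FObj (fid H) Y) (FArr (fid H) f) (FArr (fid H) g) (FObj (fid H) Z) (FArr (fid H) e)"
    using E hom_hasm[OF f] sub_hasm[OF hom_hasm(1)[OF f]] homD(1)[OF f] homD(1)[OF g]
      homD(1)[OF equalizerD(3)[OF E]]
    by (intro exI[of _ "sub X {a. Fun f a = Fun g a}"] exI[of _ "mor (sub X {a. Fun f a = Fun g a}) X (\<lambda>a. a)"]) simp
qed

lemma lex_PH: "lex_category (full_sub H PS)" "lex_functor (full_sub H PS) H (inclusion H PS)"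
proof -
  note I = inclusion_functor[OF category_H, of PS]
  have arr: "FArr (inclusion H PS) f = f" if "f \<in> Hom (full_sub H PS) X Y" for f X Y
    using homD(1)[OF that] by simp
  have T: "\<exists>T. terminal (full_sub H PS) T \<and> terminal H (FObj (inclusion H PS) T)"
    using terminal_one one_hasm by (intro exI[of _ one]) (simp add: terminal_full_sub)
  have P: "\<exists>Z p q. product (full_sub H PS) X Y Z p q \<and> product H (FObj (inclusion H PS) X)
      (FObj (inclusion H PS) Y) (FObj (inclusion H PS) Z) (FArr (inclusion H PS) p) (FArr (inclusion H PS) q)"
    if "X \<in> Obj (full_sub H PS)" "Y \<in> Obj (full_sub H PS)" for X Y
  proof -
    have XY: "partitioned code X" "partitioned code Y" "is_hasm code X" "is_hasm code Y"
      using that by simp_all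
    obtain Z p q where Z: "partitioned code Z" "product H X Y Z p q"
      using partitioned_product[OF XY(1,2)] by blast
    have Z': "product (full_sub H PS) X Y Z p q"
      by (rule product_full_sub[OF Z(2)]) (simp_all add: XY Z)
    show ?thesis
      using Z Z' XY partitioned_hasm[OF Z(1)] arr[OF productD(1)[OF Z']] arr[OF productD(2)[OF Z']]
      by (intro exI[of _ Z] exI[of _ p] exI[of _ q]) simp
  qed
  have E: "\<exists>Z e. equalizer (full_sub H PS) X Y f g Z e \<and> equalizer H (FObj (inclusion H PS) X)
      (FObj (inclusion H PS) Y) (FArr (inclusion H PS) f) (FArr (inclusion H PS) g)
      (FObj (inclusion H PS) Z) (FArr (inclusion H PS) e)"
    if fg: "f \<in> Hom (full_sub H PS) X Y" "g \<in> Hom (full_sub H PS) X Y" for X Y f g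
  proof -
    have f: "f \<in> Hom H X Y" and g: "g \<in> Hom H X Y" and XY: "partitioned code X" "partitioned code Y"
      using fg by (auto simp: hom_full_sub split: if_splits)
    let ?E = "sub X {a. Fun f a = Fun g a}"
    note E = equalizer_sub[OF f g]
    have pE: "partitioned code ?E" by (rule sub_partitioned[OF XY(1)])
    have E': "equalizer (full_sub H PS) X Y f g ?E (mor ?E X (\<lambda>a. a))"
      by (rule equalizer_full_sub[OF E]) (simp_all add: XY pE)
    show ?thesis
      using E E' XY pE partitioned_hasm[OF XY(1)] partitioned_hasm[OF XY(2)] partitioned_hasm[OF pE]
        arr[OF fg(1)] arr[OF fg(2)] arr[OF equalizerD(3)[OF E']]
      by (intro exI[of _ ?E] exI[of _ "mor ?E X (\<lambda>a. a)"]) simp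
  qed
  show "lex_category (full_sub H PS)" "lex_functor (full_sub H PS) H (inclusion H PS)"
    using lex_of_products_equalizers[OF I T P E] by blast+
qed

text \<open>Regular epimorphisms are the surjections for which a realizer of \<open>b\<close> can uniformly be turned
  into a realizer of some preimage of \<open>b\<close>.\<close>

definition "covering X Y f \<longleftrightarrow> (\<exists>n. \<forall>ys. set ys \<subseteq> Realz Y \<longrightarrow> (\<exists>xs. set xs \<subseteq> Realz X \<and>
  ap n (code ys) = Some (code xs) \<and>
  (\<forall>b \<in> Under Y. code ys \<in> Rlz Y b \<longrightarrow> (\<exists>a \<in> Under X. Fun f a = b \<and> code xs \<in> Rlz X a))))"

lemma comp_rep: "\<exists>q. \<forall>x. ap q x = papp ap (Some m) (ap n x)"
  using complete1[of "\<lambda>_. k" "Ap (Cst m) (Ap (Cst n) (Var 0))"] by simp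

lemma covering_surj:
  assumes "covering X Y f" "is_hasm code Y" "b \<in> Under Y"
  shows "\<exists>a \<in> Under X. Fun f a = b"
proof -
  obtain ys where "code ys \<in> Rlz Y b" "set ys \<subseteq> Realz Y" using hasm_ex[OF assms(2,3)] .
  then show ?thesis using assms(1,3) unfolding covering_def by blast
qed

text \<open>\<open>h\<close> is constant on the fibres of \<open>e\<close>, because \<open>p\<close>
  and \<open>q\<close> reach every pair of elements of a fibre. The underlying function uses an
  arbitrary preimage \<open>r b\<close>, while the realizer works with the preimage that
  \<open>n\<close> provides; constancy on fibres reconciles the two.\<close>

lemma covering_coequalizer:
  assumes e: "e \<in> Hom H X Y" "covering X Y e" and p: "p \<in> Hom H K X" and q: "q \<in> Hom H K X"
    and eq: "Comp H e p = Comp H e q"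
    and K: "\<And>a a'. a \<in> Under X \<Longrightarrow> a' \<in> Under X \<Longrightarrow> Fun e a = Fun e a' \<Longrightarrow>
      \<exists>t \<in> Under K. Fun p t = a \<and> Fun q t = a'"
  shows "coequalizer H p q e"
proof (rule coequalizerI[OF p q e(1) eq])
  fix W h assume h: "h \<in> Hom H X W" and hpq: "Comp H h p = Comp H h q"
  have hh: "Fun h a = Fun h a'" if "a \<in> Under X" "a' \<in> Under X" "Fun e a = Fun e a'" for a a'
    using K[OF that] hpq unfolding comp_eq_iff[OF p h q h] by auto
  obtain r where r: "\<And>b. b \<in> Under Y \<Longrightarrow> r b \<in> Under X \<and> Fun e (r b) = b"
    using covering_surj[OF e(2) hom_hasm(2)[OF e(1)]] by metis
  obtain m where m: "realizes X W m (Fun h)" using h by (rule hom_realized)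
  obtain n where n: "\<And>ys. set ys \<subseteq> Realz Y \<Longrightarrow> \<exists>xs. set xs \<subseteq> Realz X \<and>
    ap n (code ys) = Some (code xs) \<and>
    (\<forall>b \<in> Under Y. code ys \<in> Rlz Y b \<longrightarrow> (\<exists>a \<in> Under X. Fun e a = b \<and> code xs \<in> Rlz X a))"
    using e(2) unfolding covering_def by blast
  obtain l where l: "\<And>x. ap l x = papp ap (Some m) (ap n x)" using comp_rep by blast
  have "realizes Y W l (\<lambda>b. Fun h (r b))"
  proof (rule realizesI)
    fix ys assume "set ys \<subseteq> Realz Y"
    then obtain xs where xs: "set xs \<subseteq> Realz X" "ap n (code ys) = Some (code xs)"
      "\<forall>b \<in> Under Y. code ys \<in> Rlz Y b \<longrightarrow> (\<exists>a \<in> Under X. Fun e a = b \<and> code xs \<in> Rlz X a)"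
      using n by blast
    obtain zs where zs: "set zs \<subseteq> Realz W" "ap m (code xs) = Some (code zs)"
      "\<And>a. a \<in> Under X \<Longrightarrow> code xs \<in> Rlz X a \<Longrightarrow> code zs \<in> Rlz W (Fun h a)"
      using realizesE[OF m xs(1)] by metis
    have "code zs \<in> Rlz W (Fun h (r b))" if b: "b \<in> Under Y" "code ys \<in> Rlz Y b" for b
    proof -
      obtain a where a: "a \<in> Under X" "Fun e a = b" "code xs \<in> Rlz X a" using xs(3) b by blast
      then have "Fun h (r b) = Fun h a" using hh[of "r b" a] r[OF b(1)] by simp
      then show ?thesis using zs(3)[OF a(1,3)] by simp
    qed
    then show "\<exists>zs. set zs \<subseteq> Realz W \<and> ap l (code ys) = Some (code zs) \<and>
        (\<forall>b \<in> Under Y. code ys \<in> Rlz Y b \<longrightarrow> code zs \<in> Rlz W (Fun h (r b)))"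
      using zs(1,2) xs(2) l by auto
  qed
  then have u: "mor Y W (\<lambda>b. Fun h (r b)) \<in> Hom H Y W"
    using hom_Fun[OF h] r hom_hasm(2)[OF e(1)] hom_hasm(2)[OF h] by (intro mor_hom) auto
  show "\<exists>!u. u \<in> Hom H Y W \<and> Comp H u e = h"
  proof (rule ex1I[of _ "mor Y W (\<lambda>b. Fun h (r b))"])
    have "Fun h (r (Fun e a)) = Fun h a" if "a \<in> Under X" for a
      using hh[of "r (Fun e a)" a] r[OF hom_Fun[OF e(1) that]] that by simp
    then show "mor Y W (\<lambda>b. Fun h (r b)) \<in> Hom H Y W \<and> Comp H (mor Y W (\<lambda>b. Fun h (r b))) e = h"
      using u hom_Fun[OF e(1)] unfolding comp_eq_iff1[OF e(1) u h] by simp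
    fix v assume v: "v \<in> Hom H Y W \<and> Comp H v e = h"
    then have v1: "v \<in> Hom H Y W" by blast
    show "v = mor Y W (\<lambda>b. Fun h (r b))"
    proof (rule hom_eqI[OF v1 u])
      fix b assume b: "b \<in> Under Y"
      have "Fun v (Fun e (r b)) = Fun h (r b)"
        using v r[OF b] unfolding comp_eq_iff1[OF e(1) v1 h] by blast
      then show "Fun v b = Fun (mor Y W (\<lambda>b. Fun h (r b))) b" using r[OF b] b by simp
    qed
  qed
qed

text \<open>The realizers over each fibre are pooled, so that the identity combinator witnesses that
  \<open>X\<close> covers the image.\<close>

definition image_asm :: "('u, 'p) hasm \<Rightarrow> ('u \<Rightarrow> 'u) \<Rightarrow> ('u, 'p) hasm" where
  "image_asm X f = \<lparr>Under = f ` Under X, Realz = Realz X,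
    Rlz = (\<lambda>b \<in> f ` Under X. \<Union>a \<in> {a \<in> Under X. f a = b}. Rlz X a)\<rparr>"

lemma image_asm_simps [simp]: "Under (image_asm X f) = f ` Under X" "Realz (image_asm X f) = Realz X"
  "b \<in> f ` Under X \<Longrightarrow> m \<in> Rlz (image_asm X f) b \<longleftrightarrow> (\<exists>a \<in> Under X. f a = b \<and> m \<in> Rlz X a)"
  by (auto simp: image_asm_def)

lemma image_hasm:
  assumes X: "is_hasm code X"
  shows "is_hasm code (image_asm X f)"
proof (rule is_hasmI)
  show "Rlz (image_asm X f) \<in> extensional (Under (image_asm X f))" by (simp add: image_asm_def)
  fix b assume "b \<in> Under (image_asm X f)"
  then have b: "b \<in> f ` Under X" by simp
  then obtain a where a: "a \<in> Under X" "b = f a" by blast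
  obtain xs where "code xs \<in> Rlz X a" using hasm_ex[OF X a(1)] .
  then show "Rlz (image_asm X f) b \<noteq> {}" using image_asm_simps(3)[OF b] a by blast
  show "Rlz (image_asm X f) b \<subseteq> bang code (Realz (image_asm X f))"
    using image_asm_simps(3)[OF b] X by (auto simp: is_hasm_def upclosed_def)
  fix xs ys assume "code xs \<in> Rlz (image_asm X f) b" "set xs \<subseteq> set ys" "set ys \<subseteq> Realz (image_asm X f)"
  then show "code ys \<in> Rlz (image_asm X f) b"
    using hasm_up[OF X] unfolding image_asm_simps(3)[OF b] by auto
qed

lemma image_cover:
  assumes f: "f \<in> Hom H X Y"
  defines "I \<equiv> image_asm X (Fun f)"
  shows "mor X I (Fun f) \<in> Hom H X I" "covering X I (mor X I (Fun f))"
    "mor I Y (\<lambda>b. b) \<in> Hom H I Y" "Comp H (mor I Y (\<lambda>b. b)) (mor X I (Fun f)) = f"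
proof -
  note X = hom_hasm(1)[OF f] and Y = hom_hasm(2)[OF f]
  have I: "is_hasm code I" unfolding I_def by (rule image_hasm[OF X])
  show e: "mor X I (Fun f) \<in> Hom H X I"
    by (intro mor_hom X I exI[of _ comb_i] realizes_id) (auto simp: I_def)
  show "covering X I (mor X I (Fun f))"
    unfolding covering_def by (intro exI[of _ comb_i]) (auto simp: I_def)
  obtain n where n: "realizes X Y n (Fun f)" using f by (rule hom_realized)
  have "realizes I Y n (\<lambda>b. b)"
  proof (rule realizesI)
    fix xs assume "set xs \<subseteq> Realz I"
    then have "set xs \<subseteq> Realz X" by (simp add: I_def)
    then obtain ys where ys: "set ys \<subseteq> Realz Y" "ap n (code xs) = Some (code ys)"
      "\<And>a. a \<in> Under X \<Longrightarrow> code xs \<in> Rlz X a \<Longrightarrow> code ys \<in> Rlz Y (Fun f a)"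
      using realizesE[OF n] by metis
    have "code ys \<in> Rlz Y b" if b: "b \<in> Under I" "code xs \<in> Rlz I b" for b
    proof -
      have "b \<in> Fun f ` Under X" using b(1) by (simp add: I_def)
      then obtain a where "a \<in> Under X" "Fun f a = b" "code xs \<in> Rlz X a"
        using b(2) unfolding I_def by auto
      then show ?thesis using ys(3) by blast
    qed
    with ys(1,2) show "\<exists>ys. set ys \<subseteq> Realz Y \<and> ap n (code xs) = Some (code ys) \<and>
        (\<forall>b \<in> Under I. code xs \<in> Rlz I b \<longrightarrow> code ys \<in> Rlz Y b)"
      by blast
  qed
  then show m: "mor I Y (\<lambda>b. b) \<in> Hom H I Y"
    using hom_Fun[OF f] by (intro mor_hom I Y) (auto simp: I_def)
  show "Comp H (mor I Y (\<lambda>b. b)) (mor X I (Fun f)) = f"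
    unfolding comp_eq_iff1[OF e m f] by (simp add: I_def)
qed

text \<open>The inclusion of the image is monic and a regular epi factors through it, so it is
  invertible. A realizer of the inverse turns a realizer of \<open>b\<close> into one in the image,
  that is, into a realizer of some preimage.\<close>

lemma regular_epi_covering:
  assumes f: "f \<in> Hom H X Y" and re: "regular_epi H f"
  shows "covering X Y f"
proof -
  define I where "I = image_asm X (Fun f)"
  note c = image_cover[OF f, folded I_def]
  have "inj_on (Fun (mor I Y (\<lambda>b. b))) (Under I)" by (auto simp: inj_on_def)
  then have "monic H (mor I Y (\<lambda>b. b))" using monic_inj[OF c(3)] by blast
  then obtain d where d: "d \<in> Hom H Y I" "Comp H (mor I Y (\<lambda>b. b)) d = Ident H Y"
    using H.regular_epi_extremal[OF re c(1,3) _ c(4)] by metis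
  have dd: "Fun d b = b" if b: "b \<in> Under Y" for b
  proof -
    have "\<forall>b \<in> Under Y. Fun (mor I Y (\<lambda>b. b)) (Fun d b) = Fun (Ident H Y) b"
      using d(2) unfolding comp_eq_iff1[OF d(1) c(3) H.ident_hom[OF H.hom_obj1[OF d(1)]]] .
    then have "Fun (mor I Y (\<lambda>b. b)) (Fun d b) = b" using b by (simp add: Fun_ident)
    then show ?thesis unfolding Fun_mor[OF hom_Fun[OF d(1) b]] .
  qed
  obtain n where n: "realizes Y I n (Fun d)" using d(1) by (rule hom_realized)
  show ?thesis unfolding covering_def
  proof (intro exI[of _ n] allI impI)
    fix ys assume "set ys \<subseteq> Realz Y"
    then obtain xs where xs: "set xs \<subseteq> Realz I" "ap n (code ys) = Some (code xs)"
      "\<And>b. b \<in> Under Y \<Longrightarrow> code ys \<in> Rlz Y b \<Longrightarrow> code xs \<in> Rlz I (Fun d b)"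
      using realizesE[OF n] by metis
    have "\<exists>a \<in> Under X. Fun f a = b \<and> code xs \<in> Rlz X a" if b: "b \<in> Under Y" "code ys \<in> Rlz Y b" for b
    proof -
      have bI: "b \<in> Fun f ` Under X" using hom_Fun[OF d(1) b(1)] dd[OF b(1)] by (simp add: I_def)
      have "code xs \<in> Rlz I b" using xs(3)[OF b] dd[OF b(1)] by simp
      then show ?thesis unfolding I_def image_asm_simps(3)[OF bI] .
    qed
    then show "\<exists>xs. set xs \<subseteq> Realz X \<and> ap n (code ys) = Some (code xs) \<and>
        (\<forall>b \<in> Under Y. code ys \<in> Rlz Y b \<longrightarrow> (\<exists>a \<in> Under X. Fun f a = b \<and> code xs \<in> Rlz X a))"
      using xs(1,2) by (intro exI[of _ xs]) (simp add: I_def)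
  qed
qed

text \<open>The two elements form a pair of global points that \<open>f\<close> identifies, and the
  induced point of the pullback is the required element.\<close>

lemma kernel_pair_points:
  assumes pb: "pullback H f f p q" and f: "f \<in> Hom H X Y"
    and a: "a \<in> Under X" "a' \<in> Under X" "Fun f a = Fun f a'"
  shows "\<exists>t \<in> Under (Dom H p). Fun p t = a \<and> Fun q t = a'"
proof -
  note pq = pullbackD[OF pb f f]
  note x = point_hom[OF hom_hasm(1)[OF f] a(1)] and x' = point_hom[OF hom_hasm(1)[OF f] a(2)]
  have o: "undefined \<in> Under one" by (simp add: one_def)
  have "Comp H f (mor one X (\<lambda>_. a)) = Comp H f (mor one X (\<lambda>_. a'))"
    unfolding comp_eq_iff[OF x f x' f] using a(3) by simp
  then obtain u where u: "u \<in> Hom H one (Dom H p)" "Comp H p u = mor one X (\<lambda>_. a)" "Comp H q u = mor one X (\<lambda>_. a')"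
    using pq(4)[OF x x'] by blast
  show ?thesis
    using u(2,3) hom_Fun[OF u(1) o] o unfolding comp_eq_iff1[OF u(1) pq(1) x] comp_eq_iff1[OF u(1) pq(2) x']
    by (intro bexI[of _ "Fun u undefined"]) auto
qed

lemma covering_regular_epi:
  assumes f: "f \<in> Hom H X Y" and c: "covering X Y f"
  shows "regular_epi H f"
proof -
  obtain p q where pb: "pullback H f f p q" using lex_categoryD(5)[OF lex_H f f] by blast
  note pq = pullbackD[OF pb f f]
  have "coequalizer H p q f"
    by (rule covering_coequalizer[OF f c pq(1,2,3) kernel_pair_points[OF pb f]])
  then show ?thesis by (auto simp: regular_epi_def)
qed

text \<open>Preimages under the composite are pushed forward along \<open>a\<close>, and their
  realizers by a realizer of \<open>a\<close>.\<close>

lemma covering_right_cancel: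
  assumes a: "a \<in> Hom H W X" and h: "h \<in> Hom H X Y" and c: "covering W Y (Comp H h a)"
  shows "covering X Y h"
proof -
  obtain m where m: "realizes W X m (Fun a)" using a by (rule hom_realized)
  obtain n where n: "\<And>ys. set ys \<subseteq> Realz Y \<Longrightarrow> \<exists>ws. set ws \<subseteq> Realz W \<and>
    ap n (code ys) = Some (code ws) \<and>
    (\<forall>b \<in> Under Y. code ys \<in> Rlz Y b \<longrightarrow> (\<exists>w \<in> Under W. Fun (Comp H h a) w = b \<and> code ws \<in> Rlz W w))"
    using c unfolding covering_def by blast
  obtain l where l: "\<And>x. ap l x = papp ap (Some m) (ap n x)" using comp_rep by blast
  show ?thesis unfolding covering_def
  proof (intro exI[of _ l] allI impI)
    fix ys assume "set ys \<subseteq> Realz Y"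
    then obtain ws where ws: "set ws \<subseteq> Realz W" "ap n (code ys) = Some (code ws)"
      "\<forall>b \<in> Under Y. code ys \<in> Rlz Y b \<longrightarrow> (\<exists>w \<in> Under W. Fun (Comp H h a) w = b \<and> code ws \<in> Rlz W w)"
      using n by blast
    obtain xs where xs: "set xs \<subseteq> Realz X" "ap m (code ws) = Some (code xs)"
      "\<And>w. w \<in> Under W \<Longrightarrow> code ws \<in> Rlz W w \<Longrightarrow> code xs \<in> Rlz X (Fun a w)"
      using realizesE[OF m ws(1)] by metis
    have "\<exists>x \<in> Under X. Fun h x = b \<and> code xs \<in> Rlz X x" if b: "b \<in> Under Y" "code ys \<in> Rlz Y b" for b
    proof -
      obtain w where w: "w \<in> Under W" "Fun (Comp H h a) w = b" "code ws \<in> Rlz W w" using ws(3) b by blast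
      then show ?thesis using hom_Fun[OF a w(1)] xs(3)[OF w(1,3)] Fun_comp[OF a w(1)] by auto
    qed
    then show "\<exists>xs. set xs \<subseteq> Realz X \<and> ap l (code ys) = Some (code xs) \<and>
        (\<forall>b \<in> Under Y. code ys \<in> Rlz Y b \<longrightarrow> (\<exists>x \<in> Under X. Fun h x = b \<and> code xs \<in> Rlz X x))"
      using xs(1,2) ws(2) l by auto
  qed
qed

section \<open>Projectivity and partitioned covers\<close>

lemma partitioned_projective:
  assumes P: "partitioned code P"
  shows "projective H P"
proof -
  obtain g where Ph: "is_hasm code P" and g: "\<And>a. a \<in> Under P \<Longrightarrow> g a \<in> Realz P"
    "\<And>a xs. a \<in> Under P \<Longrightarrow> code xs \<in> Rlz P a \<longleftrightarrow> set xs \<subseteq> Realz P \<and> g a \<in> set xs"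
    using partitionedE[OF P] by blast
  have "\<exists>h \<in> Hom H P B. Comp H e h = f"
    if e: "e \<in> Hom H B A" and re: "regular_epi H e" and f: "f \<in> Hom H P A" for A B e f
  proof -
    obtain m where m: "realizes P A m (Fun f)" using f by (rule hom_realized)
    obtain n where n: "\<And>ys. set ys \<subseteq> Realz A \<Longrightarrow> \<exists>xs. set xs \<subseteq> Realz B \<and>
      ap n (code ys) = Some (code xs) \<and>
      (\<forall>b \<in> Under A. code ys \<in> Rlz A b \<longrightarrow> (\<exists>a \<in> Under B. Fun e a = b \<and> code xs \<in> Rlz B a))"
      using regular_epi_covering[OF e re] unfolding covering_def by blast
    obtain sg where sg: "\<And>x. ap sg x = Some (code [x])" using singleton_rep by blast
    obtain l where l: "\<And>x. ap l x = papp ap (Some n) (papp ap (Some m) (ap sg x))"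
      using complete1[of "\<lambda>_. k" "Ap (Cst n) (Ap (Cst m) (Ap (Cst sg) (Var 0)))"] by auto
    \<comment> \<open>The singleton of \<open>x\<close> realizes every \<open>a\<close> with
      designated entry \<open>x\<close>, so one output sequence serves all these elements, possibly
      with different preimages.\<close>
    have "\<exists>bs. set bs \<subseteq> Realz B \<and> ap l x = Some (code bs) \<and>
      (\<forall>a \<in> Under P. g a = x \<longrightarrow> (\<exists>b \<in> Under B. Fun e b = Fun f a \<and> code bs \<in> Rlz B b))"
      if x: "x \<in> Realz P" for x
    proof -
      obtain ys where ys: "set ys \<subseteq> Realz A" "ap m (code [x]) = Some (code ys)"
        "\<And>a. a \<in> Under P \<Longrightarrow> code [x] \<in> Rlz P a \<Longrightarrow> code ys \<in> Rlz A (Fun f a)"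
        using realizesE[OF m, of "[x]"] x by auto
      obtain bs where bs: "set bs \<subseteq> Realz B" "ap n (code ys) = Some (code bs)"
        "\<forall>b \<in> Under A. code ys \<in> Rlz A b \<longrightarrow> (\<exists>a \<in> Under B. Fun e a = b \<and> code bs \<in> Rlz B a)"
        using n[OF ys(1)] by blast
      have "\<exists>b \<in> Under B. Fun e b = Fun f a \<and> code bs \<in> Rlz B b" if "a \<in> Under P" "g a = x" for a
        using bs(3) ys(3)[OF that(1)] g(2)[OF that(1), of "[x]"] x that hom_Fun[OF f that(1)] by simp
      then show ?thesis using bs ys l sg by (intro exI[of _ bs]) simp
    qed
    then obtain \<phi> where \<phi>: "\<And>x. x \<in> Realz P \<Longrightarrow> set (\<phi> x) \<subseteq> Realz B \<and> ap l x = Some (code (\<phi> x)) \<and>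
      (\<forall>a \<in> Under P. g a = x \<longrightarrow> (\<exists>b \<in> Under B. Fun e b = Fun f a \<and> code (\<phi> x) \<in> Rlz B b))"
      by metis
    have "\<exists>b. b \<in> Under B \<and> Fun e b = Fun f a \<and> code (\<phi> (g a)) \<in> Rlz B b" if "a \<in> Under P" for a
      using \<phi>[OF g(1)[OF that]] that by blast
    \<comment> \<open>The preimage \<open>h a\<close> is chosen among those realized by the block of
      the designated entry of \<open>a\<close>.\<close>
    then obtain h where h: "\<And>a. a \<in> Under P \<Longrightarrow> h a \<in> Under B \<and> Fun e (h a) = Fun f a \<and> code (\<phi> (g a)) \<in> Rlz B (h a)"
      by metis
    have "\<exists>r. realizes P B r h"
    proof (rule realizes_bind[of P l \<phi>])
      show "ap l x = Some (code (\<phi> x)) \<and> set (\<phi> x) \<subseteq> Realz B" if "x \<in> Realz P" for x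
        using \<phi>[OF that] by blast
      fix a xs assume a: "a \<in> Under P" "code xs \<in> Rlz P a" "set xs \<subseteq> Realz P"
      then have "g a \<in> set xs" using g(2) by blast
      then have "set (\<phi> (g a)) \<subseteq> set (concat (map \<phi> xs))" by auto
      moreover have "set (concat (map \<phi> xs)) \<subseteq> Realz B" using a(3) \<phi> by fastforce
      ultimately show "code (concat (map \<phi> xs)) \<in> Rlz B (h a)"
        using hasm_up[OF hom_hasm(1)[OF e]] h[OF a(1)] by blast
    qed
    then have u: "mor P B h \<in> Hom H P B" using h by (intro mor_hom Ph hom_hasm(1)[OF e]) auto
    moreover have "Comp H e (mor P B h) = f" unfolding comp_eq_iff1[OF u e f] using h by simp
    ultimately show ?thesis by blast
  qed
  moreover have "P \<in> Obj H" using Ph by simp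
  ultimately show ?thesis unfolding projective_def by blast
qed

text \<open>Realizers of the cover are codes of sequences of codes. Flattening realizes the
  projection, and the singleton operation shows that it is covering.\<close>

lemma partitioned_cover:
  assumes X: "is_hasm code X"
  shows "\<exists>P e. partitioned code P \<and> e \<in> Hom H P X \<and> covering P X e"
proof -
  define U where "U = (\<lambda>(a, m). encp a m) ` (SIGMA a : Under X. Rlz X a)"
  define P where "P = part U (bang code (Realz X)) (\<lambda>u. snd (decp u))"
  have UE: "\<exists>a xs. u = encp a (code xs) \<and> a \<in> Under X \<and> code xs \<in> Rlz X a \<and> set xs \<subseteq> Realz X" if u: "u \<in> U" for u
  proof -
    obtain a m where am: "u = encp a m" "a \<in> Under X" "m \<in> Rlz X a" using u by (auto simp: U_def)
    obtain xs where "m = code xs" "set xs \<subseteq> Realz X" using hasm_code[OF X am(2,3)] .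
    then show ?thesis using am by blast
  qed
  have UI: "encp a m \<in> U" if "a \<in> Under X" "m \<in> Rlz X a" for a m
    using that by (auto simp: U_def)
  have g: "snd (decp u) \<in> bang code (Realz X)" if "u \<in> U" for u
    using UE[OF that] by auto
  have P: "is_hasm code P" unfolding P_def by (rule part_hasm(1)[OF g])
  have P': "partitioned code P" unfolding P_def by (rule part_hasm(2)[OF g])
  have Ps: "Under P = U" "Realz P = bang code (Realz X)" by (simp_all add: P_def)
  have R: "code zs \<in> Rlz P u \<longleftrightarrow> set zs \<subseteq> bang code (Realz X) \<and> snd (decp u) \<in> set zs" if "u \<in> U" for u zs
    using that by (simp add: P_def)
  have "\<exists>n. realizes P X n (\<lambda>u. fst (decp u))"
  \<comment> \<open>Each entry is already the code of a sequence over \<open>Realz X\<close>, so the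
    entrywise function is the identity combinator.\<close>
  proof (rule realizes_bind[where h = comb_i and \<phi> = "inv code"])
    show "ap comb_i x = Some (code (inv code x)) \<and> set (inv code x) \<subseteq> Realz X" if "x \<in> Realz P" for x
      using that unfolding Ps(2) by (elim bangE) simp
    fix u zs assume u: "u \<in> Under P" "code zs \<in> Rlz P u" "set zs \<subseteq> Realz P"
    then obtain a xs where a: "u = encp a (code xs)" "a \<in> Under X" "code xs \<in> Rlz X a" using UE Ps by blast
    then have "code xs \<in> set zs" using u R Ps by auto
    then have "set xs \<subseteq> set (concat (map (inv code) zs))"
      using UN_upper[of "code xs" "set zs" "\<lambda>z. set (inv code z)"] by simp
    moreover have "set (inv code z) \<subseteq> Realz X" if "z \<in> set zs" for z
    proof -
      have "z \<in> bang code (Realz X)" using u(3) that unfolding Ps(2) by blast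
      then show ?thesis by (elim bangE) simp
    qed
    then have "set (concat (map (inv code) zs)) \<subseteq> Realz X" by auto
    ultimately show "code (concat (map (inv code) zs)) \<in> Rlz X (fst (decp u))"
      using hasm_up[OF X a(2,3)] a(1) by simp
  qed
  moreover have "fst (decp u) \<in> Under X" if "u \<in> Under P" for u
    using UE[of u] that Ps by auto
  ultimately have e: "mor P X (\<lambda>u. fst (decp u)) \<in> Hom H P X"
    by (intro mor_hom P X)
  obtain n where n: "\<And>x. ap n x = Some (code [x])" using singleton_rep by blast
  have "covering P X (mor P X (\<lambda>u. fst (decp u)))"
    unfolding covering_def
  proof (intro exI[of _ n] allI impI)
    fix ys assume ys: "set ys \<subseteq> Realz X"
    have "\<exists>u \<in> Under P. Fun (mor P X (\<lambda>u. fst (decp u))) u = b \<and> code [code ys] \<in> Rlz P u"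
      if "b \<in> Under X" "code ys \<in> Rlz X b" for b
      using UI[OF that] R[OF UI[OF that]] ys Ps by (intro bexI[of _ "encp b (code ys)"]) simp_all
    then show "\<exists>xs. set xs \<subseteq> Realz P \<and> ap n (code ys) = Some (code xs) \<and>
        (\<forall>b \<in> Under X. code ys \<in> Rlz X b \<longrightarrow>
          (\<exists>u \<in> Under P. Fun (mor P X (\<lambda>u. fst (decp u))) u = b \<and> code xs \<in> Rlz P u))"
      using n ys Ps(2) by (intro exI[of _ "[code ys]"]) simp
  qed
  then show ?thesis using P' e by blast
qed

lemma partitioned_embedding:
  assumes X: "is_hasm code X"
  shows "\<exists>Q m. partitioned code Q \<and> m \<in> Hom H X Q \<and> monic H m"
proof -
  define Q where "Q = part (Under X) {k} (\<lambda>_. k)"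
  have Q: "is_hasm code Q" "partitioned code Q" unfolding Q_def by (rule part_hasm; simp)+
  have "\<exists>n. realizes X Q n (\<lambda>a. a)"
    by (rule realizes_const[of "[k]"]) (simp_all add: Q_def)
  then have m: "mor X Q (\<lambda>a. a) \<in> Hom H X Q" by (intro mor_hom X Q) (auto simp: Q_def)
  have "monic H (mor X Q (\<lambda>a. a))" by (rule monic_inj[OF m]) (auto simp: inj_on_def)
  then show ?thesis using Q m by blast
qed

text \<open>A kernel pair is coequalized by the map onto the image. Stability under pullback follows
  from partitioned covers: the cover of \<open>Y\<close> lifts through \<open>f\<close>, hence maps
  to the pullback, and its composite with \<open>q\<close> is covering.\<close>

lemma regular_H: "regular_category H"
  unfolding regular_category_def
proof (intro conjI lex_H allI impI)
  fix f p q assume pb: "pullback H f f p q"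
  then obtain X Y where f: "f \<in> Hom H X Y" unfolding pullback_def by blast
  define I where "I = image_asm X (Fun f)"
  note c = image_cover[OF f, folded I_def]
  note pq = pullbackD[OF pb f f]
  have pqe: "Fun f (Fun p t) = Fun f (Fun q t)" if "t \<in> Under (Dom H p)" for t
    using pq(3) that unfolding comp_eq_iff[OF pq(1) f pq(2) f] by blast
  have "coequalizer H p q (mor X I (Fun f))"
  proof (rule covering_coequalizer[OF c(1,2) pq(1,2)])
    show "Comp H (mor X I (Fun f)) p = Comp H (mor X I (Fun f)) q"
      unfolding comp_eq_iff[OF pq(1) c(1) pq(2) c(1)] using pqe hom_Fun[OF pq(1)] hom_Fun[OF pq(2)] by simp
    show "\<exists>t \<in> Under (Dom H p). Fun p t = a \<and> Fun q t = a'"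
      if "a \<in> Under X" "a' \<in> Under X" "Fun (mor X I (Fun f)) a = Fun (mor X I (Fun f)) a'" for a a'
      using kernel_pair_points[OF pb f that(1,2)] that by simp
  qed
  then show "\<exists>e. coequalizer H p q e" by blast
next
  fix f g p q assume *: "pullback H f g p q \<and> regular_epi H f"
  then obtain X Y Z where f: "f \<in> Hom H X Z" and g: "g \<in> Hom H Y Z" unfolding pullback_def by blast
  note pq = pullbackD[OF conjunct1[OF *] f g]
  obtain P e where P: "partitioned code P" and e: "e \<in> Hom H P Y" "covering P Y e"
    using partitioned_cover[OF hom_hasm(1)[OF g]] by blast
  obtain h where h: "h \<in> Hom H P X" "Comp H f h = Comp H g e"
    using partitioned_projective[OF P] f conjunct2[OF *] H.comp_hom[OF e(1) g] unfolding projective_def by blast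
  obtain u where u: "u \<in> Hom H P (Dom H p)" "Comp H q u = e"
    using pq(4)[OF h(1) e(1) h(2)] by blast
  have "covering (Dom H p) Y q"
    by (rule covering_right_cancel[OF u(1) pq(2)]) (simp add: u(2) e(2))
  then show "regular_epi H q" by (rule covering_regular_epi[OF pq(2)])
qed

sublocale enough: enough_projectives H PS
proof
  show "regular_category H" by (rule regular_H)
  show "lex_category (full_sub H PS)" "lex_functor (full_sub H PS) H (inclusion H PS)"
    by (rule lex_PH)+
  show "projective H P" if "P \<in> PS" for P
    using partitioned_projective that by simp
  show "\<exists>P \<in> PS. \<exists>e \<in> Hom H P X. regular_epi H e" if "X \<in> Obj H" for X
  proof -
    have "is_hasm code X" using that by simp
    from partitioned_cover[OF this] obtain P e where "partitioned code P" "e \<in> Hom H P X" "covering P X e"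
      by blast
    then show ?thesis using covering_regular_epi[of e P X] by blast
  qed
  show "\<exists>Q \<in> PS. \<exists>m \<in> Hom H X Q. monic H m" if "X \<in> Obj H" for X
    using partitioned_embedding[of X] that by auto
qed

text \<open>A section \<open>s'\<close> of the cover yields an idempotent on \<open>P\<close>. Its
  splitting is isomorphic to \<open>X\<close> and can be taken inside \<open>P\<close>.\<close>

lemma projective_iff:
  assumes X: "is_hasm code X"
  shows "projective H X \<longleftrightarrow> (\<exists>Y. partitioned code Y \<and> isomorphic H X Y)"
proof
  assume proj: "projective H X"
  obtain P e where P: "partitioned code P" and e: "e \<in> Hom H P X" "covering P X e"
    using partitioned_cover[OF X] by blast
  have "Ident H X \<in> Hom H X X" using X by (intro H.ident_hom) simp
  then obtain s' where s': "s' \<in> Hom H X P" "Comp H e s' = Ident H X"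
    using proj e(1) covering_regular_epi[OF e] unfolding projective_def by blast
  have es: "Fun e (Fun s' a) = a" if a: "a \<in> Under X" for a
    using s'(2) a X unfolding comp_eq_iff1[OF s'(1) e(1) H.ident_hom[OF H.hom_obj1[OF s'(1)]]] by (simp add: Fun_ident)
  \<comment> \<open>The fixed points of the idempotent \<open>s'\<close> after \<open>e\<close>; a
    subassembly of a partitioned assembly is partitioned with the same designated entries.\<close>
  define E where "E = sub P {t. Fun s' (Fun e t) = t}"
  have EP: "partitioned code E" unfolding E_def by (rule sub_partitioned[OF P])
  have i: "mor E P (\<lambda>a. a) \<in> Hom H E P" unfolding E_def by (rule sub_incl[OF partitioned_hasm[OF P]])
  have f: "mor X E (Fun s') \<in> Hom H X E"
    unfolding E_def by (rule sub_into[OF s'(1)]) (simp add: es)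
  note g = H.comp_hom[OF i e(1)]
  note o = H.hom_obj[OF f]
  have "Comp H (Comp H e (mor E P (\<lambda>a. a))) (mor X E (Fun s')) = Ident H X"
    unfolding comp_eq_iff1[OF f g H.ident_hom[OF conjunct1[OF o]]]
    using hom_Fun[OF f] es by (auto simp: Fun_comp[OF i] Fun_ident)
  moreover have "t \<in> Under P" "Fun s' (Fun e t) = t" if "t \<in> Under E" for t
    using that by (auto simp: E_def)
  then have "Comp H (mor X E (Fun s')) (Comp H e (mor E P (\<lambda>a. a))) = Ident H E"
    unfolding comp_eq_iff1[OF g f H.ident_hom[OF conjunct2[OF o]]]
    using hom_Fun[OF e(1)] by (auto simp: Fun_comp[OF i] Fun_ident)
  ultimately have "isomorphic H X E" unfolding isomorphic_def using f g by blast
  then show "\<exists>Y. partitioned code Y \<and> isomorphic H X Y" using EP by blast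
next
  assume "\<exists>Y. partitioned code Y \<and> isomorphic H X Y"
  then show "projective H X" using H.projective_isomorphic partitioned_projective by blast
qed

end

theorem corollary6p4:
  fixes ap :: "'p \<Rightarrow> 'p \<Rightarrow> 'p option" and k s :: 'p and code :: "'p list \<Rightarrow> 'p"
  assumes pca: "coded_pca ap k s code"
    and universe: "\<exists>e :: 'p \<Rightarrow> 'u. inj e"
  shows "(\<forall>X \<in> Obj (HAsm ap code :: (('u, 'p) hasm, ('u, 'p) hmor) cat).
            projective (HAsm ap code) X \<longleftrightarrow>
            (\<exists>Y. partitioned code Y \<and> isomorphic (HAsm ap code) X Y)) \<and>
         reg_lex_completion TYPE(('d, 'e) cat)
           (PHAsm ap code :: (('u, 'p) hasm, ('u, 'p) hmor) cat) (HAsm ap code)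
           (inclusion (HAsm ap code) {X. partitioned code X}) \<and>
         (\<forall>(R :: ('d, 'e) cat) H.
            reg_lex_completion TYPE(('d, 'e) cat)
              (PHAsm ap code :: (('u, 'p) hasm, ('u, 'p) hmor) cat) R H \<and>
            reg_lex_completion TYPE((('u, 'p) hasm, ('u, 'p) hmor) cat)
              (PHAsm ap code :: (('u, 'p) hasm, ('u, 'p) hmor) cat) R H \<longrightarrow>
            equivalent_cats (HAsm ap code :: (('u, 'p) hasm, ('u, 'p) hmor) cat) R)"
proof -
  obtain e :: "'p \<Rightarrow> 'u" where "inj e" using universe by blast
  then interpret assemblies ap k s code e
    using pca by (intro assemblies.intro assemblies_axioms.intro)
  show ?thesis
  proof (intro conjI ballI allI impI)
    show "projective H X \<longleftrightarrow> (\<exists>Y. partitioned code Y \<and> isomorphic H X Y)" if "X \<in> Obj H" for X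
      using projective_iff that by simp
    show "reg_lex_completion TYPE(('d, 'e) cat) (full_sub H PS) H (inclusion H PS)"
      by (rule enough.reg_lex_completion_inclusion)
    \<comment> \<open>Freeness of the assemblies is instantiated at both test types; for
      \<open>R\<close> both are supplied by the assumption.\<close>
    show "equivalent_cats H R"
      if "reg_lex_completion TYPE(('d, 'e) cat) (full_sub H PS) R K \<and>
        reg_lex_completion TYPE((('u, 'p) hasm, ('u, 'p) hmor) cat) (full_sub H PS) R K"
      for R :: "('d, 'e) cat" and K
      by (rule reg_lex_completion_unique[OF enough.reg_lex_completion_inclusion
            enough.reg_lex_completion_inclusion conjunct2[OF that] conjunct1[OF that]])
  qed
qed

end
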